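(* Given contextual categories $\mathcal A,\mathcal B,\mathcal C$, a functor $H:|\mathcal A|\times|\mathcal B|\to|\mathcal C|$ is a bimorphism from $(\mathcal A,\mathcal B)$ to $\mathcal C$ (in the sense of conditions (i)–(iv) in the context) if and only if it is a multimorphism (2-ary morphism) from $(\mathcal A,\mathcal B)$ to $\mathcal C$ (in the sense of cellular diagrams, defined in the context).
   Context: A precontextual category $\mathcal C$ consists of: a category $|\mathcal C|$ (with a set of objects); a length function $\ell$ from objects to $\mathbb N$; a function $\partial$ from objects to objects with $\ell(\partial a)=\ell(a)-1$ if $\ell(a)\ge 1$ and $\partial a=a$ if $\ell(a)=0$; for each object $a$ with $\ell(a)\ge1$ a morphism $\mathbf p_a:a\to\partial a$; and a set $\mathbf Q$ of commutative squares in $|\mathcal C|$ having left side some $\mathbf p_a$ and right side some $\mathbf p_b$. A display map (written $\twoheadrightarrow$) is a finite, possibly empty, composite of maps $\mathbf p_a$; its length is $\ell(\text{domain})-\ell(\text{codomain})$. A distinguished square is a finite vertical composite of elements of $\mathbf Q$; length-1 distinguished squares are the elements of $\mathbf Q$. $\mathcal C$ is a contextual category if moreover: there is a unique object $1_{\mathcal C}$ of length $0$, and it is terminal; every element of $\mathbf Q$ is a pullback; $\mathbf Q$ contains the identity square of every $\mathbf p_a$ and is closed under horizontal composition; for every $a$ with $\ell(a)\ge 1$ and $f:b\to\partial a$ there is a unique element of $\mathbf Q$ with right side $\mathbf p_a$ and bottom $f$ (hence any display map has a unique distinguished pullback along any map into its codomain). Gap maps. In a contextual category, let $S$ be a commutative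 square with top $f':b'\to b$, bottom $f:a'\to a$, left side $b'\twoheadrightarrow a'$ and right side $p:b\twoheadrightarrow a$ display maps. Let $c$ be the top-left corner of the distinguished square with right side $p$ and bottom $f$. The induced map $b'\to c$ is the gap map of $S$; $S$ is a relative length-1 display map if its gap map is a length-1 display map. Bimorphisms. A bimorphism from $(\mathcal A,\mathcal B)$ to $\mathcal C$ is a functor $H:|\mathcal A|\times|\mathcal B|\to|\mathcal C|$ such that: (i) for each $b$, $H(-,b)$ preserves display maps (not necessarily their lengths) and sends length-0 objects to $1_{\mathcal C}$, and it is constant at $1_{\mathcal C}$ if $\ell(b)=0$; (ii) for $a,b$ of length $\ge1$ the square with top $H(id_a,\mathbf p_b):H(a,b)\to H(a,\partial b)$, bottom $H(id_{\partial a},\mathbf p_b)$ and vertical sides $H(\mathbf p_a,id)$ is a relative length-1 display map; write $\mathrm{gap}_H(a,b)$ for its gap map; (iii) for $b$ of length $\ge1$ and a square in $\mathbf Q$ of $\mathcal A$ with top $f':a_1\to a_2$, the square with sides $\mathrm{gap}_H(a_1,b)$, $\mathrm{gap}_H(a_2,b)$, top $H(f',id_b)$ and bottom the induced map is distinguished; (iv) for $a$ of length $\ge1$ and a square in $\mathbf Q$ of $\mathcal B$ with top $f':b_1\to b_2$, the square with sides $\mathrm{gap}_H(a,b_1)$, $\mathrm{gap}_H(a,b_2)$, top $H(id_a,f')$ and bottom the induced map is distinguished. Cellular diagrams. A sieve in a poset is a downward closed subset; $x^{\le}=\{y: y\le x\}$, $\partial x=\{y:y<x\}$. For a finite poset $(P,\le)$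 with a linear order $\vartriangleleft$ refining $\le$, a functor $F:(P,\le)^{op}\to|\mathcal C|$ is cellular if one can choose for each sieve $X$ a limit cone $a^X\Rightarrow F|_X$ such that: $a^\varnothing=1_{\mathcal C}$; $a^{x^\le}=F(x)$ with cone given by $F$; if $X\subset Y$ are sieves with $Y\setminus X=\{y\}$ and $x\vartriangleleft y$ for all $x\in X$, then $a^Y\to a^X$ is a length-1 display map; if $X\subset X'$, $Y\subset Y'$, $X\subset Y$, $X'\subset Y'$ are sieves with $Y\setminus X=\{y\}=Y'\setminus X'$ and $x\vartriangleleft y$ for all $x\in X'$, then the induced square with top $a^{Y'}\to a^Y$ and bottom $a^{X'}\to a^X$ is distinguished. Such a choice is unique, and $F[X]:=a^X$. For a poset $P$ with all $x^\le$ finite, a local linearization is a relation $\vartriangleleft$, contained in the set of pairs having a common upper bound, that restricts on each $x^{\le}$ to a linear order refining $\le$; $F:P^{op}\to|\mathcal C|$ is cellular if each restriction to $(x^\le)^{op}$ is; for a sieve $X$ contained in some $x^\le$, $F[X]$ is the object $a^X$ for the restriction to $x^\le$. 2-ary morphisms. $T(\mathcal A)$ is the poset of objects of $\mathcal A$ of length $\ge1$, with $x\le y$ iff there is a display map $y\twoheadrightarrow x$; thus $T(\mathcal A)^{op}$ maps to $|\mathcal A|$ via display maps. $T(\mathcal A)\times T(\mathcal B)$ carries the lexicographic local linearization: $(x_1,x_2)\blacktriangleleft(y_1,y_2)$ iff they are equal, or $x_1<y_1$ and $x_2,y_2$ are comparable, or $x_1=y_1$ and $x_2<y_2$. A multimorphism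 from $(\mathcal A,\mathcal B)$ to $\mathcal C$ is a functor $F:|\mathcal A|\times|\mathcal B|\to|\mathcal C|$ such that: $F(x_1,x_2)=1_{\mathcal C}$ whenever $\ell(x_1)=0$ or $\ell(x_2)=0$; its restriction to $(T(\mathcal A)\times T(\mathcal B))^{op}$ is cellular for $\blacktriangleleft$; and for all length-1 distinguished squares $Q_1$ in $\mathcal A$, $Q_2$ in $\mathcal B$, with top $f_i^0:x_i^0\to y_i^0$ and bottom $f_i^1:x_i^1=\partial x_i^0\to y_i^1=\partial y_i^0$, the square with top $F(f^0_1,f^0_2)$, vertical sides the length-1 display maps $F(x^0_1,x^0_2)\to F[\partial(x^0_1,x^0_2)]$ and $F(y^0_1,y^0_2)\to F[\partial(y^0_1,y^0_2)]$, and bottom the map induced by $F(f_1^1,f_2^0)$, $F(f_1^0,f_2^1)$, $F(f_1^1,f_2^1)$ on the pullbacks $F[\partial(x_1^0,x_2^0)]=F(x_1^1,x_2^0)\times_{F(x_1^1,x_2^1)}F(x_1^0,x_2^1)$ and similarly for $y$, is distinguished. *)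

theory Defs
  imports Main
begin

section \<open>Categories and functors\<close>

record ('o, 'm) category =
  Obj :: "'o set"
  Arr :: "'m set"
  Dom :: "'m \<Rightarrow> 'o"
  Cod :: "'m \<Rightarrow> 'o"
  Ident :: "'o \<Rightarrow> 'm"
  Comp :: "'m \<Rightarrow> 'm \<Rightarrow> 'm"  (infixl "\<cdot>\<index>" 70)

definition hom :: "('o, 'm, 'z) category_scheme \<Rightarrow> 'o \<Rightarrow> 'o \<Rightarrow> 'm set" where
  "hom C a b = {f \<in> Arr C. Dom C f = a \<and> Cod C f = b}"

locale category =
  fixes C :: "('o, 'm, 'z) category_scheme" (structure)
  assumes Dom_in_Obj: "f \<in> Arr C \<Longrightarrow> Dom C f \<in> Obj C"
    and Cod_in_Obj: "f \<in> Arr C \<Longrightarrow> Cod C f \<in> Obj C"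
    and Ident_in_hom: "a \<in> Obj C \<Longrightarrow> Ident C a \<in> hom C a a"
    and Comp_in_hom: "f \<in> hom C a b \<Longrightarrow> g \<in> hom C b c \<Longrightarrow> g \<cdot> f \<in> hom C a c"
    and Comp_Ident_right: "f \<in> hom C a b \<Longrightarrow> f \<cdot> Ident C a = f"
    and Comp_Ident_left: "f \<in> hom C a b \<Longrightarrow> Ident C b \<cdot> f = f"
    and Comp_assoc: "f \<in> hom C a b \<Longrightarrow> g \<in> hom C b c \<Longrightarrow> h \<in> hom C c d
      \<Longrightarrow> h \<cdot> (g \<cdot> f) = (h \<cdot> g) \<cdot> f"

definition prod_category ::
  "('o, 'm, 'z) category_scheme \<Rightarrow> ('p, 'n, 'y) category_scheme \<Rightarrow> ('o \<times> 'p, 'm \<times> 'n) category"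
where
  "prod_category A B =
    \<lparr>Obj = Obj A \<times> Obj B,
     Arr = Arr A \<times> Arr B,
     Dom = (\<lambda>(f, g). (Dom A f, Dom B g)),
     Cod = (\<lambda>(f, g). (Cod A f, Cod B g)),
     Ident = (\<lambda>(a, b). (Ident A a, Ident B b)),
     Comp = (\<lambda>(f', g') (f, g). (f' \<cdot>\<^bsub>A\<^esub> f, g' \<cdot>\<^bsub>B\<^esub> g))\<rparr>"

record ('o, 'm, 'p, 'n) functor_data =
  omap :: "'o \<Rightarrow> 'p"
  amap :: "'m \<Rightarrow> 'n"

definition is_functor ::
  "('o, 'm, 'z) category_scheme \<Rightarrow> ('p, 'n, 'y) category_scheme
    \<Rightarrow> ('o, 'm, 'p, 'n) functor_data \<Rightarrow> bool"
where
  "is_functor C D F \<longleftrightarrow>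
    (\<forall>a \<in> Obj C. omap F a \<in> Obj D) \<and>
    (\<forall>f \<in> Arr C. amap F f \<in> hom D (omap F (Dom C f)) (omap F (Cod C f))) \<and>
    (\<forall>a \<in> Obj C. amap F (Ident C a) = Ident D (omap F a)) \<and>
    (\<forall>f \<in> Arr C. \<forall>g \<in> Arr C. Cod C f = Dom C g
      \<longrightarrow> amap F (g \<cdot>\<^bsub>C\<^esub> f) = amap F g \<cdot>\<^bsub>D\<^esub> amap F f)"

definition is_cone ::
  "('j, 'i, 'y) category_scheme \<Rightarrow> ('o, 'm, 'z) category_scheme
    \<Rightarrow> ('j, 'i, 'o, 'm) functor_data \<Rightarrow> 'o \<Rightarrow> ('j \<Rightarrow> 'm) \<Rightarrow> bool"
where
  "is_cone J C F a \<pi> \<longleftrightarrow>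
    a \<in> Obj C \<and>
    (\<forall>j \<in> Obj J. \<pi> j \<in> hom C a (omap F j)) \<and>
    (\<forall>u \<in> Arr J. amap F u \<cdot>\<^bsub>C\<^esub> \<pi> (Dom J u) = \<pi> (Cod J u))"

definition is_limit_cone ::
  "('j, 'i, 'y) category_scheme \<Rightarrow> ('o, 'm, 'z) category_scheme
    \<Rightarrow> ('j, 'i, 'o, 'm) functor_data \<Rightarrow> 'o \<Rightarrow> ('j \<Rightarrow> 'm) \<Rightarrow> bool"
where
  "is_limit_cone J C F a \<pi> \<longleftrightarrow>
    is_cone J C F a \<pi> \<and>
    (\<forall>b \<rho>. is_cone J C F b \<rho> \<longrightarrow> (\<exists>!h. h \<in> hom C b a \<and> (\<forall>j \<in> Obj J. \<pi> j \<cdot>\<^bsub>C\<^esub> h = \<rho> j)))"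

text \<open>The opposite of the poset \<open>P\<close>, with order given by a relation as in
  \<^theory>\<open>HOL.Order_Relation\<close>: the pair \<open>(y, x)\<close> with \<open>x \<le> y\<close> is the arrow from \<open>y\<close> to \<open>x\<close>.\<close>

definition poset_op :: "'p set \<Rightarrow> 'p rel \<Rightarrow> ('p, 'p \<times> 'p) category" where
  "poset_op P le =
    \<lparr>Obj = P,
     Arr = {(y, x). x \<in> P \<and> y \<in> P \<and> (x, y) \<in> le},
     Dom = fst,
     Cod = snd,
     Ident = (\<lambda>x. (x, x)),
     Comp = (\<lambda>(_, x) (y, _). (y, x))\<rparr>"


section \<open>Squares\<close>

text \<open>\<open>Sq t l r b\<close> has top \<open>t\<close>, left side \<open>l\<close>, right side \<open>r\<close> and bottom \<open>b\<close>; horizontal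
  arrows point to the right and vertical ones downwards.\<close>

datatype 'm square = Sq (top: 'm) (left: 'm) (right: 'm) (bottom: 'm)

definition comm_square :: "('o, 'm, 'z) category_scheme \<Rightarrow> 'm square \<Rightarrow> bool" where
  "comm_square C S \<longleftrightarrow>
    {top S, left S, right S, bottom S} \<subseteq> Arr C \<and>
    Dom C (top S) = Dom C (left S) \<and> Cod C (top S) = Dom C (right S) \<and>
    Cod C (left S) = Dom C (bottom S) \<and> Cod C (right S) = Cod C (bottom S) \<and>
    right S \<cdot>\<^bsub>C\<^esub> top S = bottom S \<cdot>\<^bsub>C\<^esub> left S"

definition is_pullback :: "('o, 'm, 'z) category_scheme \<Rightarrow> 'm square \<Rightarrow> bool" where
  "is_pullback C S \<longleftrightarrow>
    comm_square C S \<and>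
    (\<forall>u v. comm_square C (Sq u v (right S) (bottom S)) \<longrightarrow>
      (\<exists>!w. w \<in> hom C (Dom C u) (Dom C (top S)) \<and>
        top S \<cdot>\<^bsub>C\<^esub> w = u \<and> left S \<cdot>\<^bsub>C\<^esub> w = v))"

definition pullback_map ::
  "('o, 'm, 'z) category_scheme \<Rightarrow> 'm square \<Rightarrow> 'm square \<Rightarrow> 'm \<Rightarrow> 'm \<Rightarrow> 'm"
where
  "pullback_map C S S' u v =
    (THE w. w \<in> hom C (Dom C (top S)) (Dom C (top S')) \<and>
      top S' \<cdot>\<^bsub>C\<^esub> w = u \<cdot>\<^bsub>C\<^esub> top S \<and> left S' \<cdot>\<^bsub>C\<^esub> w = v \<cdot>\<^bsub>C\<^esub> left S)"


section \<open>Contextual categories\<close>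

record ('o, 'm) precontextual = "('o, 'm) category" +
  len :: "'o \<Rightarrow> nat"
  ft :: "'o \<Rightarrow> 'o"
  proj :: "'o \<Rightarrow> 'm"
  Qsq :: "'m square set"

locale precontextual_category = category C
  for C :: "('o, 'm, 'z) precontextual_scheme" (structure) +
  assumes ft_in_Obj: "a \<in> Obj C \<Longrightarrow> ft C a \<in> Obj C"
    and len_ft: "a \<in> Obj C \<Longrightarrow> len C a \<ge> 1 \<Longrightarrow> len C (ft C a) = len C a - 1"
    and ft_len_0: "a \<in> Obj C \<Longrightarrow> len C a = 0 \<Longrightarrow> ft C a = a"
    and proj_in_hom: "a \<in> Obj C \<Longrightarrow> len C a \<ge> 1 \<Longrightarrow> proj C a \<in> hom C a (ft C a)"
    and Qsq_comm: "S \<in> Qsq C \<Longrightarrow> comm_square C S"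
    and Qsq_left: "S \<in> Qsq C \<Longrightarrow> \<exists>a \<in> Obj C. len C a \<ge> 1 \<and> left S = proj C a"
    and Qsq_right: "S \<in> Qsq C \<Longrightarrow> \<exists>a \<in> Obj C. len C a \<ge> 1 \<and> right S = proj C a"

inductive display_map :: "('o, 'm, 'z) precontextual_scheme \<Rightarrow> 'm \<Rightarrow> bool"
  for C :: "('o, 'm, 'z) precontextual_scheme"
where
  Ident: "a \<in> Obj C \<Longrightarrow> display_map C (Ident C a)"
| Comp_proj: "a \<in> Obj C \<Longrightarrow> len C a \<ge> 1 \<Longrightarrow> display_map C d \<Longrightarrow> Dom C d = ft C a
    \<Longrightarrow> display_map C (d \<cdot>\<^bsub>C\<^esub> proj C a)"

definition display_length :: "('o, 'm, 'z) precontextual_scheme \<Rightarrow> 'm \<Rightarrow> nat" where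
  "display_length C d = len C (Dom C d) - len C (Cod C d)"

definition display_map1 :: "('o, 'm, 'z) precontextual_scheme \<Rightarrow> 'm \<Rightarrow> bool" where
  "display_map1 C d \<longleftrightarrow> display_map C d \<and> display_length C d = 1"

text \<open>The empty vertical composites are the squares with identity vertical sides, so that
  identities (display maps of length 0) also have distinguished pullbacks.\<close>

inductive distinguished :: "('o, 'm, 'z) precontextual_scheme \<Rightarrow> 'm square \<Rightarrow> bool"
  for C :: "('o, 'm, 'z) precontextual_scheme"
where
  empty: "f \<in> Arr C \<Longrightarrow> distinguished C (Sq f (Ident C (Dom C f)) (Ident C (Cod C f)) f)"
| stack: "Sq g l' r' f \<in> Qsq C \<Longrightarrow> distinguished C (Sq f l r b)
    \<Longrightarrow> distinguished C (Sq g (l \<cdot>\<^bsub>C\<^esub> l') (r \<cdot>\<^bsub>C\<^esub> r') b)"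

definition one :: "('o, 'm, 'z) precontextual_scheme \<Rightarrow> 'o" where
  "one C = (THE a. a \<in> Obj C \<and> len C a = 0)"

definition to_one :: "('o, 'm, 'z) precontextual_scheme \<Rightarrow> 'o \<Rightarrow> 'm" where
  "to_one C a = (THE f. f \<in> hom C a (one C))"

locale contextual_category = precontextual_category C
  for C :: "('o, 'm, 'z) precontextual_scheme" (structure) +
  assumes one_unique: "\<exists>!a. a \<in> Obj C \<and> len C a = 0"
    and one_terminal: "a \<in> Obj C \<Longrightarrow> \<exists>!f. f \<in> hom C a (one C)"
    and Qsq_pullback: "S \<in> Qsq C \<Longrightarrow> is_pullback C S"
    and Qsq_Ident: "a \<in> Obj C \<Longrightarrow> len C a \<ge> 1
      \<Longrightarrow> Sq (Ident C a) (proj C a) (proj C a) (Ident C (ft C a)) \<in> Qsq C"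
    and Qsq_horizontal: "Sq t l m b \<in> Qsq C \<Longrightarrow> Sq t' m r b' \<in> Qsq C
      \<Longrightarrow> Sq (t' \<cdot> t) l r (b' \<cdot> b) \<in> Qsq C"
    and Qsq_unique_lift: "a \<in> Obj C \<Longrightarrow> len C a \<ge> 1 \<Longrightarrow> f \<in> Arr C \<Longrightarrow> Cod C f = ft C a
      \<Longrightarrow> \<exists>!S. S \<in> Qsq C \<and> right S = proj C a \<and> bottom S = f"


section \<open>Gap maps\<close>

definition dist_pullback :: "('o, 'm, 'z) precontextual_scheme \<Rightarrow> 'm \<Rightarrow> 'm \<Rightarrow> 'm square" where
  "dist_pullback C p f = (THE S. distinguished C S \<and> right S = p \<and> bottom S = f)"

definition gap :: "('o, 'm, 'z) precontextual_scheme \<Rightarrow> 'm square \<Rightarrow> 'm" where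
  "gap C S =
    (let S' = dist_pullback C (right S) (bottom S) in
     THE u. u \<in> hom C (Dom C (top S)) (Dom C (top S')) \<and>
       top S' \<cdot>\<^bsub>C\<^esub> u = top S \<and> left S' \<cdot>\<^bsub>C\<^esub> u = left S)"

definition relative_display1 :: "('o, 'm, 'z) precontextual_scheme \<Rightarrow> 'm square \<Rightarrow> bool" where
  "relative_display1 C S \<longleftrightarrow>
    comm_square C S \<and> display_map C (left S) \<and> display_map C (right S) \<and> display_map1 C (gap C S)"


section \<open>Bimorphisms\<close>

definition bi_square ::
  "('oa, 'ma, 'za) precontextual_scheme \<Rightarrow> ('ob, 'mb, 'zb) precontextual_scheme
    \<Rightarrow> ('oa \<times> 'ob, 'ma \<times> 'mb, 'oc, 'mc) functor_data \<Rightarrow> 'oa \<Rightarrow> 'ob \<Rightarrow> 'mc square"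
where
  "bi_square A B H a b =
    Sq (amap H (Ident A a, proj B b))
       (amap H (proj A a, Ident B b))
       (amap H (proj A a, Ident B (ft B b)))
       (amap H (Ident A (ft A a), proj B b))"

definition bi_gap ::
  "('oa, 'ma, 'za) precontextual_scheme \<Rightarrow> ('ob, 'mb, 'zb) precontextual_scheme
    \<Rightarrow> ('oc, 'mc, 'zc) precontextual_scheme
    \<Rightarrow> ('oa \<times> 'ob, 'ma \<times> 'mb, 'oc, 'mc) functor_data \<Rightarrow> 'oa \<Rightarrow> 'ob \<Rightarrow> 'mc"
where
  "bi_gap A B C H a b = gap C (bi_square A B H a b)"

text \<open>The distinguished square whose top-left corner is the codomain of \<open>bi_gap A B C H a b\<close>,
  that is, \<open>H(\<partial>a, b) \<times>\<^bsub>H(\<partial>a, \<partial>b)\<^esub> H(a, \<partial>b)\<close> with its projections.\<close>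

definition bi_corner ::
  "('oa, 'ma, 'za) precontextual_scheme \<Rightarrow> ('ob, 'mb, 'zb) precontextual_scheme
    \<Rightarrow> ('oc, 'mc, 'zc) precontextual_scheme
    \<Rightarrow> ('oa \<times> 'ob, 'ma \<times> 'mb, 'oc, 'mc) functor_data \<Rightarrow> 'oa \<Rightarrow> 'ob \<Rightarrow> 'mc square"
where
  "bi_corner A B C H a b =
    dist_pullback C (right (bi_square A B H a b)) (bottom (bi_square A B H a b))"

definition bimorphism ::
  "('oa, 'ma, 'za) precontextual_scheme \<Rightarrow> ('ob, 'mb, 'zb) precontextual_scheme
    \<Rightarrow> ('oc, 'mc, 'zc) precontextual_scheme
    \<Rightarrow> ('oa \<times> 'ob, 'ma \<times> 'mb, 'oc, 'mc) functor_data \<Rightarrow> bool"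
where
  "bimorphism A B C H \<longleftrightarrow>
    is_functor (prod_category A B) C H \<and>
    \<comment> \<open>(i)\<close>
    (\<forall>b \<in> Obj B.
      (\<forall>d. display_map A d \<longrightarrow> display_map C (amap H (d, Ident B b))) \<and>
      (\<forall>a \<in> Obj A. len A a = 0 \<longrightarrow> omap H (a, b) = one C) \<and>
      (len B b = 0 \<longrightarrow>
        (\<forall>a \<in> Obj A. omap H (a, b) = one C) \<and>
        (\<forall>f \<in> Arr A. amap H (f, Ident B b) = Ident C (one C)))) \<and>
    \<comment> \<open>(ii)\<close>
    (\<forall>a \<in> Obj A. \<forall>b \<in> Obj B. len A a \<ge> 1 \<longrightarrow> len B b \<ge> 1
      \<longrightarrow> relative_display1 C (bi_square A B H a b)) \<and>
    \<comment> \<open>(iii)\<close>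
    (\<forall>b \<in> Obj B. \<forall>S \<in> Qsq A. len B b \<ge> 1 \<longrightarrow>
      (let a1 = Dom A (top S); a2 = Cod A (top S) in
       distinguished C
        (Sq (amap H (top S, Ident B b))
            (bi_gap A B C H a1 b)
            (bi_gap A B C H a2 b)
            (pullback_map C (bi_corner A B C H a1 b) (bi_corner A B C H a2 b)
              (amap H (top S, Ident B (ft B b)))
              (amap H (bottom S, Ident B b)))))) \<and>
    \<comment> \<open>(iv)\<close>
    (\<forall>a \<in> Obj A. \<forall>S \<in> Qsq B. len A a \<ge> 1 \<longrightarrow>
      (let b1 = Dom B (top S); b2 = Cod B (top S) in
       distinguished C
        (Sq (amap H (Ident A a, top S))
            (bi_gap A B C H a b1)
            (bi_gap A B C H a b2)
            (pullback_map C (bi_corner A B C H a b1) (bi_corner A B C H a b2)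
              (amap H (Ident A a, bottom S))
              (amap H (Ident A (ft A a), top S))))))"


section \<open>Cellular diagrams\<close>

text \<open>Orders are reflexive. The principal sieve of \<open>x\<close> is \<^term>\<open>under le x\<close>, and its
  boundary is \<^term>\<open>underS le x\<close>.\<close>

definition sieve :: "'p set \<Rightarrow> 'p rel \<Rightarrow> 'p set \<Rightarrow> bool" where
  "sieve P le X \<longleftrightarrow> X \<subseteq> P \<and> (\<forall>x \<in> X. \<forall>y \<in> P. (y, x) \<in> le \<longrightarrow> y \<in> X)"

text \<open>A family \<open>K\<close> assigns to a sieve \<open>X\<close> the apex \<open>fst (K X)\<close> and the legs \<open>snd (K X) x\<close>;
  its values on sets that are not sieves, and its legs at indices outside \<open>X\<close>, carry no
  meaning. \<open>restrict_map C K Y X\<close> is the map from \<open>a\<^sup>Y\<close> to \<open>a\<^sup>X\<close>.\<close>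

definition restrict_map ::
  "('o, 'm, 'z) category_scheme \<Rightarrow> ('p set \<Rightarrow> 'o \<times> ('p \<Rightarrow> 'm)) \<Rightarrow> 'p set \<Rightarrow> 'p set \<Rightarrow> 'm"
where
  "restrict_map C K Y X =
    (THE h. h \<in> hom C (fst (K Y)) (fst (K X)) \<and>
      (\<forall>x \<in> X. snd (K X) x \<cdot>\<^bsub>C\<^esub> h = snd (K Y) x))"

text \<open>In this definition and the next, \<open>P\<close> is a finite poset under \<open>le\<close>, and \<open>lin\<close> is a
  linear order on \<open>P\<close> refining \<open>le\<close>; both relations may extend beyond \<open>P\<close>, which allows them
  to be kept when \<open>P\<close> is shrunk.\<close>

definition cell_choice ::
  "('o, 'm, 'z) precontextual_scheme \<Rightarrow> 'p set \<Rightarrow> 'p rel \<Rightarrow> 'p rel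
    \<Rightarrow> ('p, 'p \<times> 'p, 'o, 'm) functor_data \<Rightarrow> ('p set \<Rightarrow> 'o \<times> ('p \<Rightarrow> 'm)) \<Rightarrow> bool"
where
  "cell_choice C P le lin F K \<longleftrightarrow>
    (\<forall>X. sieve P le X \<longrightarrow> is_limit_cone (poset_op X le) C F (fst (K X)) (snd (K X))) \<and>
    fst (K {}) = one C \<and>
    (\<forall>x \<in> P. fst (K (under le x \<inter> P)) = omap F x \<and>
      (\<forall>y \<in> under le x \<inter> P. snd (K (under le x \<inter> P)) y = amap F (x, y))) \<and>
    (\<forall>X Y y. sieve P le X \<and> sieve P le Y \<and> X \<subseteq> Y \<and> Y - X = {y} \<and> (\<forall>x \<in> X. (x, y) \<in> lin)
      \<longrightarrow> display_map1 C (restrict_map C K Y X)) \<and>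
    (\<forall>X X' Y Y' y. sieve P le X \<and> sieve P le X' \<and> sieve P le Y \<and> sieve P le Y' \<and>
        X \<subseteq> X' \<and> Y \<subseteq> Y' \<and> X \<subseteq> Y \<and> X' \<subseteq> Y' \<and> Y - X = {y} \<and> Y' - X' = {y} \<and>
        (\<forall>x \<in> X'. (x, y) \<in> lin)
      \<longrightarrow> distinguished C
        (Sq (restrict_map C K Y' Y)
            (restrict_map C K Y' X') (restrict_map C K Y X)
            (restrict_map C K X' X)))"

definition finite_cellular ::
  "('o, 'm, 'z) precontextual_scheme \<Rightarrow> 'p set \<Rightarrow> 'p rel \<Rightarrow> 'p rel
    \<Rightarrow> ('p, 'p \<times> 'p, 'o, 'm) functor_data \<Rightarrow> bool"
where
  "finite_cellular C P le lin F \<longleftrightarrow> (\<exists>K. cell_choice C P le lin F K)"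

definition local_linearization :: "'p set \<Rightarrow> 'p rel \<Rightarrow> 'p rel \<Rightarrow> bool" where
  "local_linearization P le lin \<longleftrightarrow>
    lin \<subseteq> {(x, y). x \<in> P \<and> y \<in> P \<and> (\<exists>z \<in> P. (x, z) \<in> le \<and> (y, z) \<in> le)} \<and>
    (\<forall>z \<in> P. linear_order_on (under le z) (Restr lin (under le z)) \<and>
      Restr le (under le z) \<subseteq> lin)"

definition cellular ::
  "('o, 'm, 'z) precontextual_scheme \<Rightarrow> 'p set \<Rightarrow> 'p rel \<Rightarrow> 'p rel
    \<Rightarrow> ('p, 'p \<times> 'p, 'o, 'm) functor_data \<Rightarrow> bool"
where
  "cellular C P le lin F \<longleftrightarrow> (\<forall>x \<in> P. finite_cellular C (under le x) le lin F)"

text \<open>\<open>cell_cone C P le lin F X\<close> is \<open>F[X]\<close> (first component) with its limit cone (second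
  component), for a sieve \<open>X\<close> contained in some principal sieve. The cell choices being unique
  as far as their values are meaningful, the descriptions are well defined at \<open>x \<in> X\<close>.\<close>

definition cell_cone ::
  "('o, 'm, 'z) precontextual_scheme \<Rightarrow> 'p set \<Rightarrow> 'p rel \<Rightarrow> 'p rel
    \<Rightarrow> ('p, 'p \<times> 'p, 'o, 'm) functor_data \<Rightarrow> 'p set \<Rightarrow> 'o \<times> ('p \<Rightarrow> 'm)"
where
  "cell_cone C P le lin F X =
    (THE a. \<exists>z \<in> P. \<exists>K. X \<subseteq> under le z \<and> cell_choice C (under le z) le lin F K \<and> a = fst (K X),
     \<lambda>x. THE f. \<exists>z \<in> P. \<exists>K. X \<subseteq> under le z \<and> cell_choice C (under le z) le lin F K
       \<and> f = snd (K X) x)"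


section \<open>Multimorphisms\<close>

definition tree :: "('o, 'm, 'z) precontextual_scheme \<Rightarrow> 'o set" where
  "tree A = {x \<in> Obj A. len A x \<ge> 1}"

definition tree_ord :: "('o, 'm, 'z) precontextual_scheme \<Rightarrow> 'o rel" where
  "tree_ord A = {(x, y). x \<in> tree A \<and> y \<in> tree A \<and> (\<exists>d \<in> hom A y x. display_map A d)}"

definition the_display :: "('o, 'm, 'z) precontextual_scheme \<Rightarrow> 'o \<Rightarrow> 'o \<Rightarrow> 'm" where
  "the_display A y x = (THE d. d \<in> hom A y x \<and> display_map A d)"

definition prod_ord :: "'p rel \<Rightarrow> 'q rel \<Rightarrow> ('p \<times> 'q) rel" where
  "prod_ord r s = {((x1, x2), (y1, y2)). (x1, y1) \<in> r \<and> (x2, y2) \<in> s}"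

definition lex_lin :: "'p rel \<Rightarrow> 'q rel \<Rightarrow> ('p \<times> 'q) rel" where
  "lex_lin r s = {((x1, x2), (y1, y2)).
    {x1, y1} \<subseteq> Field r \<and> {x2, y2} \<subseteq> Field s \<and>
    ((x1, x2) = (y1, y2) \<or>
     ((x1, y1) \<in> r \<and> x1 \<noteq> y1 \<and> ((x2, y2) \<in> s \<or> (y2, x2) \<in> s)) \<or>
     (x1 = y1 \<and> (x2, y2) \<in> s \<and> x2 \<noteq> y2))}"

definition tree_restrict ::
  "('oa, 'ma, 'za) precontextual_scheme \<Rightarrow> ('ob, 'mb, 'zb) precontextual_scheme
    \<Rightarrow> ('oa \<times> 'ob, 'ma \<times> 'mb, 'oc, 'mc) functor_data
    \<Rightarrow> ('oa \<times> 'ob, ('oa \<times> 'ob) \<times> ('oa \<times> 'ob), 'oc, 'mc) functor_data"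
where
  "tree_restrict A B F =
    \<lparr>omap = omap F,
     amap = (\<lambda>((y1, y2), (x1, x2)). amap F (the_display A y1 x1, the_display B y2 x2))\<rparr>"

definition multi_cone ::
  "('oa, 'ma, 'za) precontextual_scheme \<Rightarrow> ('ob, 'mb, 'zb) precontextual_scheme
    \<Rightarrow> ('oc, 'mc, 'zc) precontextual_scheme
    \<Rightarrow> ('oa \<times> 'ob, 'ma \<times> 'mb, 'oc, 'mc) functor_data
    \<Rightarrow> ('oa \<times> 'ob) set \<Rightarrow> 'oc \<times> ('oa \<times> 'ob \<Rightarrow> 'mc)"
where
  "multi_cone A B C F =
    cell_cone C (tree A \<times> tree B) (prod_ord (tree_ord A) (tree_ord B))
      (lex_lin (tree_ord A) (tree_ord B)) (tree_restrict A B F)"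

definition boundary ::
  "('oa, 'ma, 'za) precontextual_scheme \<Rightarrow> ('ob, 'mb, 'zb) precontextual_scheme
    \<Rightarrow> 'oa \<times> 'ob \<Rightarrow> ('oa \<times> 'ob) set"
where
  "boundary A B x = underS (prod_ord (tree_ord A) (tree_ord B)) x"

text \<open>The map \<open>F(x) \<rightarrow> F[\<partial>x]\<close>, where \<open>F(x)\<close> is \<open>F\<close> of the principal sieve of \<open>x\<close>.\<close>

definition boundary_map ::
  "('oa, 'ma, 'za) precontextual_scheme \<Rightarrow> ('ob, 'mb, 'zb) precontextual_scheme
    \<Rightarrow> ('oc, 'mc, 'zc) precontextual_scheme
    \<Rightarrow> ('oa \<times> 'ob, 'ma \<times> 'mb, 'oc, 'mc) functor_data \<Rightarrow> 'oa \<times> 'ob \<Rightarrow> 'mc"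
where
  "boundary_map A B C F x =
    restrict_map C (multi_cone A B C F)
      (under (prod_ord (tree_ord A) (tree_ord B)) x) (boundary A B x)"

text \<open>The map from \<open>F[\<partial>x]\<close> to \<open>F(z)\<close>. If a component of \<open>z\<close> has length 0 then \<open>z\<close> is not in
  the indexing poset; but then \<open>F(z)\<close> is terminal.\<close>

definition boundary_proj ::
  "('oa, 'ma, 'za) precontextual_scheme \<Rightarrow> ('ob, 'mb, 'zb) precontextual_scheme
    \<Rightarrow> ('oc, 'mc, 'zc) precontextual_scheme
    \<Rightarrow> ('oa \<times> 'ob, 'ma \<times> 'mb, 'oc, 'mc) functor_data \<Rightarrow> 'oa \<times> 'ob \<Rightarrow> 'oa \<times> 'ob \<Rightarrow> 'mc"
where
  "boundary_proj A B C F x z =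
    (if z \<in> tree A \<times> tree B then snd (multi_cone A B C F (boundary A B x)) z
     else to_one C (fst (multi_cone A B C F (boundary A B x))))"

text \<open>\<open>F[\<partial>(x\<^sub>1, x\<^sub>2)]\<close> as the pullback of \<open>F(\<partial>x\<^sub>1, x\<^sub>2)\<close> and \<open>F(x\<^sub>1, \<partial>x\<^sub>2)\<close> over
  \<open>F(\<partial>x\<^sub>1, \<partial>x\<^sub>2)\<close>.\<close>

definition boundary_square ::
  "('oa, 'ma, 'za) precontextual_scheme \<Rightarrow> ('ob, 'mb, 'zb) precontextual_scheme
    \<Rightarrow> ('oc, 'mc, 'zc) precontextual_scheme
    \<Rightarrow> ('oa \<times> 'ob, 'ma \<times> 'mb, 'oc, 'mc) functor_data \<Rightarrow> 'oa \<Rightarrow> 'ob \<Rightarrow> 'mc square"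
where
  "boundary_square A B C F x1 x2 =
    Sq (boundary_proj A B C F (x1, x2) (x1, ft B x2))
       (boundary_proj A B C F (x1, x2) (ft A x1, x2))
       (amap F (proj A x1, Ident B (ft B x2)))
       (amap F (Ident A (ft A x1), proj B x2))"

definition multimorphism ::
  "('oa, 'ma, 'za) precontextual_scheme \<Rightarrow> ('ob, 'mb, 'zb) precontextual_scheme
    \<Rightarrow> ('oc, 'mc, 'zc) precontextual_scheme
    \<Rightarrow> ('oa \<times> 'ob, 'ma \<times> 'mb, 'oc, 'mc) functor_data \<Rightarrow> bool"
where
  "multimorphism A B C F \<longleftrightarrow>
    is_functor (prod_category A B) C F \<and>
    (\<forall>x1 \<in> Obj A. \<forall>x2 \<in> Obj B. len A x1 = 0 \<or> len B x2 = 0 \<longrightarrow> omap F (x1, x2) = one C) \<and>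
    cellular C (tree A \<times> tree B) (prod_ord (tree_ord A) (tree_ord B))
      (lex_lin (tree_ord A) (tree_ord B)) (tree_restrict A B F) \<and>
    (\<forall>S1 \<in> Qsq A. \<forall>S2 \<in> Qsq B.
      (let x1 = Dom A (top S1); y1 = Cod A (top S1); x2 = Dom B (top S2); y2 = Cod B (top S2) in
       distinguished C
        (Sq (amap F (top S1, top S2))
            (boundary_map A B C F (x1, x2))
            (boundary_map A B C F (y1, y2))
            (pullback_map C (boundary_square A B C F x1 x2) (boundary_square A B C F y1 y2)
              (amap F (top S1, bottom S2))
              (amap F (bottom S1, top S2))))))"


section \<open>The lexicographic relation is a local linearization\<close>

context precontextual_category begin

lemma display_map_Cod:
  "display_map C d \<Longrightarrow>
    d \<in> Arr C \<and> (\<exists>n \<le> len C (Dom C d). Cod C d = (ft C ^^ n) (Dom C d))"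
proof (induction rule: display_map.induct)
  case (Ident a)
  then show ?case using Ident_in_hom[of a] by (auto simp: hom_def intro: exI[of _ 0])
next
  case (Comp_proj a d)
  then obtain n where n: "n \<le> len C (Dom C d)" "Cod C d = (ft C ^^ n) (Dom C d)" by auto
  have h: "d \<cdot> proj C a \<in> hom C a (Cod C d)"
    using Comp_in_hom[OF proj_in_hom[of a], of d "Cod C d"] Comp_proj by (auto simp: hom_def)
  moreover have "Suc n \<le> len C a" using n len_ft Comp_proj by auto
  moreover have "Cod C d = (ft C ^^ Suc n) a" using n Comp_proj by (simp add: funpow_swap1)
  ultimately show ?case by (auto simp: hom_def)
qed

lemma display_map_exists:
  "a \<in> Obj C \<Longrightarrow> n \<le> len C a \<Longrightarrow> \<exists>d \<in> hom C a ((ft C ^^ n) a). display_map C d"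
proof (induction n arbitrary: a)
  case 0
  then show ?case using Ident_in_hom display_map.Ident by force
next
  case (Suc n)
  then have "n \<le> len C (ft C a)" using len_ft[of a] by auto
  then obtain d where d: "d \<in> hom C (ft C a) ((ft C ^^ n) (ft C a))" "display_map C d"
    using Suc.IH[of "ft C a"] Suc.prems ft_in_Obj by auto
  have "d \<cdot> proj C a \<in> hom C a ((ft C ^^ Suc n) a)"
    using Comp_in_hom[OF proj_in_hom d(1)] Suc.prems by (simp add: funpow_swap1)
  moreover have "display_map C (d \<cdot> proj C a)"
    using display_map.Comp_proj[of a C d] d Suc.prems by (auto simp: hom_def)
  ultimately show ?case by blast
qed

lemma len_funpow_ft:
  "a \<in> Obj C \<Longrightarrow> n \<le> len C a \<Longrightarrow> (ft C ^^ n) a \<in> Obj C \<and> len C ((ft C ^^ n) a) = len C a - n"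
proof (induction n)
  case (Suc n)
  then show ?case using len_ft[of "(ft C ^^ n) a"] ft_in_Obj by auto
qed simp

lemma display_map_unique:
  "display_map C d \<Longrightarrow> display_map C d' \<Longrightarrow> Dom C d' = Dom C d \<Longrightarrow> Cod C d' = Cod C d \<Longrightarrow> d' = d"
proof (induction arbitrary: d' rule: display_map.induct)
  case (Ident a)
  from Ident(2) show ?case
  proof cases
    case (Ident a')
    then show ?thesis using \<open>a \<in> Obj C\<close> Ident_in_hom \<open>Dom C d' = Dom C (Ident C a)\<close>
      by (auto simp: hom_def)
  next
    case (Comp_proj a' e)
    have e: "e \<in> hom C (ft C a') (Cod C e)" "len C (Cod C e) \<le> len C (ft C a')" "ft C a' \<in> Obj C"
      using display_map_Cod[of e] len_funpow_ft[of "ft C a'"] Comp_proj ft_in_Obj by (auto simp: hom_def)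
    then have "d' \<in> hom C a' (Cod C e)"
      using Comp_in_hom[OF proj_in_hom[of a'], of e] Comp_proj by auto
    then have "Cod C e = a'"
      using Ident Ident_in_hom[of a] by (auto simp: hom_def)
    then show ?thesis using e(2) len_ft[of a'] Comp_proj by auto
  qed
next
  case (Comp_proj a d)
  have d: "d \<in> hom C (ft C a) (Cod C d)" "len C (Cod C d) \<le> len C (ft C a)"
    using display_map_Cod[OF Comp_proj.hyps(3)] len_funpow_ft[OF ft_in_Obj[OF Comp_proj.hyps(1)]]
      Comp_proj.hyps(4) by (auto simp: hom_def)
  have dp: "d \<cdot> proj C a \<in> hom C a (Cod C d)"
    using Comp_in_hom[OF proj_in_hom d(1)] Comp_proj.hyps(1,2) by auto
  from \<open>display_map C d'\<close> show ?case
  proof cases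
    case (Ident a')
    then have "Cod C d = a"
      using Comp_proj.prems dp Ident_in_hom[of a'] by (auto simp: hom_def)
    then show ?thesis using d(2) len_ft[of a] Comp_proj.hyps(1,2) by auto
  next
    case c: (Comp_proj a' e)
    have e: "e \<in> hom C (ft C a') (Cod C e)"
      using display_map_Cod[of e] c by (auto simp: hom_def)
    have "d' \<in> hom C a' (Cod C e)"
      using Comp_in_hom[OF proj_in_hom[of a'] e] c by auto
    then have "a' = a" "Cod C e = Cod C d"
      using Comp_proj.prems dp by (auto simp: hom_def)
    then show ?thesis using Comp_proj.IH[of e] c Comp_proj.hyps(4) by auto
  qed
qed

lemma tree_ord_display: "(x, y) \<in> tree_ord C \<Longrightarrow> \<exists>!d. d \<in> hom C y x \<and> display_map C d"
  using display_map_unique by (fastforce simp: tree_ord_def hom_def)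

lemma tree_ord_iff:
  "(x, y) \<in> tree_ord C \<longleftrightarrow> y \<in> tree C \<and> (\<exists>n < len C y. x = (ft C ^^ n) y)"
proof
  assume "(x, y) \<in> tree_ord C"
  then obtain d where d: "d \<in> hom C y x" "display_map C d" "x \<in> tree C" "y \<in> tree C"
    by (auto simp: tree_ord_def)
  then obtain n where "n \<le> len C y" "x = (ft C ^^ n) y"
    using display_map_Cod by (fastforce simp: hom_def)
  then show "y \<in> tree C \<and> (\<exists>n < len C y. x = (ft C ^^ n) y)"
    using d len_funpow_ft[of y n] by (auto simp: tree_def intro!: exI[of _ n])
next
  assume "y \<in> tree C \<and> (\<exists>n < len C y. x = (ft C ^^ n) y)"
  then show "(x, y) \<in> tree_ord C"
    using display_map_exists[of y] len_funpow_ft[of y]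
    by (auto simp: tree_ord_def tree_def)
qed

lemma partial_order_on_tree_ord: "partial_order_on (tree C) (tree_ord C)"
proof -
  have "refl_on (tree C) (tree_ord C)"
    by (auto simp: refl_on_def tree_ord_iff tree_def intro!: exI[of _ 0])
  moreover have "tree_ord C \<subseteq> tree C \<times> tree C" by (auto simp: tree_ord_def)
  moreover have "trans (tree_ord C)"
  proof (rule transI)
    fix x y z assume "(x, y) \<in> tree_ord C" "(y, z) \<in> tree_ord C"
    then obtain m n where "z \<in> tree C" "n < len C z" "y = (ft C ^^ n) z" "m < len C y" "x = (ft C ^^ m) y"
      by (auto simp: tree_ord_iff)
    then show "(x, z) \<in> tree_ord C"
      using len_funpow_ft[of z n]
      by (auto simp: tree_ord_iff tree_def funpow_add intro!: exI[of _ "m + n"])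
  qed
  moreover have "antisym (tree_ord C)"
  proof (rule antisymI)
    fix x y assume "(x, y) \<in> tree_ord C" "(y, x) \<in> tree_ord C"
    then obtain m n where m: "m < len C x" "y = (ft C ^^ m) x" "x \<in> Obj C"
      and n: "n < len C y" "x = (ft C ^^ n) y" "y \<in> Obj C"
      unfolding tree_ord_iff tree_def by blast
    have "len C x = len C y - n"
      using len_funpow_ft[of y n] n(1,3) unfolding n(2)[symmetric] by linarith
    moreover have "len C y = len C x - m"
      using len_funpow_ft[of x m] m(1,3) unfolding m(2)[symmetric] by linarith
    ultimately have "n = 0" using m(1) n(1) by linarith
    then show "x = y" using n(2) by simp
  qed
  ultimately show ?thesis by (auto simp: partial_order_on_def preorder_on_def)
qed

lemma tree_ord_down_total:
  assumes "(x, z) \<in> tree_ord C" "(y, z) \<in> tree_ord C"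
  shows "(x, y) \<in> tree_ord C \<or> (y, x) \<in> tree_ord C"
proof -
  have *: "((ft C ^^ n) z, (ft C ^^ m) z) \<in> tree_ord C" if "m \<le> n" "n < len C z" "z \<in> tree C" for m n
  proof -
    have "(ft C ^^ n) z = (ft C ^^ (n - m)) ((ft C ^^ m) z)"
      using that(1) funpow_add[of "n - m" m "ft C"] by simp
    moreover have "(ft C ^^ m) z \<in> tree C" "n - m < len C ((ft C ^^ m) z)"
      using that len_funpow_ft[of z m] by (auto simp: tree_def)
    ultimately show ?thesis unfolding tree_ord_iff by blast
  qed
  obtain m n where "m < len C z" "n < len C z" "x = (ft C ^^ m) z" "y = (ft C ^^ n) z" "z \<in> tree C"
    using assms unfolding tree_ord_iff by blast
  then show ?thesis
    using *[of m n] *[of n m] by (metis nle_le)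
qed

end

lemma finite_under_tree:
  assumes "precontextual_category A" shows "finite (under (tree_ord A) x)"
proof -
  interpret precontextual_category A by fact
  have "under (tree_ord A) x \<subseteq> (\<lambda>n. (ft A ^^ n) x) ` {..<len A x}"
    by (auto simp: under_def tree_ord_iff)
  then show ?thesis by (rule finite_subset) auto
qed

lemma local_linearization_lex:
  assumes "precontextual_category A" "precontextual_category B"
  shows "local_linearization (tree A \<times> tree B) (prod_ord (tree_ord A) (tree_ord B))
    (lex_lin (tree_ord A) (tree_ord B))"
proof -
  interpret A: precontextual_category A by fact
  interpret B: precontextual_category B by fact
  have F: "Field (tree_ord A) = tree A" "Field (tree_ord B) = tree B"
    using A.partial_order_on_tree_ord B.partial_order_on_tree_ord
    by (auto simp: partial_order_on_def preorder_on_def Field_def refl_on_def)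
  have poA: "\<And>x. x \<in> tree A \<Longrightarrow> (x,x) \<in> tree_ord A" "trans (tree_ord A)" "antisym (tree_ord A)"
      "tree_ord A \<subseteq> tree A \<times> tree A"
    and poB: "\<And>x. x \<in> tree B \<Longrightarrow> (x,x) \<in> tree_ord B" "trans (tree_ord B)" "antisym (tree_ord B)"
      "tree_ord B \<subseteq> tree B \<times> tree B"
    using A.partial_order_on_tree_ord B.partial_order_on_tree_ord
    by (auto simp: partial_order_on_def preorder_on_def refl_on_def)
  let ?lex = "lex_lin (tree_ord A) (tree_ord B)" and ?le = "prod_ord (tree_ord A) (tree_ord B)"
  have 1: "?lex \<subseteq> {(x, y). x \<in> tree A \<times> tree B \<and> y \<in> tree A \<times> tree B \<and>
    (\<exists>z \<in> tree A \<times> tree B. (x, z) \<in> ?le \<and> (y, z) \<in> ?le)}"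
    unfolding lex_lin_def prod_ord_def F using poA(1) poB(1) by auto
  have 2: "linear_order_on (under ?le z) (Restr ?lex (under ?le z)) \<and> Restr ?le (under ?le z) \<subseteq> ?lex"
    if z: "z \<in> tree A \<times> tree B" for z
  proof -
    obtain z1 z2 where z12: "z = (z1,z2)" by fastforce
    have U: "under ?le z = under (tree_ord A) z1 \<times> under (tree_ord B) z2"
      unfolding under_def prod_ord_def z12 by auto
    have tot1: "\<And>x y. x \<in> under (tree_ord A) z1 \<Longrightarrow> y \<in> under (tree_ord A) z1 \<Longrightarrow> (x,y) \<in> tree_ord A \<or> (y,x) \<in> tree_ord A"
      using A.tree_ord_down_total by (auto simp: under_def)
    have tot2: "\<And>x y. x \<in> under (tree_ord B) z2 \<Longrightarrow> y \<in> under (tree_ord B) z2 \<Longrightarrow> (x,y) \<in> tree_ord B \<or> (y,x) \<in> tree_ord B"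
      using B.tree_ord_down_total by (auto simp: under_def)
    have mem: "under (tree_ord A) z1 \<subseteq> tree A" "under (tree_ord B) z2 \<subseteq> tree B"
      using poA(4) poB(4) by (auto simp: under_def)
    have "refl_on (under ?le z) (Restr ?lex (under ?le z))"
      unfolding U using mem by (auto simp: refl_on_def lex_lin_def F)
    moreover have "total_on (under ?le z) (Restr ?lex (under ?le z))"
      unfolding U total_on_def lex_lin_def F
      using mem tot1 tot2 by (auto simp: subset_iff) blast+
    moreover have "antisym (Restr ?lex (under ?le z))"
      unfolding U lex_lin_def F using poA(3) poB(3)
      by (auto simp: antisym_def) 
    moreover have "trans (Restr ?lex (under ?le z))"
    proof (rule transI)
      fix p q r assume pq: "(p, q) \<in> Restr ?lex (under ?le z)" and qr: "(q, r) \<in> Restr ?lex (under ?le z)"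
      obtain p1 p2 q1 q2 r1 r2 where c: "p = (p1, p2)" "q = (q1, q2)" "r = (r1, r2)"
        by (cases p; cases q; cases r)
      have m: "p \<in> under ?le z" "r \<in> under ?le z" using pq qr by auto
      have t: "(p2, r2) \<in> tree_ord B \<or> (r2, p2) \<in> tree_ord B" using m tot2 unfolding U c by blast
      have "(p1, r1) \<in> tree_ord A \<and> p1 \<noteq> r1 \<or> p1 = r1 \<and> (p2, r2) \<in> tree_ord B"
        using pq qr poB(1) antisymD[OF poA(3), of p1 q1] transD[OF poA(2), of p1 q1 r1] transD[OF poB(2), of p2 q2 r2]
        unfolding lex_lin_def F c by auto
      then have "(p, r) \<in> ?lex"
        using t m mem unfolding U lex_lin_def F c by auto
      then show "(p, r) \<in> Restr ?lex (under ?le z)" using m by auto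
    qed
    moreover have "Restr ?le (under ?le z) \<subseteq> ?lex"
      unfolding prod_ord_def lex_lin_def F using poA(4) poB(4) by auto
    ultimately show ?thesis
      by (auto simp: linear_order_on_def partial_order_on_def preorder_on_def)
  qed
  show ?thesis unfolding local_linearization_def using 1 2 by blast
qed
end

theory Submission
  imports Defs
begin

text \<open>
  Both notions compare \<open>H(a, b)\<close> with the matching object of its boundary, and the proof is the
  observation that the two matching objects agree on the nose. In the lexicographic order, the
  cells \<open>(a, v)\<close> with \<open>v \<le> \<partial>b\<close> are attached last when building the boundary of \<open>(a, b)\<close>; stacking the
  distinguished squares provided by a cellular diagram for these cells exhibits \<open>H[\<partial>(a, b)]\<close> as the
  corner of a distinguished square with right side \<open>H(\<^bold>p\<^sub>a, id)\<close> and bottom \<open>H(id, \<^bold>p\<^sub>b)\<close>. As such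
  squares are unique, this corner is the one in the definition of \<open>gap\<^sub>H(a, b)\<close>, so that
  \<open>H(a, b) \<rightarrow> H[\<partial>(a, b)]\<close> is \<open>gap\<^sub>H(a, b)\<close>.

  For a bimorphism, cell structures are then built one cell at a time, the new cell being attached
  by pulling back the gap map; conversely \<open>H(\<^bold>p\<^sub>a, id)\<close> is the gap map followed by a pulled back
  display map. The square of a multimorphism for \<open>(Q\<^sub>1, Q\<^sub>2)\<close> is the horizontal composite of the
  bimorphism squares for \<open>(id, Q\<^sub>2)\<close> and \<open>(Q\<^sub>1, id)\<close>, which in turn are its special cases for identity
  squares.
\<close>

section \<open>Distinguished squares\<close>

text \<open>This is the asymmetry of the lexicographic order, where the first coordinate dominates:
  the boundary of (a, b) is built upon the rectangle below (ft a, b), so the projection towards H(ft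
  a, b) is the one that becomes a display map.

  The obstacle is equality on the nose. F[X] is a description ranging over every principal sieve
  that contains X and every cell choice on it, and these must all agree although limits are unique
  only up to isomorphism. Strictness comes from the unique lifts in \<open>Qsq\<close>, extended
  first to stacks of squares and then, cell by cell, to cell choices.

  Objects of length 0 lie outside the trees. Their rectangles are empty, the limit over the empty
  sieve is the terminal object, and H has the same value there, so the formulas need no exceptions.

  The final comparison takes place under the assumptions that both notions imply, namely the value
  on length 0 and cellularity. There each notion shrinks to a family of distinguished squares
  between gap maps.\<close>

context category begin

lemma hom_Dom_Cod: "f \<in> hom C a b \<Longrightarrow> f \<in> Arr C \<and> Dom C f = a \<and> Cod C f = b"
  by (simp add: hom_def)

lemma Arr_hom: "f \<in> Arr C \<Longrightarrow> f \<in> hom C (Dom C f) (Cod C f)"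
  by (simp add: hom_def)

lemma comm_square_iff:
  "comm_square C (Sq t l r b) \<longleftrightarrow>
    (\<exists>p q s u. t \<in> hom C p q \<and> l \<in> hom C p s \<and> r \<in> hom C q u \<and> b \<in> hom C s u \<and> r \<cdot> t = b \<cdot> l)"
  by (auto simp: comm_square_def hom_def)

lemma is_pullback_lift:
  assumes "is_pullback C S" "u \<in> hom C d (Dom C (right S))" "v \<in> hom C d (Dom C (bottom S))"
    "right S \<cdot> u = bottom S \<cdot> v"
  shows "\<exists>!w. w \<in> hom C d (Dom C (top S)) \<and> top S \<cdot> w = u \<and> left S \<cdot> w = v"
proof -
  have "comm_square C (Sq u v (right S) (bottom S))"
    using assms by (auto simp: is_pullback_def comm_square_def hom_def)
  moreover have "Dom C u = d" using assms(2) by (simp add: hom_def)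
  ultimately show ?thesis using assms(1) unfolding is_pullback_def by blast
qed

lemma is_pullbackI:
  assumes "t \<in> hom C p q" "l \<in> hom C p s" "r \<in> hom C q u" "b \<in> hom C s u" "r \<cdot> t = b \<cdot> l"
    and "\<And>d f g. f \<in> hom C d q \<Longrightarrow> g \<in> hom C d s \<Longrightarrow> r \<cdot> f = b \<cdot> g
      \<Longrightarrow> \<exists>!w. w \<in> hom C d p \<and> t \<cdot> w = f \<and> l \<cdot> w = g"
  shows "is_pullback C (Sq t l r b)"
  unfolding is_pullback_def
proof (intro conjI allI impI)
  show "comm_square C (Sq t l r b)" using assms by (auto simp: comm_square_iff)
  fix f g assume "comm_square C (Sq f g (right (Sq t l r b)) (bottom (Sq t l r b)))"
  then have "f \<in> hom C (Dom C f) q" "g \<in> hom C (Dom C f) s" "r \<cdot> f = b \<cdot> g"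
    using assms(3,4) by (auto simp: comm_square_def hom_def)
  then show "\<exists>!w. w \<in> hom C (Dom C f) (Dom C (top (Sq t l r b))) \<and>
      top (Sq t l r b) \<cdot> w = f \<and> left (Sq t l r b) \<cdot> w = g"
    using assms(6) assms(1) by (simp add: hom_def)
qed

lemma is_pullback_stack:
  assumes "is_pullback C (Sq g l' r' f)" "is_pullback C (Sq f l r b)"
  shows "is_pullback C (Sq g (l \<cdot> l') (r \<cdot> r') b)"
proof -
  obtain p q s u where 1: "g \<in> hom C p q" "l' \<in> hom C p s" "r' \<in> hom C q u" "f \<in> hom C s u"
      "r' \<cdot> g = f \<cdot> l'"
    using assms(1) unfolding is_pullback_def comm_square_iff by auto
  then obtain x y where 2: "l \<in> hom C s x" "r \<in> hom C u y" "b \<in> hom C x y" "r \<cdot> f = b \<cdot> l"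
    using assms(2) unfolding is_pullback_def comm_square_iff by (auto simp: hom_def)
  show ?thesis
  proof (rule is_pullbackI)
    show "g \<in> hom C p q" "l \<cdot> l' \<in> hom C p x" "r \<cdot> r' \<in> hom C q y" "b \<in> hom C x y"
      using 1 2 Comp_in_hom by auto
    show "r \<cdot> r' \<cdot> g = b \<cdot> (l \<cdot> l')"
      by (simp add: Comp_assoc[OF 1(1,3) 2(2), symmetric] 1(5) Comp_assoc[OF 1(2,4) 2(2)]
        Comp_assoc[OF 1(2) 2(1,3)] 2(4))
    fix d h k assume h: "h \<in> hom C d q" and k: "k \<in> hom C d x" and e: "r \<cdot> r' \<cdot> h = b \<cdot> k"
    have rh: "r' \<cdot> h \<in> hom C d u" "r \<cdot> (r' \<cdot> h) = b \<cdot> k"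
      using Comp_in_hom[OF h 1(3)] e Comp_assoc[OF h 1(3) 2(2)] by simp_all
    have "\<exists>!m. m \<in> hom C d s \<and> f \<cdot> m = r' \<cdot> h \<and> l \<cdot> m = k"
      using is_pullback_lift[OF assms(2), of "r' \<cdot> h" d k] rh k 1(4) 2 by (simp add: hom_def)
    then obtain m where m: "m \<in> hom C d s" "f \<cdot> m = r' \<cdot> h" "l \<cdot> m = k"
      "\<And>m'. m' \<in> hom C d s \<Longrightarrow> f \<cdot> m' = r' \<cdot> h \<Longrightarrow> l \<cdot> m' = k \<Longrightarrow> m' = m"
      by blast
    have "\<exists>!w. w \<in> hom C d p \<and> g \<cdot> w = h \<and> l' \<cdot> w = m"
      using is_pullback_lift[OF assms(1), of h d m] m(1,2) h 1 by (simp add: hom_def)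
    then obtain w where w: "w \<in> hom C d p" "g \<cdot> w = h" "l' \<cdot> w = m"
      "\<And>w'. w' \<in> hom C d p \<Longrightarrow> g \<cdot> w' = h \<Longrightarrow> l' \<cdot> w' = m \<Longrightarrow> w' = w"
      by blast
    show "\<exists>!w. w \<in> hom C d p \<and> g \<cdot> w = h \<and> l \<cdot> l' \<cdot> w = k"
    proof (rule ex1I[of _ w])
      show "w \<in> hom C d p \<and> g \<cdot> w = h \<and> l \<cdot> l' \<cdot> w = k"
        using w(1-3) m(1-3) Comp_assoc[OF w(1) 1(2) 2(1)] by simp
      fix w' assume w': "w' \<in> hom C d p \<and> g \<cdot> w' = h \<and> l \<cdot> l' \<cdot> w' = k"
      have "l' \<cdot> w' \<in> hom C d s" using w' 1 Comp_in_hom by blast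
      moreover have "f \<cdot> (l' \<cdot> w') = r' \<cdot> h"
        using w' Comp_assoc[of w' d p l' s f u] Comp_assoc[of w' d p g q r' u] 1 by simp
      moreover have "l \<cdot> (l' \<cdot> w') = k" using w' Comp_assoc[of w' d p l' s l x] 1(2) 2(1) by simp
      ultimately show "w' = w" using m(4) w(4) w' by blast
    qed
  qed
qed

lemma is_pullback_Ident:
  assumes "f \<in> hom C a b"
  shows "is_pullback C (Sq f (Ident C a) (Ident C b) f)"
proof -
  have a: "a \<in> Obj C" "b \<in> Obj C" using assms Dom_in_Obj Cod_in_Obj by (auto simp: hom_def)
  show ?thesis
  proof (rule is_pullbackI)
    show "f \<in> hom C a b" "Ident C a \<in> hom C a a" "Ident C b \<in> hom C b b" "f \<in> hom C a b"
      using assms Ident_in_hom a by auto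
    show "Ident C b \<cdot> f = f \<cdot> Ident C a"
      using Comp_Ident_left[OF assms] Comp_Ident_right[OF assms] by simp
    fix d g h assume g: "g \<in> hom C d b" and h: "h \<in> hom C d a" and "Ident C b \<cdot> g = f \<cdot> h"
    then have e: "f \<cdot> h = g" using Comp_Ident_left[OF g] by simp
    show "\<exists>!w. w \<in> hom C d a \<and> f \<cdot> w = g \<and> Ident C a \<cdot> w = h"
    proof (rule ex1I[of _ h])
      show "h \<in> hom C d a \<and> f \<cdot> h = g \<and> Ident C a \<cdot> h = h"
        using h e Comp_Ident_left[OF h] by simp
      show "w = h" if "w \<in> hom C d a \<and> f \<cdot> w = g \<and> Ident C a \<cdot> w = h" for w
        using that Comp_Ident_left[of w d a] by simp
    qed
  qed
qed

end

section \<open>Factorization of display maps and of distinguished squares\<close>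

context precontextual_category begin

lemma display_map_hom:
  assumes "display_map C d"
  shows "d \<in> hom C (Dom C d) (Cod C d) \<and> len C (Cod C d) \<le> len C (Dom C d)"
  using display_map_Cod[OF assms] len_funpow_ft[of "Dom C d"] Dom_in_Obj by (auto simp: hom_def)

lemma display_map_proj: "a \<in> Obj C \<Longrightarrow> len C a \<ge> 1 \<Longrightarrow> display_map C (proj C a)"
  using display_map.Comp_proj[of a C "Ident C (ft C a)"] display_map.Ident[of "ft C a" C]
    ft_in_Obj[of a] Ident_in_hom[of "ft C a"] Comp_Ident_left[OF proj_in_hom[of a]]
  by (simp add: hom_def)

lemma display_map_Comp:
  assumes "display_map C e" "display_map C d" "Cod C e = Dom C d"
  shows "display_map C (d \<cdot> e)"
  using assms
proof (induction rule: display_map.induct)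
  case (Ident a)
  then show ?case using display_map_hom[of d] Ident_in_hom[of a] by (simp add: Comp_Ident_right hom_def)
next
  case (Comp_proj a e)
  have e: "e \<in> hom C (ft C a) (Cod C e)" using display_map_hom[OF Comp_proj(3)] Comp_proj by simp
  have p: "proj C a \<in> hom C a (ft C a)" using proj_in_hom Comp_proj by simp
  have d: "d \<in> hom C (Dom C d) (Cod C d)" using display_map_hom Comp_proj by blast
  have eq: "Cod C e = Dom C d" using Comp_in_hom[OF p e] Comp_proj.prems by (simp add: hom_def)
  then have de: "d \<cdot> e \<in> hom C (ft C a) (Cod C d)" using Comp_in_hom[OF e, of d] d by simp
  have "display_map C ((d \<cdot> e) \<cdot> proj C a)"
    using Comp_proj eq de by (intro display_map.Comp_proj) (auto simp: hom_def)
  then show ?case using Comp_assoc[OF p e, of d] d eq by simp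
qed

lemma display_map1_proj:
  assumes "a \<in> Obj C" "len C a \<ge> 1" shows "display_map1 C (proj C a)"
  using assms display_map_proj proj_in_hom[of a] len_ft[of a]
  by (simp add: display_map1_def display_length_def hom_def)

text \<open>A display map ends at \<open>(ft C ^^ n) (Dom C d)\<close> with \<open>n\<close> at most
  the length of the domain, so the truncated difference in \<open>display_length\<close> is exactly
  \<open>n\<close>. Length 1 leaves only the codomain of \<open>proj\<close>, and display maps are
  determined by their ends.\<close>

lemma display_map1_eq_proj:
  assumes "display_map1 C d"
  shows "Dom C d \<in> Obj C" "len C (Dom C d) \<ge> 1" "d = proj C (Dom C d)" "Cod C d = ft C (Dom C d)"
proof -
  let ?a = "Dom C d"
  have d: "display_map C d" and l: "len C ?a - len C (Cod C d) = 1"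
    using assms by (auto simp: display_map1_def display_length_def)
  show a: "?a \<in> Obj C" "len C ?a \<ge> 1" using Dom_in_Obj display_map_hom[OF d] l by (auto simp: hom_def)
  obtain n where n: "n \<le> len C ?a" "Cod C d = (ft C ^^ n) ?a" using display_map_Cod[OF d] by auto
  then have "n = 1" using len_funpow_ft[of ?a n] a l by auto
  then show c: "Cod C d = ft C ?a" using n by simp
  show "d = proj C ?a"
    using display_map_unique[OF display_map_proj[OF a] d] proj_in_hom[OF a] c by (simp add: hom_def)
qed

lemma distinguished_display:
  "distinguished C S \<Longrightarrow> display_map C (left S) \<and> display_map C (right S) \<and> comm_square C S"
proof (induction rule: distinguished.induct)
  case (empty f)
  have "Dom C f \<in> Obj C" "Cod C f \<in> Obj C" using empty Dom_in_Obj Cod_in_Obj by auto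
  then show ?case
    using is_pullback_Ident[of f "Dom C f" "Cod C f"] empty display_map.Ident
    by (auto simp: hom_def is_pullback_def)
next
  case (stack g l' r' f l r b)
  have c: "comm_square C (Sq g l' r' f)" using Qsq_comm stack by blast
  obtain a where a: "a \<in> Obj C" "len C a \<ge> 1" "l' = proj C a" using Qsq_left[OF stack(1)] by auto
  obtain a' where a': "a' \<in> Obj C" "len C a' \<ge> 1" "r' = proj C a'" using Qsq_right[OF stack(1)] by auto
  obtain p q s u where 1: "g \<in> hom C p q" "l' \<in> hom C p s" "r' \<in> hom C q u" "f \<in> hom C s u"
      "r' \<cdot> g = f \<cdot> l'"
    using c unfolding comm_square_iff by auto
  then obtain x y where 2: "l \<in> hom C s x" "r \<in> hom C u y" "b \<in> hom C x y" "r \<cdot> f = b \<cdot> l"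
    using stack.IH unfolding comm_square_iff by (auto simp: hom_def)
  have "display_map C (l \<cdot> l')" "display_map C (r \<cdot> r')"
    using display_map_Comp[of l' l] display_map_Comp[of r' r] display_map_proj[OF a(1,2)]
      display_map_proj[OF a'(1,2)] stack.IH 1 2 a a' by (simp_all add: hom_def)
  moreover have "comm_square C (Sq g (l \<cdot> l') (r \<cdot> r') b)"
  proof -
    have "r \<cdot> r' \<cdot> g = b \<cdot> (l \<cdot> l')"
      by (simp add: Comp_assoc[OF 1(1,3) 2(2), symmetric] 1(5) Comp_assoc[OF 1(2,4) 2(2)]
        Comp_assoc[OF 1(2) 2(1,3)] 2(4))
    then show ?thesis unfolding comm_square_iff using 1 2 Comp_in_hom by blast
  qed
  ultimately show ?case by simp
qed

lemma Qsq_distinguished: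
  assumes "S \<in> Qsq C" shows "distinguished C S"
proof (cases S)
  case (Sq t l r b)
  obtain p q s u where 1: "t \<in> hom C p q" "l \<in> hom C p s" "r \<in> hom C q u" "b \<in> hom C s u"
    using Qsq_comm[OF assms] unfolding Sq comm_square_iff by blast
  have b: "b \<in> Arr C" "Dom C b = s" "Cod C b = u" using 1(4) by (auto simp: hom_def)
  have "distinguished C (Sq t (Ident C s \<cdot> l) (Ident C u \<cdot> r) b)"
    using distinguished.stack[OF assms[unfolded Sq] distinguished.empty[OF b(1)]] unfolding b .
  then show ?thesis using Comp_Ident_left[OF 1(2)] Comp_Ident_left[OF 1(3)] Sq by simp
qed

text \<open>A stack with at least one layer starts with some \<open>proj C a\<close>, which strictly
  lowers the length, and display maps never raise it. Equal lengths therefore leave only the empty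
  stack.\<close>

lemma distinguished_Ident_right:
  assumes "distinguished C (Sq t l r b)" "len C (Dom C r) = len C (Cod C r)"
  shows "Sq t l r b = Sq b (Ident C (Dom C b)) (Ident C (Cod C b)) b"
  using assms(1)
proof cases
  case (stack l' r' f l'' r'')
  obtain a where a: "a \<in> Obj C" "len C a \<ge> 1" "r' = proj C a" using Qsq_right[OF stack(3)] by auto
  have r'': "Dom C r'' = ft C a" "display_map C r''"
    using Qsq_comm[OF stack(3)] distinguished_display[OF stack(4)] a proj_in_hom[of a]
    by (auto simp: comm_square_iff hom_def)
  then have "r \<in> hom C a (Cod C r'')"
    using Comp_in_hom[OF proj_in_hom[OF a(1,2)], of r''] stack(2) a display_map_hom[of r''] by simp
  then show ?thesis
    using assms(2) display_map_hom[OF r''(2)] r''(1) len_ft[OF a(1,2)] a(2) by (auto simp: hom_def)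
qed simp

text \<open>Inversion in terms of the right side alone: the first factor of its display map has to
  be the \<open>proj\<close> of its domain, so two stacks with the same right side have top layers
  with the same right side.\<close>

lemma distinguished_right_Comp:
  assumes "distinguished C (Sq t l r b)" "len C (Dom C r) > len C (Cod C r)"
  obtains f l' l'' r'' where "Sq t l' (proj C (Dom C r)) f \<in> Qsq C" "distinguished C (Sq f l'' r'' b)"
    "l = l'' \<cdot> l'" "Dom C r'' = ft C (Dom C r)" "Cod C r'' = Cod C r" "r = r'' \<cdot> proj C (Dom C r)"
    "Dom C r \<in> Obj C" "len C (Dom C r) \<ge> 1" "display_map C r''"
  using assms(1)
proof cases
  case empty
  then show ?thesis using assms(2) Ident_in_hom[of "Cod C t"] Cod_in_Obj[of t] by (simp add: hom_def)
next
  case (stack l' r' f l'' r'')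
  obtain a where a: "a \<in> Obj C" "len C a \<ge> 1" "r' = proj C a" using Qsq_right[OF stack(3)] by auto
  have r'': "Dom C r'' = ft C a" "display_map C r''"
    using Qsq_comm[OF stack(3)] distinguished_display[OF stack(4)] a proj_in_hom[of a]
    by (auto simp: comm_square_iff hom_def)
  then have "r \<in> hom C a (Cod C r'')"
    using Comp_in_hom[OF proj_in_hom[OF a(1,2)], of r''] stack(2) a display_map_hom[of r''] by simp
  then show ?thesis using that stack a r'' by (simp add: hom_def)
qed

end

section \<open>Uniqueness of distinguished squares and of gap maps\<close>

context contextual_category begin

lemma Qsq_unique:
  assumes "S \<in> Qsq C" "S' \<in> Qsq C" "right S' = right S" "bottom S' = bottom S"
  shows "S' = S"
proof -
  obtain a where a: "a \<in> Obj C" "len C a \<ge> 1" "right S = proj C a"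
    using Qsq_right[OF assms(1)] by blast
  have "bottom S \<in> Arr C" "Cod C (bottom S) = ft C a"
    using Qsq_comm[OF assms(1)] proj_in_hom[OF a(1,2)] a(3) by (auto simp: comm_square_def hom_def)
  then show ?thesis using Qsq_unique_lift[OF a(1,2)] assms a(3) by metis
qed

lemma distinguished_pullback: "distinguished C S \<Longrightarrow> is_pullback C S"
proof (induction rule: distinguished.induct)
  case (empty f)
  then show ?case using is_pullback_Ident by (simp add: hom_def)
next
  case (stack g l' r' f l r b)
  then show ?case using is_pullback_stack Qsq_pullback by blast
qed

text \<open>Peel off the top layers. The right sides of the remaining stacks have equal ends, hence
  coincide, and by induction on the length of the domain the stacks do too. Their common top edge is
  the bottom of both top layers, so uniqueness in \<open>Qsq\<close> applies to these.\<close>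

lemma distinguished_unique:
  assumes "distinguished C S" "distinguished C S'" "right S' = right S" "bottom S' = bottom S"
  shows "S' = S"
  using assms
proof (induction "len C (Dom C (right S))" arbitrary: S S' rule: less_induct)
  case less
  obtain t l r b where S: "S = Sq t l r b" by (cases S)
  obtain t' l' where S': "S' = Sq t' l' r b" using less.prems S by (cases S') auto
  have r: "display_map C r" using distinguished_display less.prems(1) S by fastforce
  show ?case
  proof (cases "len C (Dom C r) = len C (Cod C r)")
    case True
    then show ?thesis using distinguished_Ident_right less.prems(1,2) unfolding S S' by metis
  next
    case False
    then have gt: "len C (Dom C r) > len C (Cod C r)" using display_map_hom[OF r] by simp
    let ?a = "Dom C r"
    from less.prems(1) obtain f l1 l2 r2 where 1: "Sq t l1 (proj C ?a) f \<in> Qsq C"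
      "distinguished C (Sq f l2 r2 b)" "l = l2 \<cdot> l1" "Dom C r2 = ft C ?a" "Cod C r2 = Cod C r"
      "?a \<in> Obj C" "len C ?a \<ge> 1" "display_map C r2"
      using distinguished_right_Comp[OF _ gt] unfolding S by metis
    from less.prems(2) obtain f' l1' l2' r2' where 2: "Sq t' l1' (proj C ?a) f' \<in> Qsq C"
      "distinguished C (Sq f' l2' r2' b)" "l' = l2' \<cdot> l1'" "Dom C r2' = ft C ?a" "Cod C r2' = Cod C r"
      "display_map C r2'"
      using distinguished_right_Comp[OF _ gt] unfolding S' by metis
    have rr: "r2' = r2" using display_map_unique 1 2 by simp
    have "Sq f' l2' r2 b = Sq f l2 r2 b"
      using less.hyps[of "Sq f l2 r2 b" "Sq f' l2' r2 b"] 1 2 len_ft[of ?a] unfolding S rr by simp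
    moreover then have "Sq t' l1' (proj C ?a) f' = Sq t l1 (proj C ?a) f"
      using Qsq_unique[OF 1(1) 2(1)] by simp
    ultimately show ?thesis unfolding S S' using 1(3) 2(3) by simp
  qed
qed

lemma dist_pullback_eq: "distinguished C S \<Longrightarrow> dist_pullback C (right S) (bottom S) = S"
  unfolding dist_pullback_def using distinguished_unique by blast

text \<open>The way back from stacks to \<open>Qsq\<close>, where the axioms on unique lifts and
  horizontal composition live: after one layer a right side of length 1 has no length left, and the
  rest is an empty stack.\<close>

lemma distinguished_Qsq:
  assumes "distinguished C S" "display_map1 C (right S)" shows "S \<in> Qsq C"
proof -
  obtain t l r b where S: "S = Sq t l r b" by (cases S)
  have r: "len C (Dom C r) - len C (Cod C r) = 1"
    using assms(2) S by (simp add: display_map1_def display_length_def)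
  then have gt: "len C (Dom C r) > len C (Cod C r)" by simp
  from assms(1) obtain f l1 l2 r2 where 1: "Sq t l1 (proj C (Dom C r)) f \<in> Qsq C"
      "distinguished C (Sq f l2 r2 b)" "l = l2 \<cdot> l1" "Dom C r2 = ft C (Dom C r)"
      "Cod C r2 = Cod C r" "r = r2 \<cdot> proj C (Dom C r)" "Dom C r \<in> Obj C" "len C (Dom C r) \<ge> 1"
    using distinguished_right_Comp[OF _ gt] unfolding S by metis
  have "Sq f l2 r2 b = Sq b (Ident C (Dom C b)) (Ident C (Cod C b)) b"
    using distinguished_Ident_right[OF 1(2)] 1 r len_ft[of "Dom C r"] by simp
  moreover have "comm_square C (Sq t l1 (proj C (Dom C r)) f)" using Qsq_comm 1(1) by blast
  then have "l1 \<in> hom C (Dom C l1) (Dom C f)" by (auto simp: comm_square_def hom_def)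
  ultimately show ?thesis
    using 1 S Comp_Ident_left display_map1_eq_proj(3)[OF assms(2)] by auto
qed

lemma Qsq_display_map1:
  assumes "S \<in> Qsq C" shows "display_map1 C (left S)" "display_map1 C (right S)"
  using Qsq_left[OF assms] Qsq_right[OF assms] display_map1_proj by auto

lemma one_in_Obj: "one C \<in> Obj C \<and> len C (one C) = 0"
  unfolding one_def using theI'[OF one_unique] .

lemma to_one_hom: "a \<in> Obj C \<Longrightarrow> to_one C a \<in> hom C a (one C)"
  unfolding to_one_def using theI'[OF one_terminal] .

lemma to_one_eq: "f \<in> hom C a (one C) \<Longrightarrow> g \<in> hom C a (one C) \<Longrightarrow> f = g"
  using one_terminal[of a] Dom_in_Obj[of f] by (auto simp: hom_def)

lemma gap_unique:
  assumes "distinguished C S'" "right S' = right S" "bottom S' = bottom S" "comm_square C S"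
  shows "\<exists>!u. u \<in> hom C (Dom C (top S)) (Dom C (top S')) \<and> top S' \<cdot> u = top S \<and> left S' \<cdot> u = left S"
  using is_pullback_lift[OF distinguished_pullback[OF assms(1)], of "top S" "Dom C (top S)" "left S"] assms
  by (auto simp: comm_square_def hom_def)

text \<open>Lets the gap map be computed with a distinguished square constructed elsewhere, such as
  the one found in a cellular diagram; \<open>dist_pullback\<close> is then that very
  square.\<close>

lemma gap_eq:
  assumes "distinguished C S'" "right S' = right S" "bottom S' = bottom S" "comm_square C S"
  shows "gap C S = (THE u. u \<in> hom C (Dom C (top S)) (Dom C (top S')) \<and> top S' \<cdot> u = top S \<and> left S' \<cdot> u = left S)"
  unfolding gap_def Let_def using dist_pullback_eq[OF assms(1)] assms by simp

end

section \<open>Cellular diagrams and their uniqueness\<close>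

context category begin

lemma limit_cone_hom:
  assumes "is_limit_cone J C F a \<pi>"
  shows "a \<in> Obj C" "j \<in> Obj J \<Longrightarrow> \<pi> j \<in> hom C a (omap F j)"
    "u \<in> Arr J \<Longrightarrow> amap F u \<cdot> \<pi> (Dom J u) = \<pi> (Cod J u)"
  using assms by (auto simp: is_limit_cone_def is_cone_def)

lemma limit_cone_lift:
  assumes "is_limit_cone J C F a \<pi>" "is_cone J C F b \<rho>"
  shows "\<exists>!h. h \<in> hom C b a \<and> (\<forall>j \<in> Obj J. \<pi> j \<cdot> h = \<rho> j)"
  using assms by (auto simp: is_limit_cone_def)

lemma is_cone_Comp:
  assumes "is_cone J C F a \<pi>" "is_functor J C F" "category J" "h \<in> hom C b a"
  shows "is_cone J C F b (\<lambda>j. \<pi> j \<cdot> h)"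
  unfolding is_cone_def
proof (intro conjI ballI)
  interpret J: category J by fact
  show "b \<in> Obj C" using assms(4) Dom_in_Obj by (auto simp: hom_def)
  show "\<pi> j \<cdot> h \<in> hom C b (omap F j)" if "j \<in> Obj J" for j
    using assms that by (auto simp: is_cone_def intro: Comp_in_hom)
  fix u assume u: "u \<in> Arr J"
  have "\<pi> (Dom J u) \<in> hom C a (omap F (Dom J u))" "amap F u \<cdot> \<pi> (Dom J u) = \<pi> (Cod J u)"
    "amap F u \<in> hom C (omap F (Dom J u)) (omap F (Cod J u))"
    using assms(1,2) u J.Dom_in_Obj by (auto simp: is_cone_def is_functor_def)
  then show "amap F u \<cdot> (\<pi> (Dom J u) \<cdot> h) = \<pi> (Cod J u) \<cdot> h"
    using Comp_assoc[OF assms(4)] by metis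
qed

lemma limit_cone_eqI:
  assumes "is_limit_cone J C F a \<pi>" "is_functor J C F" "category J"
    "h \<in> hom C b a" "k \<in> hom C b a" "\<And>j. j \<in> Obj J \<Longrightarrow> \<pi> j \<cdot> h = \<pi> j \<cdot> k"
  shows "h = k"
proof -
  have "is_cone J C F b (\<lambda>j. \<pi> j \<cdot> k)"
    using is_cone_Comp assms(1-3,5) by (auto simp: is_limit_cone_def)
  then show ?thesis using limit_cone_lift[OF assms(1)] assms(4-6) by blast
qed

end

section \<open>Finite posets with a linear order, and diagrams on them\<close>

lemma poset_op_sel [simp]:
  "Obj (poset_op P le) = P"
  "Arr (poset_op P le) = {(y, x). x \<in> P \<and> y \<in> P \<and> (x, y) \<in> le}"
  "Dom (poset_op P le) u = fst u" "Cod (poset_op P le) u = snd u"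
  "Ident (poset_op P le) x = (x, x)"
  "Comp (poset_op P le) v u = (fst u, snd v)"
  by (auto simp: poset_op_def split: prod.splits)

text \<open>\<open>lin\<close> is constrained only on \<open>P\<close>, because a local
  linearization is linear merely inside each principal sieve. Nothing refers to a surrounding poset,
  so the same two relations serve for every subset of \<open>P\<close>.\<close>

locale linearized_poset =
  fixes P :: "'p set" and le :: "'p rel" and lin :: "'p rel"
  assumes finite_P: "finite P"
    and le_refl: "x \<in> P \<Longrightarrow> (x, x) \<in> le"
    and le_trans: "trans le"
    and le_antisym: "antisym le"
    and lin_total: "x \<in> P \<Longrightarrow> y \<in> P \<Longrightarrow> (x, y) \<in> lin \<or> (y, x) \<in> lin"
    and lin_trans: "x \<in> P \<Longrightarrow> y \<in> P \<Longrightarrow> z \<in> P \<Longrightarrow> (x, y) \<in> lin \<Longrightarrow> (y, z) \<in> lin \<Longrightarrow> (x, z) \<in> lin"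
    and lin_antisym: "x \<in> P \<Longrightarrow> y \<in> P \<Longrightarrow> (x, y) \<in> lin \<Longrightarrow> (y, x) \<in> lin \<Longrightarrow> x = y"
    and le_lin: "x \<in> P \<Longrightarrow> y \<in> P \<Longrightarrow> (x, y) \<in> le \<Longrightarrow> (x, y) \<in> lin"
begin

lemma linearized_subset:
  assumes "Q \<subseteq> P" shows "linearized_poset Q le lin"
proof unfold_locales
  have Q: "x \<in> P" if "x \<in> Q" for x using assms that by blast
  show "finite Q" using finite_subset[OF assms finite_P] .
  show "trans le" "antisym le" using le_trans le_antisym by auto
  fix x y z assume x: "x \<in> Q"
  show "(x, x) \<in> le" using le_refl Q x by simp
  assume y: "y \<in> Q"
  show "(x, y) \<in> lin \<or> (y, x) \<in> lin" using lin_total Q x y by simp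
  show "x = y" if "(x, y) \<in> lin" "(y, x) \<in> lin" using lin_antisym[of x y] Q x y that by simp
  show "(x, y) \<in> lin" if "(x, y) \<in> le" using le_lin[of x y] Q x y that by simp
  assume z: "z \<in> Q"
  show "(x, z) \<in> lin" if "(x, y) \<in> lin" "(y, z) \<in> lin" using lin_trans[of x y z] Q x y z that by simp
qed

lemma ex_lin_max:
  assumes "X \<subseteq> P" "X \<noteq> {}" shows "\<exists>y \<in> X. \<forall>x \<in> X. (x, y) \<in> lin"
proof -
  have "finite X" using finite_subset finite_P assms by blast
  then show ?thesis using assms(2,1)
  proof (induction rule: finite_ne_induct)
    case (singleton x)
    then show ?case using lin_total[of x x] by auto
  next
    case (insert x X)
    then obtain y where y: "y \<in> X" "\<forall>x \<in> X. (x, y) \<in> lin" by auto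
    show ?case
    proof (cases "(x, y) \<in> lin")
      case True
      then show ?thesis using y by auto
    next
      case False
      then have "(y, x) \<in> lin" "(x, x) \<in> lin" using lin_total[of x y] lin_total[of x x] insert y by auto
      then have "\<forall>z \<in> insert x X. (z, x) \<in> lin" using lin_trans[of _ y x] insert.prems y by blast
      then show ?thesis by blast
    qed
  qed
qed

lemma sieve_under: "sieve P le (under le y \<inter> P)"
  using transD[OF le_trans] by (fastforce simp: sieve_def under_def)

lemma sieve_underS: "sieve P le (underS le y \<inter> P)"
  using transD[OF le_trans] antisymD[OF le_antisym] by (fastforce simp: sieve_def underS_def)

text \<open>As \<open>lin\<close> refines \<open>le\<close>, no other element of \<open>X\<close>
  lies above its \<open>lin\<close>-greatest one in \<open>le\<close>.\<close>

lemma sieve_remove_max: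
  assumes "sieve P le X" "y \<in> X" "\<forall>x \<in> X. (x, y) \<in> lin"
  shows "sieve P le (X - {y})"
proof -
  have "w \<noteq> y" if "x \<in> X" "x \<noteq> y" "w \<in> P" "(w, x) \<in> le" for w x
    using assms that le_lin[of y x] lin_antisym[of y x] unfolding sieve_def by blast
  then show ?thesis using assms(1) unfolding sieve_def by blast
qed

lemma category_poset_op: "category (poset_op P le)"
proof -
  have "(x, z) \<in> le" if "(x, y) \<in> le" "(y, z) \<in> le" for x y z
    using transD[OF le_trans] that .
  then show ?thesis by unfold_locales (force simp: hom_def le_refl)+
qed

end

lemma is_functor_poset_op:
  "is_functor (poset_op P le) C F \<longleftrightarrow>
    (\<forall>x \<in> P. omap F x \<in> Obj C) \<and>
    (\<forall>x \<in> P. \<forall>y \<in> P. (x, y) \<in> le \<longrightarrow> amap F (y, x) \<in> hom C (omap F y) (omap F x)) \<and>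
    (\<forall>x \<in> P. amap F (x, x) = Ident C (omap F x)) \<and>
    (\<forall>x \<in> P. \<forall>y \<in> P. \<forall>z \<in> P. (x, y) \<in> le \<and> (y, z) \<in> le
      \<longrightarrow> amap F (z, x) = Comp C (amap F (y, x)) (amap F (z, y)))"
  unfolding is_functor_def by auto

lemma is_functor_poset_op_subset:
  "is_functor (poset_op P le) C F \<Longrightarrow> Q \<subseteq> P \<Longrightarrow> is_functor (poset_op Q le) C F"
  unfolding is_functor_poset_op by blast

locale poset_diagram = contextual_category C + linearized_poset P le lin
  for C :: "('o, 'm, 'z) precontextual_scheme" (structure)
    and P :: "'p set" and le :: "'p rel" and lin :: "'p rel" +
  fixes F :: "('p, 'p \<times> 'p, 'o, 'm) functor_data"
  assumes functor_F: "is_functor (poset_op P le) C F"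
begin

lemma F_Obj: "x \<in> P \<Longrightarrow> omap F x \<in> Obj C"
  and F_hom: "x \<in> P \<Longrightarrow> y \<in> P \<Longrightarrow> (x, y) \<in> le \<Longrightarrow> amap F (y, x) \<in> hom C (omap F y) (omap F x)"
  and F_Ident: "x \<in> P \<Longrightarrow> amap F (x, x) = Ident C (omap F x)"
  using functor_F unfolding is_functor_poset_op by auto

lemma poset_diagram_subset: "Q \<subseteq> P \<Longrightarrow> poset_diagram C Q le lin F"
  using linearized_subset is_functor_poset_op_subset[OF functor_F]
  by (simp add: poset_diagram_def poset_diagram_axioms_def contextual_category_axioms)

lemma limit_cone_poset_eqI:
  assumes "X \<subseteq> P" "is_limit_cone (poset_op X le) C F a \<pi>" "h \<in> hom C b a" "k \<in> hom C b a"
    "\<And>x. x \<in> X \<Longrightarrow> \<pi> x \<cdot> h = \<pi> x \<cdot> k"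
  shows "h = k"
  using limit_cone_eqI[OF assms(2) is_functor_poset_op_subset[OF functor_F assms(1)] _ assms(3,4)]
    linearized_poset.category_poset_op[OF linearized_subset[OF assms(1)]] assms(5) by simp

end

section \<open>Restriction maps of a cell choice\<close>

locale cell_diagram = poset_diagram C P le lin F
  for C :: "('o, 'm, 'z) precontextual_scheme" (structure)
    and P :: "'p set" and le :: "'p rel" and lin :: "'p rel"
    and F :: "('p, 'p \<times> 'p, 'o, 'm) functor_data" +
  fixes K :: "'p set \<Rightarrow> 'o \<times> ('p \<Rightarrow> 'm)"
  assumes cell: "cell_choice C P le lin F K"
begin

abbreviation "res \<equiv> restrict_map C K"

lemma limit_K: "sieve P le X \<Longrightarrow> is_limit_cone (poset_op X le) C F (fst (K X)) (snd (K X))"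
  and K_empty: "fst (K {}) = one C"
  and K_under: "x \<in> P \<Longrightarrow> fst (K (under le x \<inter> P)) = omap F x"
  and leg_under: "x \<in> P \<Longrightarrow> y \<in> under le x \<inter> P \<Longrightarrow> snd (K (under le x \<inter> P)) y = amap F (x, y)"
  using cell by (simp_all add: cell_choice_def)

lemma res_display:
  assumes "sieve P le X" "sieve P le Y" "X \<subseteq> Y" "Y - X = {y}" "\<forall>x \<in> X. (x, y) \<in> lin"
  shows "display_map1 C (res Y X)"
  using cell assms unfolding cell_choice_def by blast

lemma res_distinguished:
  assumes "sieve P le X" "sieve P le X'" "sieve P le Y" "sieve P le Y'"
    "X \<subseteq> X'" "Y \<subseteq> Y'" "X \<subseteq> Y" "X' \<subseteq> Y'" "Y - X = {y}" "Y' - X' = {y}"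
    "\<forall>x \<in> X'. (x, y) \<in> lin"
  shows "distinguished C (Sq (res Y' Y) (res Y' X') (res Y X) (res X' X))"
  using cell assms unfolding cell_choice_def by blast

lemma K_Obj: "sieve P le X \<Longrightarrow> fst (K X) \<in> Obj C"
  using limit_cone_hom(1)[OF limit_K] .

lemma leg_hom: "sieve P le X \<Longrightarrow> x \<in> X \<Longrightarrow> snd (K X) x \<in> hom C (fst (K X)) (omap F x)"
  using limit_cone_hom(2)[OF limit_K] by simp

lemma leg_F: "sieve P le X \<Longrightarrow> x \<in> X \<Longrightarrow> y \<in> X \<Longrightarrow> (y, x) \<in> le
    \<Longrightarrow> amap F (x, y) \<cdot> snd (K X) x = snd (K X) y"
  using limit_cone_hom(3)[OF limit_K, of X "(x, y)"] by simp

lemma map_eqI: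
  assumes "sieve P le X" "h \<in> hom C b (fst (K X))" "k \<in> hom C b (fst (K X))"
    "\<And>x. x \<in> X \<Longrightarrow> snd (K X) x \<cdot> h = snd (K X) x \<cdot> k"
  shows "h = k"
  using limit_cone_poset_eqI[OF _ limit_K[OF assms(1)] assms(2,3)] assms(1,4) by (simp add: sieve_def)

lemma res_ex1:
  assumes "sieve P le X" "sieve P le Y" "X \<subseteq> Y"
  shows "\<exists>!h. h \<in> hom C (fst (K Y)) (fst (K X)) \<and> (\<forall>x \<in> X. snd (K X) x \<cdot> h = snd (K Y) x)"
proof -
  have "is_cone (poset_op X le) C F (fst (K Y)) (snd (K Y))"
    using leg_hom[OF assms(2)] leg_F[OF assms(2)] assms(3) K_Obj[OF assms(2)]
    by (auto simp: is_cone_def)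
  then show ?thesis using limit_cone_lift[OF limit_K[OF assms(1)]] by simp
qed

lemma res_hom:
    "sieve P le X \<Longrightarrow> sieve P le Y \<Longrightarrow> X \<subseteq> Y \<Longrightarrow> res Y X \<in> hom C (fst (K Y)) (fst (K X))"
  and leg_res:
    "sieve P le X \<Longrightarrow> sieve P le Y \<Longrightarrow> X \<subseteq> Y \<Longrightarrow> x \<in> X \<Longrightarrow> snd (K X) x \<cdot> res Y X = snd (K Y) x"
  using theI'[OF res_ex1[of X Y]] unfolding restrict_map_def by auto

lemma res_eqI:
  assumes "sieve P le X" "sieve P le Y" "X \<subseteq> Y" "h \<in> hom C (fst (K Y)) (fst (K X))"
    "\<And>x. x \<in> X \<Longrightarrow> snd (K X) x \<cdot> h = snd (K Y) x"
  shows "res Y X = h"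
  using map_eqI[OF assms(1) res_hom[OF assms(1-3)] assms(4)] leg_res[OF assms(1-3)] assms(5) by simp

lemma res_Comp:
  assumes "sieve P le X" "sieve P le Y" "sieve P le Z" "X \<subseteq> Y" "Y \<subseteq> Z"
  shows "res Y X \<cdot> res Z Y = res Z X"
proof (rule res_eqI[symmetric])
  have h: "res Z Y \<in> hom C (fst (K Z)) (fst (K Y))" "res Y X \<in> hom C (fst (K Y)) (fst (K X))"
    using res_hom assms by auto
  show "res Y X \<cdot> res Z Y \<in> hom C (fst (K Z)) (fst (K X))" using Comp_in_hom[OF h] .
  fix x assume x: "x \<in> X"
  show "snd (K X) x \<cdot> (res Y X \<cdot> res Z Y) = snd (K Z) x"
    using Comp_assoc[OF h leg_hom[OF assms(1) x]] leg_res[of X Y x] leg_res[of Y Z x] assms x by auto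
qed (use assms in auto)

lemma res_self: "sieve P le X \<Longrightarrow> res X X = Ident C (fst (K X))"
  using res_eqI[of X X] Ident_in_hom[OF K_Obj] Comp_Ident_right[OF leg_hom] by simp

text \<open>The limit over the principal sieve of \<open>y\<close> is \<open>F(y)\<close> with an
  identity as leg at \<open>y\<close>, so following the restriction by this leg changes
  nothing.\<close>

lemma res_under_leg:
  assumes "sieve P le X" "y \<in> X"
  shows "res X (under le y \<inter> P) \<in> hom C (fst (K X)) (omap F y)" "res X (under le y \<inter> P) = snd (K X) y"
proof -
  have y: "y \<in> P" and s: "under le y \<inter> P \<subseteq> X" using assms by (auto simp: sieve_def under_def)
  then show h: "res X (under le y \<inter> P) \<in> hom C (fst (K X)) (omap F y)"
    using res_hom[OF sieve_under assms(1) s] K_under[OF y] by simp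
  have "y \<in> under le y \<inter> P" using y le_refl by (auto simp: under_def)
  then have "amap F (y, y) \<cdot> res X (under le y \<inter> P) = snd (K X) y"
    using leg_res[OF sieve_under assms(1) s, of y] leg_under[OF y, of y] by simp
  then show "res X (under le y \<inter> P) = snd (K X) y"
    using F_Ident[OF y] Comp_Ident_left[OF h] by simp
qed

lemma under_minus: "y \<in> P \<Longrightarrow> under le y \<inter> P - (underS le y \<inter> P) = {y}"
  using le_refl by (auto simp: under_def underS_def)

text \<open>The distinguished-square condition for the inclusion of the principal sieve of
  \<open>y\<close> into \<open>X\<close>, with \<open>y\<close> removed from both in the lower row.
  It recovers the limit over \<open>X\<close> from \<open>F(y)\<close> and limits over sieves
  without \<open>y\<close>, which makes induction along \<open>lin\<close> possible.\<close>

lemma cell_attach: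
  assumes "sieve P le X" "y \<in> X" "\<forall>x \<in> X. (x, y) \<in> lin"
  shows "Sq (snd (K X) y) (res X (X - {y})) (res (under le y \<inter> P) (underS le y \<inter> P))
    (res (X - {y}) (underS le y \<inter> P)) \<in> Qsq C"
proof -
  have y: "y \<in> P" and s: "under le y \<inter> P \<subseteq> X" using assms by (auto simp: sieve_def under_def)
  have s': "underS le y \<inter> P \<subseteq> X - {y}" "underS le y \<inter> P \<subseteq> under le y \<inter> P"
    using s by (auto simp: underS_def under_def)
  note 1 = sieve_under[of y] sieve_underS[of y] sieve_remove_max[OF assms] under_minus[OF y]
  have "X - (X - {y}) = {y}" using assms by auto
  then have "distinguished C (Sq (res X (under le y \<inter> P)) (res X (X - {y}))
      (res (under le y \<inter> P) (underS le y \<inter> P)) (res (X - {y}) (underS le y \<inter> P)))"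
    using res_distinguished[OF 1(2,3,1) assms(1) s'(1) s s'(2) _ 1(4)] assms(3) by auto
  moreover have "display_map1 C (res (under le y \<inter> P) (underS le y \<inter> P))"
    using res_display[OF 1(2,1) s'(2) 1(4)] s' assms(3) by auto
  ultimately show ?thesis
    using distinguished_Qsq res_under_leg(2)[OF assms(1,2)] by simp
qed

end

section \<open>Uniqueness of cell choices\<close>

lemma restrict_map_cong:
  assumes "fst (K X) = fst (K' X)" "fst (K Y) = fst (K' Y)" "X \<subseteq> Y"
    "\<And>x. x \<in> X \<Longrightarrow> snd (K X) x = snd (K' X) x" "\<And>x. x \<in> Y \<Longrightarrow> snd (K Y) x = snd (K' Y) x"
  shows "restrict_map C K Y X = restrict_map C K' Y X"
proof -
  have "(\<forall>x \<in> X. Comp C (snd (K X) x) h = snd (K Y) x) \<longleftrightarrow> (\<forall>x \<in> X. Comp C (snd (K' X) x) h = snd (K' Y) x)" for h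
    using assms by (metis subsetD)
  then show ?thesis unfolding restrict_map_def using assms by simp
qed

text \<open>Two ambient posets are allowed because \<open>cell_cone\<close> ranges over every
  principal sieve containing \<open>X\<close>. Induct on \<open>card X\<close> and remove the
  \<open>lin\<close>-greatest \<open>y\<close>: the right and bottom sides in
  \<open>cell_attach\<close> agree for both choices, so the squares are equal. The top is the leg at
  \<open>y\<close>; the other legs factor through the left side.\<close>

lemma cell_diagram_unique:
  assumes "cell_diagram C P le lin F K" "cell_diagram C P' le lin F K'"
    "sieve P le X" "sieve P' le X"
  shows "fst (K' X) = fst (K X) \<and> (\<forall>x \<in> X. snd (K' X) x = snd (K X) x)"
proof -
  interpret cell_diagram C P le lin F K by fact
  interpret K': cell_diagram C P' le lin F K' by fact
  have "finite X" using assms(3) finite_P finite_subset by (auto simp: sieve_def)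
  then show ?thesis using assms(3,4)
  proof (induction "card X" arbitrary: X rule: less_induct)
    case less
    show ?case
    proof (cases "X = {}")
      case True
      then show ?thesis using K_empty K'.K_empty by simp
    next
      case False
      have XP: "X \<subseteq> P" "X \<subseteq> P'" using less.prems(2,3) by (simp_all add: sieve_def)
      obtain y where y: "y \<in> X" "\<forall>x \<in> X. (x, y) \<in> lin"
        using ex_lin_max[OF XP(1) False] by blast
      let ?U = "under le y \<inter> P" and ?D = "underS le y \<inter> P" and ?X = "X - {y}"
      have yP: "y \<in> P" "y \<in> P'" using y(1) XP by auto
      have UX: "?U \<subseteq> X" "under le y \<inter> P' \<subseteq> X"
        using y(1) less.prems(2,3) unfolding sieve_def under_def by blast+
      \<comment> \<open>Being downward closed in both posets, \<open>X\<close> contains everything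
        below \<open>y\<close> in either, so the principal sieve of \<open>y\<close> is the same in
        \<open>P\<close> and \<open>P'\<close>.\<close>
      then have U: "under le y \<inter> P' = ?U" and D: "underS le y \<inter> P' = ?D"
        using XP unfolding under_def underS_def by blast+
      have DU: "?D \<subseteq> ?U" "?D \<subseteq> ?X" using UX by (auto simp: under_def underS_def)
      have card: "card ?X < card X" using card_Diff1_less[OF less.prems(1) y(1)] .
      moreover have "card ?D \<le> card ?X" using card_mono[OF _ DU(2)] less.prems(1) by simp
      ultimately have cD: "card ?D < card X" by simp
      have IH: "fst (K' Y) = fst (K Y)" "\<And>x. x \<in> Y \<Longrightarrow> snd (K' Y) x = snd (K Y) x"
        if "sieve P le Y" "sieve P' le Y" "card Y < card X" "Y \<subseteq> X" for Y
        using less.hyps[OF that(3) finite_subset[OF that(4) less.prems(1)] that(1,2)] by auto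
      note sX = sieve_remove_max[OF less.prems(2) y] K'.sieve_remove_max[OF less.prems(3) y]
      note sD = sieve_underS[of y] K'.sieve_underS[of y, unfolded D]
      \<comment> \<open>The principal sieve may be all of \<open>X\<close>, out of reach of the
        induction; there the values are prescribed by \<open>F\<close>.\<close>
      have fU: "fst (K' ?U) = fst (K ?U)" "\<And>x. x \<in> ?U \<Longrightarrow> snd (K' ?U) x = snd (K ?U) x"
        using K_under[OF yP(1)] K'.K_under[OF yP(2)] leg_under[OF yP(1)] K'.leg_under[OF yP(2)]
        unfolding U by auto
      have IX: "fst (K' ?X) = fst (K ?X)" "\<And>x. x \<in> ?X \<Longrightarrow> snd (K' ?X) x = snd (K ?X) x"
        using IH[OF sX card] by auto
      have ID: "fst (K' ?D) = fst (K ?D)" "\<And>x. x \<in> ?D \<Longrightarrow> snd (K' ?D) x = snd (K ?D) x"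
        using IH[OF sD cD] DU by auto
      have 1: "K'.res ?U ?D = res ?U ?D" "K'.res ?X ?D = res ?X ?D"
        using fU IX ID DU by (auto intro!: restrict_map_cong)
      have sq: "Sq (snd (K' X) y) (K'.res X ?X) (res ?U ?D) (res ?X ?D)
          = Sq (snd (K X) y) (res X ?X) (res ?U ?D) (res ?X ?D)"
        by (rule Qsq_unique[OF cell_attach[OF less.prems(2) y]
              K'.cell_attach[OF less.prems(3) y, unfolded U D 1]]) simp_all
      have XX: "?X \<subseteq> X" by auto
      have r: "K'.res X ?X = res X ?X" using sq by simp
      then have "fst (K' X) = fst (K X)"
        using res_hom[OF sX(1) less.prems(2) XX] K'.res_hom[OF sX(2) less.prems(3) XX]
        by (simp add: hom_def)
      moreover have "snd (K' X) x = snd (K X) x" if "x \<in> X" for x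
      proof (cases "x = y")
        case True
        then show ?thesis using sq by simp
      next
        case False
        then have x: "x \<in> ?X" using that by auto
        show ?thesis
          using leg_res[OF sX(1) less.prems(2) XX x] K'.leg_res[OF sX(2) less.prems(3) XX x]
            r IX(2)[OF x] by simp
      qed
      ultimately show ?thesis by blast
    qed
  qed
qed

section \<open>Attaching a cell\<close>

text \<open>The limit over a sieve containing \<open>y\<close> is the pullback of \<open>g\<close> along the restriction to the
  boundary of \<open>y\<close>; for the principal sieve of \<open>y\<close> this is \<open>F(y)\<close> on the nose, by uniqueness of
  distinguished squares.\<close>

lemma cell_choice_insert:
  fixes C :: "('o, 'm, 'z) precontextual_scheme" (structure)
  assumes "poset_diagram C (insert y P) le lin F" "y \<notin> P" "cell_choice C P le lin F K"
    and y_max: "\<And>x. x \<in> P \<Longrightarrow> (x, y) \<in> lin"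
    and g: "g \<in> hom C (omap F y) (fst (K (underS le y \<inter> P)))"
    and g_leg: "\<And>x. x \<in> underS le y \<inter> P \<Longrightarrow> snd (K (underS le y \<inter> P)) x \<cdot> g = amap F (y, x)"
    and g_display: "display_map1 C g"
  shows "\<exists>K'. cell_choice C (insert y P) le lin F K'"
proof -
  let ?P = "insert y P" and ?D = "underS le y \<inter> P"
  interpret contextual_category C using assms(1) by (simp add: poset_diagram_def)
  interpret P': poset_diagram C ?P le lin F by fact
  interpret cell_diagram C P le lin F K
    using P'.poset_diagram_subset[of P] assms(3) by (auto simp: cell_diagram_def cell_diagram_axioms_def)
  have not_le: "(y, x) \<notin> le" if "x \<in> P" for x
    using P'.le_lin[of y x] P'.lin_antisym[of y x] y_max[of x] that \<open>y \<notin> P\<close> by auto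
  have sieve_P: "sieve P le X \<longleftrightarrow> sieve ?P le X \<and> y \<notin> X" for X
    using not_le \<open>y \<notin> P\<close> unfolding sieve_def by blast
  have sD: "sieve P le ?D" using sieve_underS .
  have sX: "sieve P le (Y - {y})" "?D \<subseteq> Y - {y}" if "sieve ?P le Y" "y \<in> Y" for Y
    using that not_le \<open>y \<notin> P\<close> unfolding sieve_def underS_def by blast+
  define S where "S Y = (THE S. S \<in> Qsq C \<and> right S = g \<and> bottom S = res (Y - {y}) ?D)" for Y
  define K' where "K' Y = (if y \<in> Y
    then (Dom C (top (S Y)), \<lambda>x. if x = y then top (S Y) else snd (K (Y - {y})) x \<cdot> left (S Y))
    else K Y)" for Y
  note gp = display_map1_eq_proj[OF g_display]
  have S: "S Y \<in> Qsq C" "right (S Y) = g" "bottom (S Y) = res (Y - {y}) ?D"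
    if "sieve ?P le Y" "y \<in> Y" for Y
  proof -
    have "res (Y - {y}) ?D \<in> Arr C" "Cod C (res (Y - {y}) ?D) = ft C (Dom C g)"
      using res_hom[OF sD sX[OF that]] g gp(4) by (auto simp: hom_def)
    then have "\<exists>!S. S \<in> Qsq C \<and> right S = g \<and> bottom S = res (Y - {y}) ?D"
      using Qsq_unique_lift[OF gp(1,2)] gp(3) by simp
    from theI'[OF this]
    show "S Y \<in> Qsq C" "right (S Y) = g" "bottom (S Y) = res (Y - {y}) ?D" unfolding S_def by auto
  qed
  have S_eq: "S Y = T" if "sieve ?P le Y" "y \<in> Y" "T \<in> Qsq C" "right T = g"
      "bottom T = res (Y - {y}) ?D" for Y T
    using Qsq_unique[OF that(3) S(1)[OF that(1,2)]] S(2,3)[OF that(1,2)] that(4,5) by simp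
  have S_top: "top (S Y) \<in> hom C (fst (K' Y)) (omap F y)"
    and S_left: "left (S Y) \<in> hom C (fst (K' Y)) (fst (K (Y - {y})))"
    and S_comm: "g \<cdot> top (S Y) = res (Y - {y}) ?D \<cdot> left (S Y)"
    if "sieve ?P le Y" "y \<in> Y" for Y
    using Qsq_comm[OF S(1)[OF that]] S[OF that] g res_hom[OF sD sX[OF that]] that(2)
    by (auto simp: comm_square_def hom_def K'_def)
  have K'_y: "snd (K' Y) y = top (S Y)"
    and K'_x: "x \<noteq> y \<Longrightarrow> snd (K' Y) x = snd (K (Y - {y})) x \<cdot> left (S Y)" if "y \<in> Y" for Y x
    using that by (auto simp: K'_def)
  have K'_old: "K' Y = K Y" if "y \<notin> Y" for Y using that by (simp add: K'_def)
  have limit: "is_limit_cone (poset_op Y le) C F (fst (K' Y)) (snd (K' Y))" if Y: "sieve ?P le Y" for Y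
  proof (cases "y \<in> Y")
    case False
    then show ?thesis using limit_K[of Y] sieve_P[of Y] Y by (simp add: K'_old)
  next
    case True
    let ?X = "Y - {y}"
    note SY = S[OF Y True] and tl = S_top[OF Y True] S_left[OF Y True] and sc = S_comm[OF Y True]
      and X = sX[OF Y True]
    have legs: "snd (K' Y) x \<in> hom C (fst (K' Y)) (omap F x)" if "x \<in> Y" for x
    proof (cases "x = y")
      case False
      then show ?thesis using K'_x[OF True] Comp_in_hom[OF tl(2) leg_hom[OF X(1)], of x] that by simp
    qed (use K'_y[OF True] tl(1) in simp)
    have cone: "amap F (x, w) \<cdot> snd (K' Y) x = snd (K' Y) w" if x: "x \<in> Y" "w \<in> Y" "(w, x) \<in> le" for x w
    proof (cases "x = y")
      case xy: True
      show ?thesis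
      proof (cases "w = y")
        case True
        then show ?thesis using xy P'.F_Ident[of y] Comp_Ident_left[OF legs[of y]] x by simp
      next
        case False
        then have w: "w \<in> ?D" "w \<in> ?X" using x xy Y unfolding sieve_def underS_def by auto
        have "amap F (x, w) \<cdot> snd (K' Y) x = (snd (K ?D) w \<cdot> g) \<cdot> top (S Y)"
          using g_leg[OF w(1)] xy K'_y[OF True] by simp
        also have "\<dots> = snd (K ?D) w \<cdot> (res ?X ?D \<cdot> left (S Y))"
          using Comp_assoc[OF tl(1) g leg_hom[OF sD w(1)]] sc by simp
        also have "\<dots> = snd (K ?X) w \<cdot> left (S Y)"
          using Comp_assoc[OF tl(2) res_hom[OF sD X] leg_hom[OF sD w(1)]] leg_res[OF sD X w(1)] by simp
        finally show ?thesis using K'_x[OF True] False by simp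
      qed
    next
      case False
      then have xP: "x \<in> P" "x \<in> ?X" using x Y unfolding sieve_def by auto
      then have wy: "w \<noteq> y" "w \<in> ?X" "w \<in> P" using not_le x Y unfolding sieve_def by auto
      have "amap F (x, w) \<cdot> (snd (K ?X) x \<cdot> left (S Y)) = snd (K ?X) w \<cdot> left (S Y)"
        using Comp_assoc[OF tl(2) leg_hom[OF X(1) xP(2)] F_hom[OF wy(3) xP(1) x(3)]]
          leg_F[OF X(1) xP(2) wy(2) x(3)] by simp
      then show ?thesis using K'_x[OF True] wy(1) False by simp
    qed
    have "fst (K' Y) \<in> Obj C" using tl(1) Dom_in_Obj[of "top (S Y)"] by (simp add: hom_def)
    then have "is_cone (poset_op Y le) C F (fst (K' Y)) (snd (K' Y))"
      using legs cone by (auto simp: is_cone_def)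
    moreover have "\<exists>!h. h \<in> hom C b (fst (K' Y)) \<and> (\<forall>x \<in> Y. snd (K' Y) x \<cdot> h = \<rho> x)"
      if \<rho>: "is_cone (poset_op Y le) C F b \<rho>" for b \<rho>
    proof -
      have "is_cone (poset_op ?X le) C F b \<rho>" using \<rho> by (auto simp: is_cone_def)
      from limit_cone_lift[OF limit_K[OF X(1)] this]
      obtain k where k: "k \<in> hom C b (fst (K ?X))" "\<And>x. x \<in> ?X \<Longrightarrow> snd (K ?X) x \<cdot> k = \<rho> x"
        "\<And>k'. k' \<in> hom C b (fst (K ?X)) \<Longrightarrow> \<forall>x \<in> ?X. snd (K ?X) x \<cdot> k' = \<rho> x \<Longrightarrow> k' = k"
        by auto
      have \<rho>y: "\<rho> y \<in> hom C b (omap F y)" using \<rho> True by (auto simp: is_cone_def)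
      \<comment> \<open>Compatibility needed for the pullback, checked on the legs of the limit over
        the boundary of \<open>y\<close>: at \<open>x\<close> both sides are
        \<open>\<rho> x\<close>, once through \<open>y\<close> and once through the cells other than
        \<open>y\<close>.\<close>
      have "g \<cdot> \<rho> y = res ?X ?D \<cdot> k"
      proof (rule map_eqI[OF sD])
        show "g \<cdot> \<rho> y \<in> hom C b (fst (K ?D))" using Comp_in_hom[OF \<rho>y g] .
        show "res ?X ?D \<cdot> k \<in> hom C b (fst (K ?D))" using Comp_in_hom[OF k(1) res_hom[OF sD X]] .
        fix x assume x: "x \<in> ?D"
        then have xX: "x \<in> ?X" using X(2) by auto
        have "amap F (y, x) \<cdot> \<rho> y = \<rho> x"
          using \<rho> x xX True unfolding is_cone_def by (force simp: underS_def)
        then have "snd (K ?D) x \<cdot> (g \<cdot> \<rho> y) = \<rho> x"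
          using Comp_assoc[OF \<rho>y g leg_hom[OF sD x]] g_leg[OF x] by simp
        moreover have "snd (K ?D) x \<cdot> (res ?X ?D \<cdot> k) = \<rho> x"
          using Comp_assoc[OF k(1) res_hom[OF sD X] leg_hom[OF sD x]] leg_res[OF sD X x] k(2)[OF xX]
          by simp
        ultimately show "snd (K ?D) x \<cdot> (g \<cdot> \<rho> y) = snd (K ?D) x \<cdot> (res ?X ?D \<cdot> k)" by simp
      qed
      moreover have "Dom C g = omap F y" "Dom C (res ?X ?D) = fst (K ?X)" "Dom C (top (S Y)) = fst (K' Y)"
        using g res_hom[OF sD X] tl(1) by (auto simp: hom_def)
      ultimately have "\<exists>!w. w \<in> hom C b (fst (K' Y)) \<and> top (S Y) \<cdot> w = \<rho> y \<and> left (S Y) \<cdot> w = k"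
        using is_pullback_lift[OF Qsq_pullback[OF SY(1)], of "\<rho> y" b k] SY \<rho>y k(1) by simp
      then obtain w where w: "w \<in> hom C b (fst (K' Y))" "top (S Y) \<cdot> w = \<rho> y" "left (S Y) \<cdot> w = k"
        "\<And>w'. w' \<in> hom C b (fst (K' Y)) \<Longrightarrow> top (S Y) \<cdot> w' = \<rho> y \<Longrightarrow> left (S Y) \<cdot> w' = k \<Longrightarrow> w' = w"
        by blast
      have leg_w: "snd (K' Y) x \<cdot> w' = snd (K ?X) x \<cdot> (left (S Y) \<cdot> w')"
        if "w' \<in> hom C b (fst (K' Y))" "x \<in> ?X" for w' x
        using Comp_assoc[OF that(1) tl(2) leg_hom[OF X(1) that(2)]] K'_x[OF True, of x] that by simp
      show ?thesis
      proof (rule ex1I[of _ w])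
        have "snd (K' Y) x \<cdot> w = \<rho> x" if "x \<in> Y" for x
          using w(2,3) leg_w[OF w(1), of x] k(2)[of x] K'_y[OF True] that by (cases "x = y") simp_all
        then show "w \<in> hom C b (fst (K' Y)) \<and> (\<forall>x \<in> Y. snd (K' Y) x \<cdot> w = \<rho> x)"
          using w(1) by blast
        fix w' assume w': "w' \<in> hom C b (fst (K' Y)) \<and> (\<forall>x \<in> Y. snd (K' Y) x \<cdot> w' = \<rho> x)"
        have "left (S Y) \<cdot> w' = k"
        proof (rule k(3))
          show "left (S Y) \<cdot> w' \<in> hom C b (fst (K ?X))" using Comp_in_hom[of w' b, OF _ tl(2)] w' by blast
          show "\<forall>x \<in> ?X. snd (K ?X) x \<cdot> (left (S Y) \<cdot> w') = \<rho> x"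
            using leg_w[of w'] w' by auto
        qed
        then show "w' = w" using w(4) w' K'_y[OF True] True by auto
      qed
    qed
    ultimately show ?thesis by (simp add: is_limit_cone_def)
  qed
  \<comment> \<open>\<open>K'\<close> is not yet known to be a cell choice, so its restrictions are
    identified directly from the limit property.\<close>
  have res_unique: "restrict_map C K' Y X = h"
    if "sieve ?P le X" "h \<in> hom C (fst (K' Y)) (fst (K' X))" "\<And>x. x \<in> X \<Longrightarrow> snd (K' X) x \<cdot> h = snd (K' Y) x"
    for X Y h
    unfolding restrict_map_def
  proof (rule the_equality)
    fix k assume k: "k \<in> hom C (fst (K' Y)) (fst (K' X)) \<and> (\<forall>x \<in> X. snd (K' X) x \<cdot> k = snd (K' Y) x)"
    show "k = h"
      using P'.limit_cone_poset_eqI[OF _ limit[OF that(1)] _ that(2), of k] k that(1,3)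
      by (simp add: sieve_def)
  qed (use that in blast)
  have res_left: "restrict_map C K' Y (Y - {y}) = left (S Y)" if "sieve ?P le Y" "y \<in> Y" for Y
    using res_unique[of "Y - {y}" "left (S Y)" Y] S_left[OF that] K'_x[OF that(2)] K'_old[of "Y - {y}"]
      sX[OF that] sieve_P by auto
  have res_old: "restrict_map C K' Y X = res Y X" if "y \<notin> X" "y \<notin> Y" for X Y
    using that by (simp add: restrict_map_def K'_old)
  \<comment> \<open>Since \<open>y\<close> is \<open>lin\<close>-greatest, another cell
    \<open>v\<close> can be attached last only to sieves avoiding \<open>y\<close>; such steps are
    inherited from \<open>K\<close>.\<close>
  have new_cell: "y \<notin> X \<and> y \<notin> Y"
    if "sieve ?P le Y" "Y - X = {v}" "\<forall>x \<in> X. (x, v) \<in> lin" "v \<noteq> y" for X Y v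
  proof -
    have v: "v \<in> P" using that unfolding sieve_def by blast
    have "(v, y) \<in> lin" using y_max v by simp
    then have "y \<notin> X" using P'.lin_antisym[of v y] that(3,4) v by auto
    then show ?thesis using that by auto
  qed
  have "cell_choice C ?P le lin F K'"
    unfolding cell_choice_def
  proof (intro conjI allI impI ballI; (elim conjE)?)
    show "is_limit_cone (poset_op X le) C F (fst (K' X)) (snd (K' X))" if "sieve ?P le X" for X
      using limit[OF that] .
    show "fst (K' {}) = one C" using K_empty by (simp add: K'_def)
  next
    fix x assume x: "x \<in> ?P"
    have *: "fst (K' (under le x \<inter> ?P)) = omap F x \<and>
      (\<forall>w \<in> under le x \<inter> ?P. snd (K' (under le x \<inter> ?P)) w = amap F (x, w))"
    proof (cases "x = y")
      case True
      let ?U = "under le y \<inter> ?P"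
      have yU: "y \<in> ?U" using P'.le_refl[of y] by (simp add: under_def)
      have UD: "?U - {y} = ?D" using P'.le_refl by (auto simp: under_def underS_def)
      \<comment> \<open>For the principal sieve of \<open>y\<close> the bottom side restricts the
        boundary to itself and is an identity, so the chosen square can only be the identity square
        of \<open>g\<close>.\<close>
      have "Sq (Ident C (omap F y)) g g (Ident C (fst (K ?D))) \<in> Qsq C"
        using Qsq_Ident[OF gp(1,2)] hom_Dom_Cod[OF g] unfolding gp(3)[symmetric] gp(4)[symmetric]
        by simp
      then have "S ?U = Sq (Ident C (omap F y)) g g (Ident C (fst (K ?D)))"
        using S_eq[OF P'.sieve_under yU] UD res_self[OF sD] by simp
      moreover have "Ident C (omap F y) \<in> hom C (omap F y) (omap F y)" using Ident_in_hom P'.F_Obj by simp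
      ultimately have "fst (K' ?U) = omap F y" "snd (K' ?U) y = amap F (y, y)"
        "\<And>w. w \<in> ?D \<Longrightarrow> snd (K' ?U) w = snd (K ?D) w \<cdot> g"
        using yU UD K'_y[OF yU] K'_x[OF yU] P'.F_Ident[of y] \<open>y \<notin> P\<close>
        by (auto simp: K'_def hom_def)
      then have "fst (K' ?U) = omap F y \<and> (\<forall>w \<in> ?U. snd (K' ?U) w = amap F (y, w))"
        using g_leg UD by (metis Diff_iff empty_iff insert_iff)
      then show ?thesis using True by simp
    next
      case False
      then have xP: "x \<in> P" using x by simp
      have "under le x \<inter> ?P = under le x \<inter> P" using not_le[OF xP] by (auto simp: under_def)
      moreover have "y \<notin> under le x \<inter> P" using \<open>y \<notin> P\<close> by simp
      ultimately show ?thesis using K_under[OF xP] leg_under[OF xP] K'_old by simp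
    qed
    show "fst (K' (under le x \<inter> ?P)) = omap F x" using * by simp
    show "snd (K' (under le x \<inter> ?P)) w = amap F (x, w)" if "w \<in> under le x \<inter> ?P" for w using * that by simp
  next
    fix X Y v
    assume a: "sieve ?P le X" "sieve ?P le Y" "X \<subseteq> Y" "Y - X = {v}" "\<forall>x \<in> X. (x, v) \<in> lin"
    show "display_map1 C (restrict_map C K' Y X)"
    proof (cases "v = y")
      case True
      then have "y \<in> Y" "X = Y - {y}" using a by auto
      then show ?thesis using res_left[OF a(2)] Qsq_display_map1(1)[OF S(1)[OF a(2)]] by simp
    next
      case False
      then have n: "y \<notin> X" "y \<notin> Y" using new_cell a by blast+
      then show ?thesis using res_old[OF n] res_display[of X Y v] sieve_P a by simp
    qed
  next
    fix X X' Y Y' v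
    assume a: "sieve ?P le X" "sieve ?P le X'" "sieve ?P le Y" "sieve ?P le Y'"
      "X \<subseteq> X'" "Y \<subseteq> Y'" "X \<subseteq> Y" "X' \<subseteq> Y'" "Y - X = {v}" "Y' - X' = {v}" "\<forall>x \<in> X'. (x, v) \<in> lin"
    show "distinguished C (Sq (restrict_map C K' Y' Y) (restrict_map C K' Y' X')
      (restrict_map C K' Y X) (restrict_map C K' X' X))"
    proof (cases "v = y")
      case False
      then have n': "y \<notin> X'" "y \<notin> Y'" using new_cell a by blast+
      then have n: "y \<notin> X" "y \<notin> Y" using a by auto
      show ?thesis
        using res_old n n' res_distinguished[of X X' Y Y' v] sieve_P a by simp
    next
      case True
      then have y: "y \<in> Y" "X = Y - {y}" "y \<in> Y'" "X' = Y' - {y}" using a by auto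
      have s: "sieve P le X" "?D \<subseteq> X" "sieve P le X'" "?D \<subseteq> X'"
        using sX[OF a(3) y(1)] sX[OF a(4) y(3)] unfolding y(2,4) by auto
      note SY = S[OF a(3) y(1), folded y(2)] and tl = S_top[OF a(3) y(1)] S_left[OF a(3) y(1), folded y(2)]
        and tl' = S_top[OF a(4) y(3)] S_left[OF a(4) y(3), folded y(4)]
      note r = res_hom[OF s(1,3) a(5)]
      \<comment> \<open>Pull \<open>left (S Y)\<close> back along \<open>res X' X\<close> inside
        \<open>Qsq\<close> and paste with \<open>S Y\<close>: the result has the right side and
        bottom of \<open>S Y'\<close>, hence equals it. The upper edge \<open>t\<close> of the new
        square turns out to be the restriction from \<open>Y'\<close> to \<open>Y\<close>.\<close>
      obtain b where b: "b \<in> Obj C" "len C b \<ge> 1" "left (S Y) = proj C b" using Qsq_left[OF SY(1)] by auto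
      have "Cod C (res X' X) = ft C b" "res X' X \<in> Arr C"
        using r tl(2) b(3) proj_in_hom[OF b(1,2)] by (auto simp: hom_def)
      then obtain T where "T \<in> Qsq C" "right T = left (S Y)" "bottom T = res X' X"
        using Qsq_unique_lift[OF b(1,2), of "res X' X"] b(3) by auto
      then obtain t l where T: "Sq t l (left (S Y)) (res X' X) \<in> Qsq C" by (cases T) auto
      have "S Y = Sq (top (S Y)) (left (S Y)) g (res X ?D)" using SY(2,3) by (cases "S Y") auto
      then have "Sq (top (S Y) \<cdot> t) l g (res X ?D \<cdot> res X' X) \<in> Qsq C"
        using Qsq_horizontal[OF T, of "top (S Y)" g "res X ?D"] SY(1) by simp
      then have "S Y' = Sq (top (S Y) \<cdot> t) l g (res X' ?D)"
        using S_eq[OF a(4) y(3)] res_Comp[OF sD s(1,3,2) a(5)] y(4) by simp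
      then have l: "l = left (S Y')" and t: "top (S Y') = top (S Y) \<cdot> t" by auto
      have tc: "t \<in> hom C (fst (K' Y')) (fst (K' Y))" "left (S Y) \<cdot> t = res X' X \<cdot> l"
        using Qsq_comm[OF T] tl tl' l by (auto simp: comm_square_def hom_def)
      have "restrict_map C K' Y' Y = t"
      proof (rule res_unique[OF a(3) tc(1)])
        fix x assume x: "x \<in> Y"
        show "snd (K' Y) x \<cdot> t = snd (K' Y') x"
        proof (cases "x = y")
          case True
          then show ?thesis using K'_y y t by simp
        next
          case False
          then have x: "x \<in> X" using x y(2) by simp
          have "snd (K' Y) x \<cdot> t = snd (K X) x \<cdot> (left (S Y) \<cdot> t)"
            using K'_x[OF y(1) False] Comp_assoc[OF tc(1) tl(2) leg_hom[OF s(1) x]] y(2) by simp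
          also have "\<dots> = snd (K X') x \<cdot> left (S Y')"
            using tc(2) l Comp_assoc[OF tl'(2) r leg_hom[OF s(1) x]] leg_res[OF s(1,3) a(5) x] by simp
          finally show ?thesis using K'_x[OF y(3) False] y(4) by simp
        qed
      qed
      moreover have "y \<notin> X" "y \<notin> X'" using y by auto
      ultimately show ?thesis
        using Qsq_distinguished[OF T] res_left[OF a(3) y(1)] res_left[OF a(4) y(3)] res_old l y(2,4)
        by simp
    qed
  qed
  then show ?thesis by blast
qed

section \<open>Boundaries in a product of trees\<close>

context precontextual_category begin

lemma the_display_eq: "d \<in> hom C y x \<Longrightarrow> display_map C d \<Longrightarrow> the_display C y x = d"
  unfolding the_display_def using display_map_unique by (fastforce simp: hom_def)

lemma the_display:
  assumes "(x, y) \<in> tree_ord C"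
  shows "the_display C y x \<in> hom C y x" "display_map C (the_display C y x)"
  using theI'[OF tree_ord_display[OF assms]] unfolding the_display_def by auto

lemma the_display_self: "a \<in> Obj C \<Longrightarrow> the_display C a a = Ident C a"
  using the_display_eq Ident_in_hom display_map.Ident by metis

lemma the_display_Comp:
  assumes "d \<in> hom C y x" "display_map C d" "e \<in> hom C z y" "display_map C e"
  shows "the_display C z x = d \<cdot> e"
  using assms Comp_in_hom[OF assms(3,1)] display_map_Comp[of e d]
  by (intro the_display_eq) (auto simp: hom_def)

lemma tree_trans: "(x, y) \<in> tree_ord C \<Longrightarrow> (y, z) \<in> tree_ord C \<Longrightarrow> (x, z) \<in> tree_ord C"
  using partial_order_on_tree_ord by (auto simp: partial_order_on_def preorder_on_def dest: transD)

lemma tree_antisym: "(x, y) \<in> tree_ord C \<Longrightarrow> (y, x) \<in> tree_ord C \<Longrightarrow> x = y"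
  using partial_order_on_tree_ord by (auto simp: partial_order_on_def preorder_on_def dest: antisymD)

lemma tree_refl: "x \<in> tree C \<Longrightarrow> (x, x) \<in> tree_ord C"
  using partial_order_on_tree_ord by (auto simp: partial_order_on_def preorder_on_def refl_on_def)

lemma under_tree_subset: "under (tree_ord C) x \<subseteq> tree C"
  by (auto simp: under_def tree_ord_def)

lemma under_tree_empty: "x \<notin> tree C \<Longrightarrow> under (tree_ord C) x = {}"
  by (auto simp: under_def tree_ord_def)

text \<open>Everything below \<open>x\<close> other than \<open>x\<close> arises by at least one
  step of \<open>ft\<close>, hence lies below \<open>ft C x\<close>. For \<open>x\<close> of length
  1 the parent has length 0 and is not in the tree; its principal sieve is empty and the formula
  persists.\<close>

lemma under_tree_ft:
  assumes "x \<in> tree C"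
  shows "under (tree_ord C) x = insert x (under (tree_ord C) (ft C x))" "x \<notin> under (tree_ord C) (ft C x)"
proof -
  have x: "x \<in> Obj C" "len C x \<ge> 1" using assms by (auto simp: tree_def)
  note l = len_ft[OF x]
  show "x \<notin> under (tree_ord C) (ft C x)"
  proof
    assume "x \<in> under (tree_ord C) (ft C x)"
    then obtain d where "d \<in> hom C (ft C x) x" "display_map C d"
      by (auto simp: under_def tree_ord_def)
    then show False using display_map_hom[of d] x l by (auto simp: hom_def)
  qed
  have p: "proj C x \<in> hom C x (ft C x)" "display_map C (proj C x)"
    using proj_in_hom[OF x] display_map_proj[OF x] by auto
  have "(w, x) \<in> tree_ord C" if w: "(w, ft C x) \<in> tree_ord C" for w
  proof -
    obtain d where "d \<in> hom C (ft C x) w" "display_map C d" "w \<in> tree C" using w by (auto simp: tree_ord_def)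
    then show ?thesis
      using Comp_in_hom[OF p(1)] display_map_Comp[OF p(2), of d] p assms
      by (auto simp: tree_ord_def hom_def intro!: exI[of _ "d \<cdot> proj C x"])
  qed
  moreover have "w = x \<or> (w, ft C x) \<in> tree_ord C" if w: "(w, x) \<in> tree_ord C" for w
  proof -
    obtain n where n: "n < len C x" "w = (ft C ^^ n) x" using w by (auto simp: tree_ord_iff)
    show ?thesis
    proof (cases n)
      case (Suc m)
      then have "w = (ft C ^^ m) (ft C x)" "m < len C (ft C x)" using n l by (auto simp: funpow_swap1)
      then show ?thesis using ft_in_Obj[OF x(1)] by (auto simp: tree_ord_iff tree_def)
    qed (use n in simp)
  qed
  ultimately show "under (tree_ord C) x = insert x (under (tree_ord C) (ft C x))"
    using tree_refl[OF assms] by (auto simp: under_def)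
qed

lemma under_tree_mono:
  assumes "d \<in> hom C y x" "display_map C d" "y \<in> Obj C"
  shows "under (tree_ord C) x \<subseteq> under (tree_ord C) y"
proof (cases "x \<in> tree C")
  case True
  then have "y \<in> tree C" using display_map_hom[OF assms(2)] assms by (auto simp: tree_def hom_def)
  then have "(x, y) \<in> tree_ord C" using True assms by (auto simp: tree_ord_def)
  then show ?thesis using tree_trans by (auto simp: under_def)
qed (simp add: under_tree_empty)

lemma not_tree: "x \<in> Obj C \<Longrightarrow> x \<notin> tree C \<longleftrightarrow> len C x = 0"
  by (auto simp: tree_def)

lemma Field_tree_ord: "Field (tree_ord C) = tree C"
proof -
  have "tree_ord C \<subseteq> tree C \<times> tree C" by (auto simp: tree_ord_def)
  then show ?thesis using tree_refl unfolding Field_def by blast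
qed

end

section \<open>Diagrams on the product of two trees\<close>

lemma under_prod_ord: "under (prod_ord r s) (x, y) = under r x \<times> under s y"
  by (auto simp: under_def prod_ord_def)

text \<open>\<open>H_one\<close> is common to both notions: condition (i) contains it on one side,
  the clause on length 0 of a multimorphism on the other. So boundaries can be studied before either
  notion is assumed.\<close>

locale bifunctor =
  A: contextual_category A + B: contextual_category B + C: contextual_category C
  for A :: "('oa, 'ma, 'za) precontextual_scheme" and B :: "('ob, 'mb, 'zb) precontextual_scheme"
    and C :: "('oc, 'mc, 'zc) precontextual_scheme" +
  fixes H :: "('oa \<times> 'ob, 'ma \<times> 'mb, 'oc, 'mc) functor_data"
  assumes functor_H: "is_functor (prod_category A B) C H"
    and H_one: "a \<in> Obj A \<Longrightarrow> b \<in> Obj B \<Longrightarrow> len A a = 0 \<or> len B b = 0 \<Longrightarrow> omap H (a, b) = one C"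
begin

abbreviation "T \<equiv> tree A \<times> tree B"
abbreviation "le \<equiv> prod_ord (tree_ord A) (tree_ord B)"
abbreviation "lin \<equiv> lex_lin (tree_ord A) (tree_ord B)"
abbreviation "F \<equiv> tree_restrict A B H"
abbreviation "rect u v \<equiv> under (tree_ord A) u \<times> under (tree_ord B) v"

lemma H_Obj: "a \<in> Obj A \<Longrightarrow> b \<in> Obj B \<Longrightarrow> omap H (a, b) \<in> Obj C"
  using functor_H by (simp add: is_functor_def prod_category_def)

lemma H_hom: "f \<in> hom A a a' \<Longrightarrow> g \<in> hom B b b' \<Longrightarrow> amap H (f, g) \<in> hom C (omap H (a, b)) (omap H (a', b'))"
  using functor_H by (auto simp: is_functor_def prod_category_def hom_def)

lemma H_Ident: "a \<in> Obj A \<Longrightarrow> b \<in> Obj B \<Longrightarrow> amap H (Ident A a, Ident B b) = Ident C (omap H (a, b))"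
  using functor_H by (simp add: is_functor_def prod_category_def)

lemma H_Comp: "f \<in> hom A a a' \<Longrightarrow> f' \<in> hom A a' a'' \<Longrightarrow> g \<in> hom B b b' \<Longrightarrow> g' \<in> hom B b' b''
    \<Longrightarrow> amap H (f', g') \<cdot>\<^bsub>C\<^esub> amap H (f, g) = amap H (f' \<cdot>\<^bsub>A\<^esub> f, g' \<cdot>\<^bsub>B\<^esub> g)"
  using functor_H by (auto simp: is_functor_def prod_category_def hom_def)

lemma F_sel: "omap F x = omap H x" "amap F ((y1, y2), (x1, x2)) = amap H (the_display A y1 x1, the_display B y2 x2)"
  by (simp_all add: tree_restrict_def)

lemma functor_tree_restrict: "is_functor (poset_op T le) C F"
  unfolding is_functor_poset_op
proof (intro conjI ballI impI)
  fix x assume x: "x \<in> T"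
  obtain x1 x2 where x12: "x = (x1, x2)" by (cases x)
  have o: "x1 \<in> Obj A" "x2 \<in> Obj B" using x x12 by (auto simp: tree_def)
  show "omap F x \<in> Obj C" using H_Obj o x12 by (simp add: F_sel)
  show "amap F (x, x) = Ident C (omap F x)"
    using H_Ident[OF o] A.the_display_self[OF o(1)] B.the_display_self[OF o(2)] x12 by (simp add: F_sel)
  fix y assume y: "y \<in> T"
  obtain y1 y2 where y12: "y = (y1, y2)" by (cases y)
  show "amap F (y, x) \<in> hom C (omap F y) (omap F x)" if "(x, y) \<in> le"
    using that A.the_display(1) B.the_display(1) H_hom x12 y12 by (auto simp: F_sel prod_ord_def)
  fix z assume z: "z \<in> T" and l: "(x, y) \<in> le \<and> (y, z) \<in> le"
  obtain z1 z2 where z12: "z = (z1, z2)" by (cases z)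
  have l1: "(x1, y1) \<in> tree_ord A" "(y1, z1) \<in> tree_ord A" and l2: "(x2, y2) \<in> tree_ord B" "(y2, z2) \<in> tree_ord B"
    using l x12 y12 z12 by (auto simp: prod_ord_def)
  note d1 = A.the_display[OF l1(1)] A.the_display[OF l1(2)]
    and d2 = B.the_display[OF l2(1)] B.the_display[OF l2(2)]
  show "amap F (z, x) = amap F (y, x) \<cdot>\<^bsub>C\<^esub> amap F (z, y)"
    using H_Comp[OF d1(3,1) d2(3,1)] A.the_display_Comp[OF d1] B.the_display_Comp[OF d2] x12 y12 z12
    by (simp add: F_sel)
qed

lemma poset_diagram_under:
  assumes "z \<in> T" "P \<subseteq> under le z" shows "poset_diagram C P le lin F"
proof -
  obtain z1 z2 where z: "z = (z1, z2)" by (cases z)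
  let ?U = "under le z"
  have U: "?U = rect z1 z2" unfolding z under_prod_ord ..
  have UT: "?U \<subseteq> T" unfolding U using A.under_tree_subset B.under_tree_subset by blast
  have L: "linear_order_on ?U (Restr lin ?U)" "Restr le ?U \<subseteq> lin"
    using local_linearization_lex[OF A.precontextual_category_axioms B.precontextual_category_axioms] assms(1)
    unfolding local_linearization_def by auto
  have lo: "refl_on ?U (Restr lin ?U)" "trans (Restr lin ?U)" "antisym (Restr lin ?U)" "total_on ?U (Restr lin ?U)"
    using L(1) by (auto simp: linear_order_on_def partial_order_on_def preorder_on_def)
  have "linearized_poset ?U le lin"
  proof unfold_locales
    show "finite ?U" unfolding U
      using finite_under_tree[OF A.precontextual_category_axioms]
        finite_under_tree[OF B.precontextual_category_axioms] by (intro finite_cartesian_product)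
    show "trans le" using A.tree_trans B.tree_trans unfolding trans_def prod_ord_def by blast
    show "antisym le" using A.tree_antisym B.tree_antisym unfolding antisym_def prod_ord_def by blast
    fix x y w assume x: "x \<in> ?U"
    show "(x, x) \<in> le" using x UT A.tree_refl B.tree_refl by (auto simp: prod_ord_def)
    assume y: "y \<in> ?U"
    show "(x, y) \<in> lin \<or> (y, x) \<in> lin"
      using refl_onD[OF lo(1) x] lo(4) x y unfolding total_on_def by (cases "x = y") auto
    show "x = y" if "(x, y) \<in> lin" "(y, x) \<in> lin" using x y that antisymD[OF lo(3), of x y] by blast
    show "(x, y) \<in> lin" if "(x, y) \<in> le" using x y that L(2) by blast
    assume w: "w \<in> ?U"
    show "(x, w) \<in> lin" if "(x, y) \<in> lin" "(y, w) \<in> lin"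
      using x y w that transD[OF lo(2), of x y w] by blast
  qed
  then have "linearized_poset P le lin" using linearized_poset.linearized_subset assms(2) by blast
  moreover have "is_functor (poset_op P le) C F"
    using is_functor_poset_op_subset[OF functor_tree_restrict] UT assms(2) by blast
  ultimately show ?thesis
    by (simp add: poset_diagram_def poset_diagram_axioms_def C.contextual_category_axioms)
qed

text \<open>The decomposition follows the lexicographic order: every cell of the first piece
  precedes every cell of the column over \<open>a\<close>.\<close>

lemma boundary_eq:
  assumes "a \<in> tree A" "b \<in> tree B"
  shows "boundary A B (a, b) = rect (ft A a) b \<union> {a} \<times> under (tree_ord B) (ft B b)"
proof -
  have "boundary A B (a, b) = rect a b - {(a, b)}"
    unfolding boundary_def underS_def prod_ord_def under_def by auto
  then show ?thesis using A.under_tree_ft[OF assms(1)] B.under_tree_ft[OF assms(2)] by auto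
qed

lemma under_boundary:
  "a \<in> tree A \<Longrightarrow> b \<in> tree B \<Longrightarrow> rect a b = insert (a, b) (boundary A B (a, b)) \<and> (a, b) \<notin> boundary A B (a, b)"
  using A.tree_refl B.tree_refl unfolding boundary_def under_def underS_def prod_ord_def by auto

end

text \<open>\<open>P\<close> is any sieve rather than a principal one, since gap maps are also
  needed in the middle of building a choice, when the boundary of \<open>(a, b)\<close> is present
  and \<open>(a, b)\<close> is not yet.\<close>

locale bifunctor_cells = bifunctor A B C H +
  cell_diagram C P "prod_ord (tree_ord A) (tree_ord B)" "lex_lin (tree_ord A) (tree_ord B)"
    "tree_restrict A B H" K
  for A :: "('oa, 'ma, 'za) precontextual_scheme" and B :: "('ob, 'mb, 'zb) precontextual_scheme"
    and C :: "('oc, 'mc, 'zc) precontextual_scheme"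
    and H :: "('oa \<times> 'ob, 'ma \<times> 'mb, 'oc, 'mc) functor_data"
    and P :: "('oa \<times> 'ob) set" and K +
  assumes sieve_P: "sieve T le P"
begin

lemma sieve_iff: "sieve P le X \<longleftrightarrow> sieve T le X \<and> X \<subseteq> P"
  using sieve_P unfolding sieve_def by blast

lemma sieve_rect: "rect u v \<subseteq> P \<Longrightarrow> sieve P le (rect u v)"
  unfolding sieve_iff unfolding sieve_def
  using A.under_tree_subset B.under_tree_subset A.tree_trans B.tree_trans
  by (auto simp: under_def prod_ord_def) blast+

lemma rect_in_P:
  assumes "(u, v) \<in> T" "rect u v \<subseteq> P"
  shows "(u, v) \<in> P" "under le (u, v) \<inter> P = rect u v"
  using assms A.tree_refl B.tree_refl unfolding under_prod_ord by (auto simp: under_def)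

text \<open>If a component has length 0, the rectangle is empty and its apex is the terminal object,
  which is also the value of \<open>H\<close>. This lets parents of length-1 objects be treated like
  any others.\<close>

lemma apex_rect:
  assumes "u \<in> Obj A" "v \<in> Obj B" "rect u v \<subseteq> P"
  shows "fst (K (rect u v)) = omap H (u, v)"
proof (cases "(u, v) \<in> T")
  case True
  then show ?thesis using K_under[OF rect_in_P(1)[OF True assms(3)]] rect_in_P(2)[OF True assms(3)]
    by (simp add: F_sel)
next
  case False
  then have "rect u v = {}" using A.under_tree_empty B.under_tree_empty by auto
  moreover have "omap H (u, v) = one C"
    using False H_one[OF assms(1,2)] A.not_tree[OF assms(1)] B.not_tree[OF assms(2)] by auto
  ultimately show ?thesis using K_empty by metis
qed

text \<open>Written with the case distinction of \<open>boundary_proj\<close>, for the later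
  comparison of boundary squares with corners.\<close>

lemma res_rect:
  assumes "sieve P le X" "u \<in> Obj A" "v \<in> Obj B" "rect u v \<subseteq> X"
  shows "res X (rect u v) = (if (u, v) \<in> T then snd (K X) (u, v) else to_one C (fst (K X)))"
proof (cases "(u, v) \<in> T")
  case True
  then have m: "(u, v) \<in> X" using assms(4) A.tree_refl B.tree_refl by (auto simp: under_def)
  have "rect u v \<subseteq> P" using assms(1,4) by (auto simp: sieve_def)
  then show ?thesis using res_under_leg(2)[OF assms(1) m] rect_in_P(2)[OF True] True by simp
next
  case False
  then have e: "rect u v = {}" using A.under_tree_empty B.under_tree_empty by auto
  have "res X {} \<in> hom C (fst (K X)) (one C)" using res_hom[of "{}" X] assms(1) K_empty by (simp add: sieve_def)
  then show ?thesis unfolding e using False C.to_one_eq C.to_one_hom[OF K_Obj[OF assms(1)]] by auto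
qed

lemma res_rect_rect:
  assumes "f \<in> hom A u u'" "display_map A f" "g \<in> hom B v v'" "display_map B g" "rect u v \<subseteq> P"
  shows "res (rect u v) (rect u' v') = amap H (f, g)" "rect u' v' \<subseteq> rect u v"
proof -
  have o: "u \<in> Obj A" "u' \<in> Obj A" "v \<in> Obj B" "v' \<in> Obj B"
    using assms A.Dom_in_Obj A.Cod_in_Obj B.Dom_in_Obj B.Cod_in_Obj by (auto simp: hom_def)
  show sub: "rect u' v' \<subseteq> rect u v"
    using A.under_tree_mono[OF assms(1,2) o(1)] B.under_tree_mono[OF assms(3,4) o(3)] by blast
  note s = sieve_rect[OF assms(5)]
  show "res (rect u v) (rect u' v') = amap H (f, g)"
  proof (cases "(u', v') \<in> T")
    case True
    have "len A u' \<le> len A u" "len B v' \<le> len B v"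
      using A.display_map_hom[OF assms(2)] B.display_map_hom[OF assms(4)] assms(1,3) by (auto simp: hom_def)
    then have uv: "(u, v) \<in> T" using True o by (auto simp: tree_def)
    have m: "(u', v') \<in> rect u v" using sub True A.tree_refl B.tree_refl by (auto simp: under_def)
    show ?thesis
      using res_rect[OF s o(2,4) sub] True leg_under[OF rect_in_P(1)[OF uv assms(5)], of "(u', v')"] m
        rect_in_P(2)[OF uv assms(5)] A.the_display_eq[OF assms(1,2)] B.the_display_eq[OF assms(3,4)]
      by (simp add: F_sel)
  next
    case False
    then have 1: "omap H (u', v') = one C"
      using H_one[OF o(2,4)] A.not_tree[OF o(2)] B.not_tree[OF o(4)] by auto
    have "res (rect u v) (rect u' v') \<in> hom C (omap H (u, v)) (one C)"
      using res_hom[OF sieve_rect s sub] sub assms(5) apex_rect o 1 by force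
    then show ?thesis using C.to_one_eq[OF _ H_hom[OF assms(1,3), unfolded 1]] by blast
  qed
qed


text \<open>The rectangles below \<open>(ft A a, ft B b)\<close> and \<open>(ft A a, b)\<close> are
  extended by the same column over \<open>a\<close>. Each cell of the column is attached to both in
  parallel, which gives one layer of the stack.\<close>

lemma corner_distinguished:
  assumes a: "a \<in> tree A" and b: "b \<in> tree B" and D: "boundary A B (a, b) \<subseteq> P"
  shows "distinguished C
    (Sq (res (boundary A B (a, b)) (rect a (ft B b))) (res (boundary A B (a, b)) (rect (ft A a) b))
      (amap H (proj A a, Ident B (ft B b))) (amap H (Ident A (ft A a), proj B b)))"
proof -
  have ab: "a \<in> Obj A" "len A a \<ge> 1" "b \<in> Obj B" "len B b \<ge> 1" using a b by (auto simp: tree_def)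
  have ftab: "ft A a \<in> Obj A" "ft B b \<in> Obj B" using ab A.ft_in_Obj B.ft_in_Obj by auto
  note ua = A.under_tree_ft[OF a] and ub = B.under_tree_ft[OF b]
  define R where "R = rect (ft A a) (ft B b)"
  define R' where "R' = rect (ft A a) b"
  \<comment> \<open>The smaller and the larger rectangle with the column over \<open>a\<close>
    filled up to \<open>v\<close>: at \<open>v = ft B b\<close> they are
    \<open>rect a (ft B b)\<close> and the boundary, at length 0 the bare rectangles.\<close>
  define X where "X v = R \<union> {a} \<times> under (tree_ord B) v" for v
  define X' where "X' v = R' \<union> {a} \<times> under (tree_ord B) v" for v
  have D_eq: "boundary A B (a, b) = X' (ft B b)" using boundary_eq[OF a b] by (simp add: X'_def R'_def)
  have RR: "R \<subseteq> R'" unfolding R_def R'_def ub(1) by blast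
  have sub: "rect a (ft B b) \<subseteq> P" "R' \<subseteq> P" using D RR unfolding D_eq X'_def R_def ua(1) by blast+
  have sR: "sieve P le R'" "sieve P le R" using sieve_rect sub(2) RR unfolding R'_def R_def by blast+
  have Xs: "sieve P le (X v)" "sieve P le (X' v)" "X v \<subseteq> X' v" "R \<subseteq> X v" "R' \<subseteq> X' v"
    if v: "under (tree_ord B) v \<subseteq> under (tree_ord B) (ft B b)" for v
  proof -
    show "X v \<subseteq> X' v" "R \<subseteq> X v" "R' \<subseteq> X' v" unfolding X_def X'_def using RR by blast+
    have P: "X v \<subseteq> P" "X' v \<subseteq> P" using D v RR unfolding D_eq X_def X'_def by blast+
    have down: "y \<in> R \<union> {a} \<times> under (tree_ord B) v" "y \<in> R' \<union> {a} \<times> under (tree_ord B) v"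
      if y: "(y, (a, x)) \<in> le" "x \<in> under (tree_ord B) v" for x y
    proof -
      obtain y1 y2 where y12: "y = (y1, y2)" by (cases y)
      have "y1 \<in> under (tree_ord A) a" "y2 \<in> under (tree_ord B) v"
        using y y12 B.tree_trans by (auto simp: prod_ord_def under_def)
      then show "y \<in> R \<union> {a} \<times> under (tree_ord B) v" "y \<in> R' \<union> {a} \<times> under (tree_ord B) v"
        using v unfolding ua(1) R_def R'_def ub(1) y12 by blast+
    qed
    have *: "sieve P le (Q \<union> {a} \<times> under (tree_ord B) v)"
      if "sieve P le Q" "Q \<union> {a} \<times> under (tree_ord B) v \<subseteq> P"
        "\<And>x y. (y, (a, x)) \<in> le \<Longrightarrow> x \<in> under (tree_ord B) v \<Longrightarrow> y \<in> Q \<union> {a} \<times> under (tree_ord B) v" for Q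
      unfolding sieve_def
    proof (intro conjI ballI impI)
      fix x y assume xy: "x \<in> Q \<union> {a} \<times> under (tree_ord B) v" "y \<in> P" "(y, x) \<in> le"
      show "y \<in> Q \<union> {a} \<times> under (tree_ord B) v"
      proof (cases "x \<in> Q")
        case True
        then show ?thesis using that(1) xy(2,3) unfolding sieve_def by blast
      next
        case False
        then obtain x2 where "x = (a, x2)" "x2 \<in> under (tree_ord B) v" using xy(1) by blast
        then show ?thesis using that(3) xy(3) by simp
      qed
    qed (rule that(2))
    show "sieve P le (X v)" "sieve P le (X' v)"
      using *[OF sR(2) _ down(1)] *[OF sR(1) _ down(2)] P unfolding X_def X'_def by simp_all
  qed
  \<comment> \<open>Induction on the length of \<open>v\<close>; the empty column yields a square
    with identity vertical sides, which is an empty stack.\<close>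
  have claim: "distinguished C (Sq (res (X' v) (X v)) (res (X' v) R') (res (X v) R) (res R' R))"
    if "v \<in> Obj B" "under (tree_ord B) v \<subseteq> under (tree_ord B) (ft B b)" for v
    using that
  proof (induction "len B v" arbitrary: v rule: less_induct)
    case less
    show ?case
    proof (cases "v \<in> tree B")
      case False
      then have "X v = R" "X' v = R'" using B.under_tree_empty by (simp_all add: X_def X'_def)
      then show ?thesis
        using distinguished.empty[of "res R' R" C] res_hom[OF sR(2,1) RR] res_self sR
        by (simp add: hom_def)
    next
      case True
      let ?v = "ft B v"
      note uv = B.under_tree_ft[OF True]
      have v: "len B ?v < len B v" "?v \<in> Obj B" "under (tree_ord B) ?v \<subseteq> under (tree_ord B) (ft B b)"
        using B.len_ft[of v] B.ft_in_Obj True less.prems uv by (auto simp: tree_def)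
      note s = Xs[OF less.prems(2)] and s' = Xs[OF v(3)]
      have XX: "X ?v \<subseteq> X v" "X' ?v \<subseteq> X' v" "X v - X ?v = {(a, v)}" "X' v - X' ?v = {(a, v)}"
        using uv ua(2) unfolding X_def X'_def R_def R'_def by blast+
      have vb: "(v, b) \<in> tree_ord B" using less.prems(2) uv(1) ub(1) by (auto simp: under_def)
      \<comment> \<open>Here the lexicographic order enters: a smaller first coordinate wins as soon
        as the second coordinates are comparable, and \<open>x2\<close> and \<open>v\<close> are,
        both being below \<open>b\<close>.\<close>
      have lin: "\<forall>x \<in> X' ?v. (x, (a, v)) \<in> lin"
      proof
        fix x assume x: "x \<in> X' ?v"
        obtain x1 x2 where x12: "x = (x1, x2)" by (cases x)
        from x consider "x1 \<in> under (tree_ord A) (ft A a)" "x2 \<in> under (tree_ord B) b"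
          | "x1 = a" "x2 \<in> under (tree_ord B) ?v"
          unfolding X'_def R'_def x12 by blast
        then show "(x, (a, v)) \<in> lin"
        proof cases
          case 1
          then have "x1 \<in> tree A" "x2 \<in> tree B" using A.under_tree_subset B.under_tree_subset by blast+
          moreover have "(x2, v) \<in> tree_ord B \<or> (v, x2) \<in> tree_ord B"
            using B.tree_ord_down_total[OF _ vb, of x2] 1(2) by (simp add: under_def)
          moreover have "x1 \<in> under (tree_ord A) a" "x1 \<noteq> a" using 1(1) ua by auto
          then have "(x1, a) \<in> tree_ord A" "x1 \<noteq> a" by (simp_all add: under_def)
          ultimately show ?thesis using a True
            unfolding lex_lin_def x12 A.Field_tree_ord B.Field_tree_ord by simp
        next
          case 2
          then have "(x2, v) \<in> tree_ord B" "x2 \<noteq> v" "x2 \<in> tree B"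
            using uv B.under_tree_subset by (auto simp: under_def)
          then show ?thesis using a True 2(1)
            unfolding lex_lin_def x12 A.Field_tree_ord B.Field_tree_ord by simp
        qed
      qed
      have "distinguished C (Sq (res (X' v) (X v)) (res (X' v) (X' ?v)) (res (X v) (X ?v)) (res (X' ?v) (X ?v)))"
        using res_distinguished[OF s'(1,2) s(1,2) s'(3) s(3) XX lin] .
      moreover have "display_map1 C (res (X v) (X ?v))"
        using res_display[OF s'(1) s(1) XX(1,3)] lin s'(3) by blast
      ultimately have "Sq (res (X' v) (X v)) (res (X' v) (X' ?v)) (res (X v) (X ?v)) (res (X' ?v) (X ?v)) \<in> Qsq C"
        using C.distinguished_Qsq by simp
      from distinguished.stack[OF this less.hyps[OF v]]
      show ?thesis
        using res_Comp[OF sR(1) s'(2) s(2) s'(5) XX(2)] res_Comp[OF sR(2) s'(1) s(1) s'(4) XX(1)] by simp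
    qed
  qed
  have "X (ft B b) = rect a (ft B b)" unfolding X_def R_def ua(1) by blast
  moreover have "res (rect a (ft B b)) R = amap H (proj A a, Ident B (ft B b))"
    unfolding R_def
    using res_rect_rect(1)[OF A.proj_in_hom A.display_map_proj B.Ident_in_hom display_map.Ident sub(1)] ab ftab
    by simp
  moreover have "res R' R = amap H (Ident A (ft A a), proj B b)"
    using res_rect_rect(1)[OF A.Ident_in_hom display_map.Ident B.proj_in_hom B.display_map_proj] sub(2) ab ftab
    unfolding R_def R'_def by simp
  ultimately show ?thesis using claim[OF ftab(2) subset_refl] unfolding D_eq R'_def by simp
qed

end

section \<open>Gap maps of a cellular bifunctor\<close>

context category begin

lemma pullback_map_eqI:
  assumes "is_pullback C S'" "w \<in> hom C (Dom C (top S)) (Dom C (top S'))"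
    "top S' \<cdot> w = u \<cdot> top S" "left S' \<cdot> w = v \<cdot> left S"
  shows "pullback_map C S S' u v = w"
  unfolding pullback_map_def
proof (rule the_equality)
  show "w \<in> hom C (Dom C (top S)) (Dom C (top S')) \<and> top S' \<cdot> w = u \<cdot> top S \<and> left S' \<cdot> w = v \<cdot> left S"
    using assms by blast
  fix w' assume w': "w' \<in> hom C (Dom C (top S)) (Dom C (top S')) \<and> top S' \<cdot> w' = u \<cdot> top S \<and> left S' \<cdot> w' = v \<cdot> left S"
  have c: "comm_square C S'" using assms(1) by (simp add: is_pullback_def)
  then have t: "top S' \<in> hom C (Dom C (top S')) (Dom C (right S'))"
    and l: "left S' \<in> hom C (Dom C (top S')) (Dom C (bottom S'))"
    and r: "right S' \<in> hom C (Dom C (right S')) (Cod C (right S'))"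
    and b: "bottom S' \<in> hom C (Dom C (bottom S')) (Cod C (right S'))"
    and e: "right S' \<cdot> top S' = bottom S' \<cdot> left S'"
    by (auto simp: comm_square_def hom_def)
  have "right S' \<cdot> (top S' \<cdot> w) = bottom S' \<cdot> (left S' \<cdot> w)"
    using Comp_assoc[OF assms(2) t r] Comp_assoc[OF assms(2) l b] e by simp
  then have "\<exists>!z. z \<in> hom C (Dom C (top S)) (Dom C (top S')) \<and> top S' \<cdot> z = top S' \<cdot> w \<and> left S' \<cdot> z = left S' \<cdot> w"
    using is_pullback_lift[OF assms(1) Comp_in_hom[OF assms(2) t] Comp_in_hom[OF assms(2) l]] by simp
  then show "w' = w" using w' assms(2-4) by metis
qed

text \<open>The map \<open>k\<close> of lower right corners does not occur in
  \<open>pullback_map\<close>; it witnesses that the outer square commutes, so that the description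
  has a solution.\<close>

lemma pullback_map:
  assumes S': "is_pullback C S'" and S: "comm_square C S"
    and u: "u \<in> hom C (Dom C (right S)) (Dom C (right S'))"
    and v: "v \<in> hom C (Dom C (bottom S)) (Dom C (bottom S'))"
    and k: "k \<in> hom C (Cod C (right S)) (Cod C (right S'))"
    and e: "right S' \<cdot> u = k \<cdot> right S" "bottom S' \<cdot> v = k \<cdot> bottom S"
  shows "pullback_map C S S' u v \<in> hom C (Dom C (top S)) (Dom C (top S'))"
    "top S' \<cdot> pullback_map C S S' u v = u \<cdot> top S"
    "left S' \<cdot> pullback_map C S S' u v = v \<cdot> left S"
proof -
  have s: "top S \<in> hom C (Dom C (top S)) (Dom C (right S))"
    "left S \<in> hom C (Dom C (top S)) (Dom C (bottom S))"
    "right S \<in> hom C (Dom C (right S)) (Cod C (right S))"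
    "bottom S \<in> hom C (Dom C (bottom S)) (Cod C (right S))"
    "right S \<cdot> top S = bottom S \<cdot> left S"
    using S by (auto simp: comm_square_def hom_def)
  have s': "right S' \<in> hom C (Dom C (right S')) (Cod C (right S'))"
    "bottom S' \<in> hom C (Dom C (bottom S')) (Cod C (right S'))"
    using S' by (auto simp: is_pullback_def comm_square_def hom_def)
  have "right S' \<cdot> (u \<cdot> top S) = bottom S' \<cdot> (v \<cdot> left S)"
    using Comp_assoc[OF s(1) u s'(1)] Comp_assoc[OF s(2) v s'(2)] e
      Comp_assoc[OF s(1,3) k] Comp_assoc[OF s(2,4) k] s(5) by simp
  from is_pullback_lift[OF S' Comp_in_hom[OF s(1) u] Comp_in_hom[OF s(2) v] this]
  have "\<exists>!w. w \<in> hom C (Dom C (top S)) (Dom C (top S')) \<and> top S' \<cdot> w = u \<cdot> top S \<and> left S' \<cdot> w = v \<cdot> left S" .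
  from theI'[OF this]
  show "pullback_map C S S' u v \<in> hom C (Dom C (top S)) (Dom C (top S'))"
    "top S' \<cdot> pullback_map C S S' u v = u \<cdot> top S"
    "left S' \<cdot> pullback_map C S S' u v = v \<cdot> left S"
    unfolding pullback_map_def by auto
qed

end

lemma (in precontextual_category) Qsq_tree:
  assumes "S \<in> Qsq C"
  shows "Dom C (top S) \<in> tree C" "Cod C (top S) \<in> tree C"
    "top S \<in> hom C (Dom C (top S)) (Cod C (top S))"
    "bottom S \<in> hom C (ft C (Dom C (top S))) (ft C (Cod C (top S)))"
    "proj C (Cod C (top S)) \<cdot> top S = bottom S \<cdot> proj C (Dom C (top S))"
proof -
  obtain a where a: "a \<in> Obj C" "len C a \<ge> 1" "left S = proj C a" using Qsq_left[OF assms] by blast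
  obtain b where b: "b \<in> Obj C" "len C b \<ge> 1" "right S = proj C b" using Qsq_right[OF assms] by blast
  have d: "Dom C (top S) = a" "Cod C (top S) = b"
    using Qsq_comm[OF assms] proj_in_hom[OF a(1,2)] proj_in_hom[OF b(1,2)] a(3) b(3)
    by (auto simp: comm_square_def hom_def)
  show "Dom C (top S) \<in> tree C" "Cod C (top S) \<in> tree C"
    "top S \<in> hom C (Dom C (top S)) (Cod C (top S))"
    "bottom S \<in> hom C (ft C (Dom C (top S))) (ft C (Cod C (top S)))"
    "proj C (Cod C (top S)) \<cdot> top S = bottom S \<cdot> proj C (Dom C (top S))"
    using Qsq_comm[OF assms] proj_in_hom[OF a(1,2)] proj_in_hom[OF b(1,2)] a b unfolding d
    by (auto simp: comm_square_def hom_def tree_def)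
qed

lemma (in precontextual_category) tree_homs:
  assumes "a \<in> tree C"
  shows "a \<in> Obj C" "ft C a \<in> Obj C" "proj C a \<in> hom C a (ft C a)" "Ident C a \<in> hom C a a"
    "Ident C (ft C a) \<in> hom C (ft C a) (ft C a)" "display_map C (proj C a)" "len C a \<ge> 1"
  using assms ft_in_Obj[of a] proj_in_hom[of a] Ident_in_hom display_map_proj[of a] by (auto simp: tree_def)

context bifunctor begin

lemma bi_square_comm:
  assumes "a \<in> tree A" "b \<in> tree B" shows "comm_square C (bi_square A B H a b)"
proof -
  note a = A.tree_homs[OF assms(1)] and b = B.tree_homs[OF assms(2)]
  have "amap H (proj A a, Ident B (ft B b)) \<cdot>\<^bsub>C\<^esub> amap H (Ident A a, proj B b) =
      amap H (Ident A (ft A a), proj B b) \<cdot>\<^bsub>C\<^esub> amap H (proj A a, Ident B b)"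
    using H_Comp[OF a(4,3) b(3,5)] H_Comp[OF a(3,5) b(4,3)] A.Comp_Ident_left[OF a(3)]
      A.Comp_Ident_right[OF a(3)] B.Comp_Ident_left[OF b(3)] B.Comp_Ident_right[OF b(3)] by simp
  then show ?thesis
    unfolding bi_square_def C.comm_square_iff
    using H_hom[OF a(4) b(3)] H_hom[OF a(3) b(4)] H_hom[OF a(3) b(5)] H_hom[OF a(5) b(3)] by blast
qed

lemma bifunctor_cellsI:
  assumes "z \<in> T" "P \<subseteq> under le z" "sieve T le P" "cell_choice C P le lin F K"
  shows "bifunctor_cells A B C H P K"
  using poset_diagram_under[OF assms(1,2)] assms(3,4) bifunctor_axioms
  by (simp add: bifunctor_cells_def bifunctor_cells_axioms_def cell_diagram_def cell_diagram_axioms_def)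

lemma sieve_under_T: "sieve T le (under le z)"
proof (cases z)
  case (Pair u v)
  show ?thesis
    unfolding Pair under_prod_ord sieve_def
    using A.under_tree_subset B.under_tree_subset A.tree_trans B.tree_trans
    by (auto simp: under_def prod_ord_def)
qed

end

section \<open>The gap map as a map into the limit over the boundary\<close>

context bifunctor_cells begin

context
  fixes a b
  assumes a: "a \<in> tree A" and b: "b \<in> tree B" and D: "boundary A B (a, b) \<subseteq> P"
begin

abbreviation "bd \<equiv> boundary A B (a, b)"

lemma boundary_underS: "underS le (a, b) \<inter> P = bd"
  using D by (auto simp: boundary_def)

lemma sieve_boundary: "sieve P le bd"
  using sieve_underS[of "(a, b)"] unfolding boundary_underS .

lemma bd_rect: "rect a (ft B b) \<subseteq> bd" "rect (ft A a) b \<subseteq> bd" "bd = rect a (ft B b) \<union> rect (ft A a) b"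
  using boundary_eq[OF a b] A.under_tree_ft[OF a] B.under_tree_ft[OF b] by blast+

lemma bi_corner_eq:
  "bi_corner A B C H a b = Sq (res bd (rect a (ft B b))) (res bd (rect (ft A a) b))
    (amap H (proj A a, Ident B (ft B b))) (amap H (Ident A (ft A a), proj B b))"
  using C.dist_pullback_eq[OF corner_distinguished[OF a b D]] by (simp add: bi_corner_def bi_square_def)

lemma corner_hom:
  "res bd (rect a (ft B b)) \<in> hom C (fst (K bd)) (omap H (a, ft B b))"
  "res bd (rect (ft A a) b) \<in> hom C (fst (K bd)) (omap H (ft A a, b))"
proof -
  note a = A.tree_homs[OF a] and b = B.tree_homs[OF b]
  have P: "rect a (ft B b) \<subseteq> P" "rect (ft A a) b \<subseteq> P" using bd_rect D by auto
  show "res bd (rect a (ft B b)) \<in> hom C (fst (K bd)) (omap H (a, ft B b))"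
    "res bd (rect (ft A a) b) \<in> hom C (fst (K bd)) (omap H (ft A a, b))"
    using res_hom[OF sieve_rect[OF P(1)] sieve_boundary bd_rect(1)] apex_rect[OF a(1) b(2) P(1)]
      res_hom[OF sieve_rect[OF P(2)] sieve_boundary bd_rect(2)] apex_rect[OF a(2) b(1) P(2)] by simp_all
qed

lemma bi_gap_ex1:
  "\<exists>!u. u \<in> hom C (omap H (a, b)) (fst (K bd)) \<and>
    res bd (rect a (ft B b)) \<cdot>\<^bsub>C\<^esub> u = amap H (Ident A a, proj B b) \<and>
    res bd (rect (ft A a) b) \<cdot>\<^bsub>C\<^esub> u = amap H (proj A a, Ident B b)"
  and bi_gap_The: "bi_gap A B C H a b = (THE u. u \<in> hom C (omap H (a, b)) (fst (K bd)) \<and>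
    res bd (rect a (ft B b)) \<cdot>\<^bsub>C\<^esub> u = amap H (Ident A a, proj B b) \<and>
    res bd (rect (ft A a) b) \<cdot>\<^bsub>C\<^esub> u = amap H (proj A a, Ident B b))"
proof -
  note 1 = corner_distinguished[OF a b D] _ _ bi_square_comm[OF a b]
  have d: "Dom C (top (bi_square A B H a b)) = omap H (a, b)" "Dom C (res bd (rect a (ft B b))) = fst (K bd)"
    using H_hom[OF A.tree_homs(4)[OF a] B.tree_homs(3)[OF b]] corner_hom(1) by (simp_all add: bi_square_def hom_def)
  show "\<exists>!u. u \<in> hom C (omap H (a, b)) (fst (K bd)) \<and>
    res bd (rect a (ft B b)) \<cdot>\<^bsub>C\<^esub> u = amap H (Ident A a, proj B b) \<and>
    res bd (rect (ft A a) b) \<cdot>\<^bsub>C\<^esub> u = amap H (proj A a, Ident B b)"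
    using C.gap_unique[OF 1] d by (simp add: bi_square_def)
  show "bi_gap A B C H a b = (THE u. u \<in> hom C (omap H (a, b)) (fst (K bd)) \<and>
    res bd (rect a (ft B b)) \<cdot>\<^bsub>C\<^esub> u = amap H (Ident A a, proj B b) \<and>
    res bd (rect (ft A a) b) \<cdot>\<^bsub>C\<^esub> u = amap H (proj A a, Ident B b))"
    using C.gap_eq[OF 1] d by (simp add: bi_square_def bi_gap_def)
qed

lemma bi_gap_hom: "bi_gap A B C H a b \<in> hom C (omap H (a, b)) (fst (K bd))"
  and bi_gap_top: "res bd (rect a (ft B b)) \<cdot>\<^bsub>C\<^esub> bi_gap A B C H a b = amap H (Ident A a, proj B b)"
  and bi_gap_left: "res bd (rect (ft A a) b) \<cdot>\<^bsub>C\<^esub> bi_gap A B C H a b = amap H (proj A a, Ident B b)"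
  using theI'[OF bi_gap_ex1] unfolding bi_gap_The by blast+

text \<open>An index in the boundary lies in one of its two rectangles, and its leg factors through
  the restriction there, whose composite with the gap map is H(id, p_b) or H(p_a, id). This is the
  condition imposed on \<open>g\<close> in \<open>cell_choice_insert\<close>.\<close>

lemma bi_gap_leg:
  assumes "x \<in> bd" shows "snd (K bd) x \<cdot>\<^bsub>C\<^esub> bi_gap A B C H a b = amap F ((a, b), x)"
proof -
  obtain x1 x2 where x12: "x = (x1, x2)" by (cases x)
  note ah = A.tree_homs[OF a] and bh = B.tree_homs[OF b]
  have *: "snd (K bd) x \<cdot>\<^bsub>C\<^esub> bi_gap A B C H a b = amap F ((a, b), x)"
    if uv: "rect u v \<subseteq> bd" "x \<in> rect u v" "u \<in> Obj A" "v \<in> Obj B"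
      and f: "f \<in> hom A a u" "display_map A f" and g: "g \<in> hom B b v" "display_map B g"
      and e: "res bd (rect u v) \<cdot>\<^bsub>C\<^esub> bi_gap A B C H a b = amap H (f, g)" for u v f g
  proof -
    have P: "rect u v \<subseteq> P" using uv(1) D by blast
    note s = sieve_rect[OF P]
    have o: "(x1, u) \<in> tree_ord A" "(x2, v) \<in> tree_ord B" using uv(2) x12 by (auto simp: under_def)
    have T: "(u, v) \<in> T" using o by (auto simp: tree_ord_def)
    note d1 = A.the_display[OF o(1)] and d2 = B.the_display[OF o(2)]
    have "snd (K bd) x \<cdot>\<^bsub>C\<^esub> bi_gap A B C H a b = snd (K (rect u v)) x \<cdot>\<^bsub>C\<^esub> amap H (f, g)"
      using leg_res[OF s sieve_boundary uv(1,2)] e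
        C.Comp_assoc[OF bi_gap_hom res_hom[OF s sieve_boundary uv(1)] leg_hom[OF s uv(2)]] by simp
    also have "snd (K (rect u v)) x = amap H (the_display A u x1, the_display B v x2)"
      using leg_under[OF rect_in_P(1)[OF T P], of x] rect_in_P(2)[OF T P] uv(2) x12 by (simp add: F_sel)
    also have "\<dots> \<cdot>\<^bsub>C\<^esub> amap H (f, g) = amap H (the_display A a x1, the_display B b x2)"
      using H_Comp[OF f(1) d1(1) g(1) d2(1)] A.the_display_Comp[OF d1 f] B.the_display_Comp[OF d2 g] by simp
    finally show ?thesis by (simp add: F_sel x12)
  qed
  from assms consider "x \<in> rect a (ft B b)" | "x \<in> rect (ft A a) b" unfolding bd_rect(3) by blast
  then show ?thesis
  proof cases
    case 1
    then show ?thesis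
      using *[OF bd_rect(1) _ ah(1) bh(2) ah(4) display_map.Ident[OF ah(1)] bh(3,6) bi_gap_top] by blast
  next
    case 2
    then show ?thesis
      using *[OF bd_rect(2) _ ah(2) bh(1) ah(3,6) bh(4) display_map.Ident[OF bh(1)] bi_gap_left] by blast
  qed
qed

text \<open>Once \<open>(a, b)\<close> itself is in \<open>P\<close>, the limit over its rectangle
  is H(a, b), and by \<open>bi_gap_leg\<close> the gap map has the composites with the legs that
  determine the restriction.\<close>

lemma bi_gap_res:
  assumes "(a, b) \<in> P" shows "res (rect a b) bd = bi_gap A B C H a b"
proof (rule res_eqI)
  have "rect a b \<subseteq> P" using under_boundary[OF a b] assms D by auto
  note P = this rect_in_P[OF _ this]
  have T: "(a, b) \<in> T" using a b by simp
  show "sieve P le (rect a b)" "sieve P le bd" "bd \<subseteq> rect a b"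
    using sieve_rect[OF P(1)] sieve_boundary under_boundary[OF a b] by auto
  show "bi_gap A B C H a b \<in> hom C (fst (K (rect a b))) (fst (K bd))"
    using bi_gap_hom apex_rect[OF _ _ P(1)] a b by (simp add: tree_def)
  show "snd (K bd) x \<cdot>\<^bsub>C\<^esub> bi_gap A B C H a b = snd (K (rect a b)) x" if "x \<in> bd" for x
    using bi_gap_leg[OF that] leg_under[OF P(2)[OF T], of x] P(3)[OF T] that under_boundary[OF a b] by auto
qed

end

end

section \<open>From gap maps to cell choices\<close>

context bifunctor begin

text \<open>The induction runs over all sieves below \<open>z\<close>, since a principal sieve
  without its greatest element need not be principal. The hypothesis on gap maps is what condition
  (ii) supplies.\<close>

lemma finite_cellular_sieve:
  assumes gap: "\<And>a b. a \<in> tree A \<Longrightarrow> b \<in> tree B \<Longrightarrow> display_map1 C (bi_gap A B C H a b)"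
    and z: "z \<in> T" and "sieve T le P" "P \<subseteq> under le z"
  shows "\<exists>K. cell_choice C P le lin F K"
  using assms(3,4)
proof (induction "card P" arbitrary: P rule: less_induct)
  case less
  interpret P: linearized_poset P le lin
    using poset_diagram_under[OF z less.prems(2)] by (simp add: poset_diagram_def)
  show ?case
  proof (cases "P = {}")
    case True
    \<comment> \<open>A limit of the empty diagram is a terminal object; any family of legs will do,
      hence \<open>undefined\<close> below.\<close>
    have "is_limit_cone (poset_op {} le) C F (one C) \<pi>" for \<pi>
      using C.one_in_Obj C.one_terminal by (auto simp: is_limit_cone_def is_cone_def)
    then have "cell_choice C {} le lin F (\<lambda>_. (one C, \<lambda>_. undefined))"
      by (auto simp: cell_choice_def sieve_def)
    then show ?thesis using True by blast
  next
    case False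
    obtain y where y: "y \<in> P" "\<forall>x \<in> P. (x, y) \<in> lin" using P.ex_lin_max[OF subset_refl False] by blast
    let ?Q = "P - {y}"
    have "sieve P le ?Q" using P.sieve_remove_max[OF _ y] by (simp add: sieve_def)
    then have Q: "sieve T le ?Q" using less.prems(1) unfolding sieve_def by blast
    have "card ?Q < card P" using card_Diff1_less[OF P.finite_P y(1)] .
    then obtain K where K: "cell_choice C ?Q le lin F K" using less.hyps[OF _ Q] less.prems(2) by blast
    interpret K: bifunctor_cells A B C H ?Q K
      using bifunctor_cellsI[OF z _ Q K] less.prems(2) by blast
    obtain a b where ab: "y = (a, b)" by (cases y)
    have T: "a \<in> tree A" "b \<in> tree B" using y(1) less.prems(1) ab by (auto simp: sieve_def)
    have "rect a b \<subseteq> P"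
      using less.prems(1) y(1) ab A.under_tree_subset B.under_tree_subset
      unfolding sieve_def under_prod_ord[symmetric] under_def prod_ord_def by blast
    then have D: "boundary A B (a, b) \<subseteq> ?Q" using under_boundary[OF T] ab by auto
    have "insert y ?Q = P" using y(1) by blast
    moreover have "\<exists>K'. cell_choice C (insert y ?Q) le lin F K'"
      unfolding ab
    proof (rule cell_choice_insert[OF _ _ K[unfolded ab]])
      show "poset_diagram C (insert (a, b) (P - {(a, b)})) le lin F"
        using poset_diagram_under[OF z less.prems(2)] y(1) ab by (simp add: insert_absorb)
      show "(x, (a, b)) \<in> lin" if "x \<in> P - {(a, b)}" for x using y(2) that ab by simp
      note e = K.boundary_underS[OF T D, unfolded ab]
      show "bi_gap A B C H a b \<in> hom C (omap F (a, b)) (fst (K (underS le (a, b) \<inter> (P - {(a, b)}))))"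
        using K.bi_gap_hom[OF T D] by (simp add: e F_sel)
      show "snd (K (underS le (a, b) \<inter> (P - {(a, b)}))) x \<cdot>\<^bsub>C\<^esub> bi_gap A B C H a b = amap F ((a, b), x)"
        if "x \<in> underS le (a, b) \<inter> (P - {(a, b)})" for x
        using K.bi_gap_leg[OF T D] that unfolding e .
      show "display_map1 C (bi_gap A B C H a b)" using gap T .
    qed simp
    ultimately show ?thesis by simp
  qed
qed

end

text \<open>A commutative square over two \<open>proj\<close> maps, not assumed to be a pullback:
  corner maps depend on no more than this, and it covers identities as well as the squares in
  \<open>Qsq\<close>.\<close>

definition lies_over :: "('o, 'm, 'z) precontextual_scheme \<Rightarrow> 'o \<Rightarrow> 'o \<Rightarrow> 'm \<Rightarrow> 'm \<Rightarrow> bool" where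
  "lies_over D x y f g \<longleftrightarrow> x \<in> tree D \<and> y \<in> tree D \<and> f \<in> hom D x y \<and> g \<in> hom D (ft D x) (ft D y) \<and>
    proj D y \<cdot>\<^bsub>D\<^esub> f = g \<cdot>\<^bsub>D\<^esub> proj D x"

locale cellular_bifunctor = bifunctor +
  assumes cellular: "cellular C (tree A \<times> tree B) (prod_ord (tree_ord A) (tree_ord B))
    (lex_lin (tree_ord A) (tree_ord B)) (tree_restrict A B H)"
begin

text \<open>Resolves the descriptions in \<open>cell_cone\<close>: by
  \<open>cell_diagram_unique\<close> any principal sieve containing \<open>X\<close> and any choice
  on it give the same apex and legs, so one choice at hand stands for all.\<close>

lemma multi_cone_eq:
  assumes z: "z \<in> T" and K: "cell_choice C (under le z) le lin F K"
    and X: "sieve T le X" "X \<subseteq> under le z"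
  shows "fst (multi_cone A B C H X) = fst (K X)"
    "x \<in> X \<Longrightarrow> snd (multi_cone A B C H X) x = snd (K X) x"
proof -
  have cells: "cell_diagram C (under le z') le lin F K' \<and> sieve (under le z') le X"
    if "z' \<in> T" "X \<subseteq> under le z'" "cell_choice C (under le z') le lin F K'" for z' K'
    using bifunctor_cellsI[OF that(1) subset_refl sieve_under_T that(3)] that(2) X(1) sieve_under_T[of z']
    unfolding bifunctor_cells_def sieve_def by blast
  have *: "fst (K' X) = fst (K X) \<and> (\<forall>x \<in> X. snd (K' X) x = snd (K X) x)"
    if "z' \<in> T" "X \<subseteq> under le z'" "cell_choice C (under le z') le lin F K'" for z' K'
    using cell_diagram_unique cells[OF z X(2) K] cells[OF that] by blast
  show "fst (multi_cone A B C H X) = fst (K X)"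
    unfolding multi_cone_def cell_cone_def fst_conv
    by (rule the_equality) (use z K X * in blast)+
  show "snd (multi_cone A B C H X) x = snd (K X) x" if x: "x \<in> X"
    unfolding multi_cone_def cell_cone_def snd_conv
    by (rule the_equality) (use z K X * x in blast)+
qed

context
  fixes a b assumes a: "a \<in> tree A" and b: "b \<in> tree B"
begin

lemma cells:
  obtains K where "bifunctor_cells A B C H (rect a b) K" "cell_choice C (under le (a, b)) le lin F K"
    "boundary A B (a, b) \<subseteq> rect a b" "(a, b) \<in> rect a b"
proof -
  have z: "(a, b) \<in> T" using a b by simp
  then obtain K where K: "cell_choice C (under le (a, b)) le lin F K"
    using cellular by (auto simp: cellular_def finite_cellular_def)
  have "bifunctor_cells A B C H (rect a b) K"
    using bifunctor_cellsI[OF z subset_refl sieve_under_T K] unfolding under_prod_ord .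
  then show ?thesis using that K under_boundary[OF a b] by blast
qed

lemma boundary_map_eq: "boundary_map A B C H (a, b) = bi_gap A B C H a b"
  and boundary_square_eq: "boundary_square A B C H a b = bi_corner A B C H a b"
  and bi_gap_display: "display_map1 C (bi_gap A B C H a b)"
  and bi_corner_distinguished: "distinguished C (bi_corner A B C H a b)"
  and bi_corner_sides: "right (bi_corner A B C H a b) = amap H (proj A a, Ident B (ft B b))"
    "bottom (bi_corner A B C H a b) = amap H (Ident A (ft A a), proj B b)"
  and bi_gap_in_hom: "bi_gap A B C H a b \<in> hom C (omap H (a, b)) (Dom C (top (bi_corner A B C H a b)))"
  and bi_corner_left_gap: "left (bi_corner A B C H a b) \<cdot>\<^bsub>C\<^esub> bi_gap A B C H a b = amap H (proj A a, Ident B b)"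
proof -
  obtain K where K: "bifunctor_cells A B C H (rect a b) K" "cell_choice C (under le (a, b)) le lin F K"
    and D: "boundary A B (a, b) \<subseteq> rect a b" and ab: "(a, b) \<in> rect a b" by (rule cells)
  interpret K: bifunctor_cells A B C H "rect a b" K by fact
  have z: "(a, b) \<in> T" using a b by simp
  note h = A.tree_homs[OF a] B.tree_homs[OF b]
  let ?D = "boundary A B (a, b)"
  have sD: "sieve (rect a b) le ?D" using K.sieve_boundary[OF a b D] .
  have D': "sieve T le ?D" "?D \<subseteq> under le (a, b)" "sieve T le (rect a b)"
    using sD K.sieve_iff D sieve_under_T[of "(a, b)"] unfolding under_prod_ord by blast+
  note mD = multi_cone_eq[OF z K(2) D'(1,2)]
    and mU = multi_cone_eq[OF z K(2) D'(3)[folded under_prod_ord] subset_refl, unfolded under_prod_ord]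
  show "boundary_map A B C H (a, b) = bi_gap A B C H a b"
    unfolding boundary_map_def K.bi_gap_res[OF a b D ab, symmetric] under_prod_ord
    using mD mU D by (intro restrict_map_cong) auto
  have r: "boundary_proj A B C H (a, b) (u, v) = K.res ?D (rect u v)"
    if "rect u v \<subseteq> ?D" "u \<in> Obj A" "v \<in> Obj B" for u v
  proof -
    have "(u, v) \<in> ?D" if "(u, v) \<in> T"
      using that \<open>rect u v \<subseteq> ?D\<close> A.tree_refl B.tree_refl by (auto simp: under_def)
    then show ?thesis
      using K.res_rect[OF sD that(2,3,1)] mD by (simp add: boundary_proj_def)
  qed
  note c = K.bi_corner_eq[OF a b D] and bd = K.bd_rect[OF a b D]
  show "boundary_square A B C H a b = bi_corner A B C H a b"
    unfolding boundary_square_def c using r bd h by simp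
  \<comment> \<open>The cell \<open>(a, b)\<close> is attached last to its own boundary, so the
    length-1 condition of the cell choice applies.\<close>
  have "display_map1 C (K.res (rect a b) ?D)"
    using K.res_display[OF sD K.sieve_rect[OF subset_refl] D, of "(a, b)"] under_boundary[OF a b] D ab
      K.le_lin by (auto simp: boundary_def underS_def)
  then show "display_map1 C (bi_gap A B C H a b)" using K.bi_gap_res[OF a b D ab] by simp
  show "distinguished C (bi_corner A B C H a b)" unfolding c using K.corner_distinguished[OF a b D] .
  show "right (bi_corner A B C H a b) = amap H (proj A a, Ident B (ft B b))"
    "bottom (bi_corner A B C H a b) = amap H (Ident A (ft A a), proj B b)" unfolding c by simp_all
  show "bi_gap A B C H a b \<in> hom C (omap H (a, b)) (Dom C (top (bi_corner A B C H a b)))"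
    using K.bi_gap_hom[OF a b D] K.corner_hom[OF a b D] unfolding c by (simp add: hom_def)
  show "left (bi_corner A B C H a b) \<cdot>\<^bsub>C\<^esub> bi_gap A B C H a b = amap H (proj A a, Ident B b)"
    using K.bi_gap_left[OF a b D] unfolding c by simp
qed

end

text \<open>The pulled back factor is the left side of a distinguished square, hence a display map
  by construction, so no induction on the length of \<open>b\<close> is involved. For
  \<open>b\<close> of length 0 the map is the identity of the terminal object.\<close>

lemma display_H_proj:
  assumes "a \<in> tree A" "b \<in> Obj B"
  shows "display_map C (amap H (proj A a, Ident B b))"
proof (cases "b \<in> tree B")
  case True
  have "display_map C (left (bi_corner A B C H a b))"
    using C.distinguished_display[OF bi_corner_distinguished[OF assms(1) True]] by blast
  moreover have "display_map C (bi_gap A B C H a b)"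
    using bi_gap_display[OF assms(1) True] by (simp add: display_map1_def)
  moreover have "Cod C (bi_gap A B C H a b) = Dom C (left (bi_corner A B C H a b))"
    using bi_gap_in_hom[OF assms(1) True] C.distinguished_display[OF bi_corner_distinguished[OF assms(1) True]]
    by (simp add: comm_square_def hom_def)
  ultimately show ?thesis
    using C.display_map_Comp bi_corner_left_gap[OF assms(1) True] by metis
next
  case False
  note h = A.tree_homs[OF assms(1)]
  have "omap H (a, b) = one C" "omap H (ft A a, b) = one C"
    using H_one h(1,2) assms(2) B.not_tree[OF assms(2)] False by auto
  then have "amap H (proj A a, Ident B b) = Ident C (one C)"
    using H_hom[OF h(3) B.Ident_in_hom[OF assms(2)]] C.to_one_eq C.Ident_in_hom C.one_in_Obj by metis
  then show ?thesis using display_map.Ident[of "one C" C] C.one_in_Obj by simp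
qed

lemma display_H:
  assumes "display_map A d" "b \<in> Obj B" shows "display_map C (amap H (d, Ident B b))"
  using assms(1)
proof (induction rule: display_map.induct)
  case (Ident a)
  then show ?case using H_Ident[OF _ assms(2)] display_map.Ident[OF H_Obj[OF _ assms(2)]] by simp
next
  case (Comp_proj a d)
  have a: "a \<in> tree A" using Comp_proj by (simp add: tree_def)
  note h = A.tree_homs[OF a] and i = B.Ident_in_hom[OF assms(2)]
  have d: "d \<in> hom A (ft A a) (Cod A d)" using A.display_map_hom[OF Comp_proj(3)] Comp_proj(4) by simp
  have "amap H (d, Ident B b) \<cdot>\<^bsub>C\<^esub> amap H (proj A a, Ident B b) = amap H (d \<cdot>\<^bsub>A\<^esub> proj A a, Ident B b)"
    using H_Comp[OF h(3) d i i] B.Comp_Ident_left[OF i] by simp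
  moreover have "Cod C (amap H (proj A a, Ident B b)) = Dom C (amap H (d, Ident B b))"
    using H_hom[OF h(3) i] H_hom[OF d i] by (simp add: hom_def)
  ultimately show ?case
    using C.display_map_Comp[OF display_H_proj[OF a assms(2)] Comp_proj.IH] by simp
qed

abbreviation corner_map where
  "corner_map x1 x2 y1 y2 f1 g1 f2 g2 \<equiv>
    pullback_map C (bi_corner A B C H x1 x2) (bi_corner A B C H y1 y2) (amap H (f1, g2)) (amap H (g1, f2))"

lemma corner_map:
  assumes "lies_over A x1 y1 f1 g1" "lies_over B x2 y2 f2 g2"
  shows "corner_map x1 x2 y1 y2 f1 g1 f2 g2
      \<in> hom C (Dom C (top (bi_corner A B C H x1 x2))) (Dom C (top (bi_corner A B C H y1 y2)))"
    "top (bi_corner A B C H y1 y2) \<cdot>\<^bsub>C\<^esub> corner_map x1 x2 y1 y2 f1 g1 f2 g2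
      = amap H (f1, g2) \<cdot>\<^bsub>C\<^esub> top (bi_corner A B C H x1 x2)"
    "left (bi_corner A B C H y1 y2) \<cdot>\<^bsub>C\<^esub> corner_map x1 x2 y1 y2 f1 g1 f2 g2
      = amap H (g1, f2) \<cdot>\<^bsub>C\<^esub> left (bi_corner A B C H x1 x2)"
proof -
  have 1: "x1 \<in> tree A" "y1 \<in> tree A" "f1 \<in> hom A x1 y1" "g1 \<in> hom A (ft A x1) (ft A y1)"
      "proj A y1 \<cdot>\<^bsub>A\<^esub> f1 = g1 \<cdot>\<^bsub>A\<^esub> proj A x1"
    and 2: "x2 \<in> tree B" "y2 \<in> tree B" "f2 \<in> hom B x2 y2" "g2 \<in> hom B (ft B x2) (ft B y2)"
      "proj B y2 \<cdot>\<^bsub>B\<^esub> f2 = g2 \<cdot>\<^bsub>B\<^esub> proj B x2"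
    using assms by (auto simp: lies_over_def)
  note hx1 = A.tree_homs[OF 1(1)] and hy1 = A.tree_homs[OF 1(2)]
    and hx2 = B.tree_homs[OF 2(1)] and hy2 = B.tree_homs[OF 2(2)]
  note sx = bi_corner_sides[OF 1(1) 2(1)] and sy = bi_corner_sides[OF 1(2) 2(2)]
  have "amap H (f1, g2) \<in> hom C (Dom C (right (bi_corner A B C H x1 x2))) (Dom C (right (bi_corner A B C H y1 y2)))"
    "amap H (g1, f2) \<in> hom C (Dom C (bottom (bi_corner A B C H x1 x2))) (Dom C (bottom (bi_corner A B C H y1 y2)))"
    "amap H (g1, g2) \<in> hom C (Cod C (right (bi_corner A B C H x1 x2))) (Cod C (right (bi_corner A B C H y1 y2)))"
    unfolding sx sy
    using H_hom[OF 1(3) 2(4)] H_hom[OF 1(4) 2(3)] H_hom[OF 1(4) 2(4)] H_hom[OF hx1(3) hx2(5)]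
      H_hom[OF hy1(3) hy2(5)] H_hom[OF hx1(5) hx2(3)] H_hom[OF hy1(5) hy2(3)] by (simp_all add: hom_def)
  moreover have "right (bi_corner A B C H y1 y2) \<cdot>\<^bsub>C\<^esub> amap H (f1, g2) = amap H (g1, g2) \<cdot>\<^bsub>C\<^esub> right (bi_corner A B C H x1 x2)"
    unfolding sx sy
    using H_Comp[OF 1(3) hy1(3) 2(4) hy2(5)] H_Comp[OF hx1(3) 1(4) hx2(5) 2(4)] 1(5)
      B.Comp_Ident_left[OF 2(4)] B.Comp_Ident_right[OF 2(4)] by simp
  moreover have "bottom (bi_corner A B C H y1 y2) \<cdot>\<^bsub>C\<^esub> amap H (g1, f2) = amap H (g1, g2) \<cdot>\<^bsub>C\<^esub> bottom (bi_corner A B C H x1 x2)"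
    unfolding sx sy
    using H_Comp[OF 1(4) hy1(5) 2(3) hy2(3)] H_Comp[OF hx1(5) 1(4) hx2(3) 2(4)] 2(5)
      A.Comp_Ident_left[OF 1(4)] A.Comp_Ident_right[OF 1(4)] by simp
  ultimately show "corner_map x1 x2 y1 y2 f1 g1 f2 g2
      \<in> hom C (Dom C (top (bi_corner A B C H x1 x2))) (Dom C (top (bi_corner A B C H y1 y2)))"
    "top (bi_corner A B C H y1 y2) \<cdot>\<^bsub>C\<^esub> corner_map x1 x2 y1 y2 f1 g1 f2 g2
      = amap H (f1, g2) \<cdot>\<^bsub>C\<^esub> top (bi_corner A B C H x1 x2)"
    "left (bi_corner A B C H y1 y2) \<cdot>\<^bsub>C\<^esub> corner_map x1 x2 y1 y2 f1 g1 f2 g2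
      = amap H (g1, f2) \<cdot>\<^bsub>C\<^esub> left (bi_corner A B C H x1 x2)"
    using C.pullback_map[OF C.distinguished_pullback[OF bi_corner_distinguished[OF 1(2) 2(2)]]]
      C.distinguished_display[OF bi_corner_distinguished[OF 1(1) 2(1)]] by blast+
qed

text \<open>Functoriality of the corner, checked on its two projections. It identifies the bottom of
  a pasted square with the corner map of the composites.\<close>

lemma corner_map_Comp:
  assumes "lies_over A x1 y1 f1 g1" "lies_over B x2 y2 f2 g2"
    "lies_over A y1 z1 f1' g1'" "lies_over B y2 z2 f2' g2'"
  shows "corner_map y1 y2 z1 z2 f1' g1' f2' g2' \<cdot>\<^bsub>C\<^esub> corner_map x1 x2 y1 y2 f1 g1 f2 g2
    = corner_map x1 x2 z1 z2 (f1' \<cdot>\<^bsub>A\<^esub> f1) (g1' \<cdot>\<^bsub>A\<^esub> g1) (f2' \<cdot>\<^bsub>B\<^esub> f2) (g2' \<cdot>\<^bsub>B\<^esub> g2)"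
proof (rule C.pullback_map_eqI[symmetric])
  note p = corner_map[OF assms(1,2)] and q = corner_map[OF assms(3,4)]
  have 1: "x1 \<in> tree A" "y1 \<in> tree A" "z1 \<in> tree A" "x2 \<in> tree B" "y2 \<in> tree B" "z2 \<in> tree B"
    and f: "f1 \<in> hom A x1 y1" "g1 \<in> hom A (ft A x1) (ft A y1)" "f2 \<in> hom B x2 y2" "g2 \<in> hom B (ft B x2) (ft B y2)"
    and f': "f1' \<in> hom A y1 z1" "g1' \<in> hom A (ft A y1) (ft A z1)" "f2' \<in> hom B y2 z2" "g2' \<in> hom B (ft B y2) (ft B z2)"
    using assms by (auto simp: lies_over_def)
  show "is_pullback C (bi_corner A B C H z1 z2)"
    using C.distinguished_pullback[OF bi_corner_distinguished] 1 by blast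
  show "corner_map y1 y2 z1 z2 f1' g1' f2' g2' \<cdot>\<^bsub>C\<^esub> corner_map x1 x2 y1 y2 f1 g1 f2 g2
      \<in> hom C (Dom C (top (bi_corner A B C H x1 x2))) (Dom C (top (bi_corner A B C H z1 z2)))"
    using C.Comp_in_hom[OF p(1) q(1)] .
  have top_left: "top (bi_corner A B C H a b) \<in> hom C (Dom C (top (bi_corner A B C H a b))) (omap H (a, ft B b))"
    "left (bi_corner A B C H a b) \<in> hom C (Dom C (top (bi_corner A B C H a b))) (omap H (ft A a, b))"
    if "a \<in> tree A" "b \<in> tree B" for a b
    using C.distinguished_display[OF bi_corner_distinguished[OF that]] bi_corner_sides[OF that]
      H_hom[OF A.tree_homs(3)[OF that(1)] B.tree_homs(5)[OF that(2)]]
      H_hom[OF A.tree_homs(5)[OF that(1)] B.tree_homs(3)[OF that(2)]]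
    by (simp_all add: comm_square_def hom_def)
  note tx = top_left[OF 1(1,4)] and ty = top_left[OF 1(2,5)] and tz = top_left[OF 1(3,6)]
  show "top (bi_corner A B C H z1 z2) \<cdot>\<^bsub>C\<^esub>
      (corner_map y1 y2 z1 z2 f1' g1' f2' g2' \<cdot>\<^bsub>C\<^esub> corner_map x1 x2 y1 y2 f1 g1 f2 g2)
    = amap H (f1' \<cdot>\<^bsub>A\<^esub> f1, g2' \<cdot>\<^bsub>B\<^esub> g2) \<cdot>\<^bsub>C\<^esub> top (bi_corner A B C H x1 x2)"
    using C.Comp_assoc[OF p(1) q(1) tz(1)] q(2) C.Comp_assoc[OF p(1) ty(1) H_hom[OF f'(1,4)]] p(2)
      C.Comp_assoc[OF tx(1) H_hom[OF f(1,4)] H_hom[OF f'(1,4)]] H_Comp[OF f(1) f'(1) f(4) f'(4)] by simp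
  show "left (bi_corner A B C H z1 z2) \<cdot>\<^bsub>C\<^esub>
      (corner_map y1 y2 z1 z2 f1' g1' f2' g2' \<cdot>\<^bsub>C\<^esub> corner_map x1 x2 y1 y2 f1 g1 f2 g2)
    = amap H (g1' \<cdot>\<^bsub>A\<^esub> g1, f2' \<cdot>\<^bsub>B\<^esub> f2) \<cdot>\<^bsub>C\<^esub> left (bi_corner A B C H x1 x2)"
    using C.Comp_assoc[OF p(1) q(1) tz(2)] q(3) C.Comp_assoc[OF p(1) ty(2) H_hom[OF f'(2,3)]] p(3)
      C.Comp_assoc[OF tx(2) H_hom[OF f(2,3)] H_hom[OF f'(2,3)]] H_Comp[OF f(2) f'(2) f(3) f'(3)] by simp
qed

end

section \<open>Comparison of the two notions\<close>

lemma (in precontextual_category) lies_over_Qsq: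
  "S \<in> Qsq C \<Longrightarrow> lies_over C (Dom C (top S)) (Cod C (top S)) (top S) (bottom S)"
  using Qsq_tree unfolding lies_over_def by blast

lemma (in precontextual_category) lies_over_Ident:
  "a \<in> tree C \<Longrightarrow> lies_over C a a (Ident C a) (Ident C (ft C a))"
  using tree_homs[of a] Comp_Ident_left[OF tree_homs(3)] Comp_Ident_right[OF tree_homs(3)]
  unfolding lies_over_def by simp

context cellular_bifunctor begin

lemma multimorphism_iff:
  "multimorphism A B C H \<longleftrightarrow>
    (\<forall>S1 \<in> Qsq A. \<forall>S2 \<in> Qsq B.
      distinguished C
        (Sq (amap H (top S1, top S2))
            (bi_gap A B C H (Dom A (top S1)) (Dom B (top S2)))
            (bi_gap A B C H (Cod A (top S1)) (Cod B (top S2)))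
            (corner_map (Dom A (top S1)) (Dom B (top S2)) (Cod A (top S1)) (Cod B (top S2))
              (top S1) (bottom S1) (top S2) (bottom S2))))"
  unfolding multimorphism_def Let_def
  using functor_H H_one cellular boundary_map_eq boundary_square_eq A.Qsq_tree(1,2) B.Qsq_tree(1,2) by simp

text \<open>In this locale conditions (i) and (ii) are consequences of \<open>H_one\<close> and
  cellularity, through \<open>display_H\<close> and \<open>bi_gap_display\<close>, so just the
  squares of (iii) and (iv) remain.\<close>

lemma bimorphism_iff:
  "bimorphism A B C H \<longleftrightarrow>
    (\<forall>b \<in> tree B. \<forall>S \<in> Qsq A.
      distinguished C
        (Sq (amap H (top S, Ident B b))
            (bi_gap A B C H (Dom A (top S)) b) (bi_gap A B C H (Cod A (top S)) b)
            (corner_map (Dom A (top S)) b (Cod A (top S)) b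
              (top S) (bottom S) (Ident B b) (Ident B (ft B b))))) \<and>
    (\<forall>a \<in> tree A. \<forall>S \<in> Qsq B.
      distinguished C
        (Sq (amap H (Ident A a, top S))
            (bi_gap A B C H a (Dom B (top S))) (bi_gap A B C H a (Cod B (top S)))
            (corner_map a (Dom B (top S)) a (Cod B (top S))
              (Ident A a) (Ident A (ft A a)) (top S) (bottom S))))"
proof -
  have 1: "amap H (f, Ident B b) = Ident C (one C)" if "b \<in> Obj B" "len B b = 0" "f \<in> Arr A" for b f
  proof -
    have "amap H (f, Ident B b) \<in> hom C (omap H (Dom A f, b)) (omap H (Cod A f, b))"
      using H_hom[OF A.Arr_hom[OF that(3)] B.Ident_in_hom[OF that(1)]] .
    then show ?thesis
      using H_one that A.Dom_in_Obj A.Cod_in_Obj C.to_one_eq C.Ident_in_hom C.one_in_Obj by metis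
  qed
  have 2: "relative_display1 C (bi_square A B H a b)"
    if "a \<in> Obj A" "b \<in> Obj B" "1 \<le> len A a" "1 \<le> len B b" for a b
  proof -
    have t: "a \<in> tree A" "b \<in> tree B" using that by (simp_all add: tree_def)
    show ?thesis
      using bi_square_comm[OF t] bi_gap_display[OF t] display_H_proj[OF t(1)] that(2) B.ft_in_Obj[OF that(2)]
      by (simp add: relative_display1_def bi_gap_def bi_square_def)
  qed
  show ?thesis
    unfolding bimorphism_def Let_def
    using functor_H H_one display_H 1 2 by (auto simp: tree_def)
qed

lemma bimorphism_iff_multimorphism: "bimorphism A B C H \<longleftrightarrow> multimorphism A B C H"
proof
  assume bi: "bimorphism A B C H"
  show "multimorphism A B C H"
    unfolding multimorphism_iff
  proof (intro ballI)
    fix S1 S2 assume S1: "S1 \<in> Qsq A" and S2: "S2 \<in> Qsq B"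
    let ?x1 = "Dom A (top S1)" and ?y1 = "Cod A (top S1)"
      and ?x2 = "Dom B (top S2)" and ?y2 = "Cod B (top S2)"
    note t1 = A.Qsq_tree[OF S1] and t2 = B.Qsq_tree[OF S2]
    note l1 = A.lies_over_Ident[OF t1(1)] A.lies_over_Qsq[OF S1]
      and l2 = B.lies_over_Qsq[OF S2] B.lies_over_Ident[OF t2(2)]
    \<comment> \<open>Move in the second variable at \<open>?x1\<close>, then in the first at
      \<open>?y2\<close>. Both squares are brought into \<open>Qsq\<close>, the class that the
      axioms close under horizontal composition.\<close>
    have "Sq (amap H (Ident A ?x1, top S2)) (bi_gap A B C H ?x1 ?x2) (bi_gap A B C H ?x1 ?y2)
        (corner_map ?x1 ?x2 ?x1 ?y2 (Ident A ?x1) (Ident A (ft A ?x1)) (top S2) (bottom S2)) \<in> Qsq C"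
      using bi[unfolded bimorphism_iff] S2 t1(1) bi_gap_display[OF t1(1) t2(2)]
      by (intro C.distinguished_Qsq) auto
    moreover have "Sq (amap H (top S1, Ident B ?y2)) (bi_gap A B C H ?x1 ?y2) (bi_gap A B C H ?y1 ?y2)
        (corner_map ?x1 ?y2 ?y1 ?y2 (top S1) (bottom S1) (Ident B ?y2) (Ident B (ft B ?y2))) \<in> Qsq C"
      using bi[unfolded bimorphism_iff] S1 t2(2) bi_gap_display[OF t1(2) t2(2)]
      by (intro C.distinguished_Qsq) auto
    ultimately show "distinguished C
        (Sq (amap H (top S1, top S2)) (bi_gap A B C H ?x1 ?x2) (bi_gap A B C H ?y1 ?y2)
            (corner_map ?x1 ?x2 ?y1 ?y2 (top S1) (bottom S1) (top S2) (bottom S2)))"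
      using C.Qsq_distinguished[OF C.Qsq_horizontal] corner_map_Comp[OF l1(1) l2(1) l1(2) l2(2)]
        H_Comp[OF A.tree_homs(4)[OF t1(1)] t1(3) t2(3) B.tree_homs(4)[OF t2(2)]]
        A.Comp_Ident_right[OF t1(3)] A.Comp_Ident_right[OF t1(4)]
        B.Comp_Ident_left[OF t2(3)] B.Comp_Ident_left[OF t2(4)] by metis
  qed
next
  assume m: "multimorphism A B C H"
  have id_sel: "Dom A (Ident A a) = a" "Cod A (Ident A a) = a"
    "Sq (Ident A a) (proj A a) (proj A a) (Ident A (ft A a)) \<in> Qsq A" if "a \<in> tree A" for a
    using A.tree_homs[OF that] A.Qsq_Ident[of a] by (simp_all add: hom_def)
  have id_sel': "Dom B (Ident B b) = b" "Cod B (Ident B b) = b"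
    "Sq (Ident B b) (proj B b) (proj B b) (Ident B (ft B b)) \<in> Qsq B" if "b \<in> tree B" for b
    using B.tree_homs[OF that] B.Qsq_Ident[of b] by (simp_all add: hom_def)
  show "bimorphism A B C H"
    unfolding bimorphism_iff
  proof (intro conjI ballI)
    fix b S assume b: "b \<in> tree B" and S: "S \<in> Qsq A"
    show "distinguished C
        (Sq (amap H (top S, Ident B b))
            (bi_gap A B C H (Dom A (top S)) b) (bi_gap A B C H (Cod A (top S)) b)
            (corner_map (Dom A (top S)) b (Cod A (top S)) b
              (top S) (bottom S) (Ident B b) (Ident B (ft B b))))"
      using m[unfolded multimorphism_iff, rule_format, OF S id_sel'(3)[OF b]] id_sel'(1,2)[OF b] by simp
  next
    fix a S assume a: "a \<in> tree A" and S: "S \<in> Qsq B"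
    show "distinguished C
        (Sq (amap H (Ident A a, top S))
            (bi_gap A B C H a (Dom B (top S))) (bi_gap A B C H a (Cod B (top S)))
            (corner_map a (Dom B (top S)) a (Cod B (top S))
              (Ident A a) (Ident A (ft A a)) (top S) (bottom S)))"
      using m[unfolded multimorphism_iff, rule_format, OF id_sel(3)[OF a] S] id_sel(1,2)[OF a] by simp
  qed
qed

end

lemma (in bifunctor) cellular_if_display_gap:
  assumes "\<And>a b. a \<in> tree A \<Longrightarrow> b \<in> tree B \<Longrightarrow> display_map1 C (bi_gap A B C H a b)"
  shows "cellular C T le lin F"
  unfolding cellular_def finite_cellular_def
  using finite_cellular_sieve[OF assms _ sieve_under_T subset_refl] by blast

theorem proposition5p23:
  fixes A :: "('oa, 'ma) precontextual"
    and B :: "('ob, 'mb) precontextual"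
    and C :: "('oc, 'mc) precontextual"
    and H :: "('oa \<times> 'ob, 'ma \<times> 'mb, 'oc, 'mc) functor_data"
  assumes "contextual_category A"
    and "contextual_category B"
    and "contextual_category C"
    and "is_functor (prod_category A B) C H"
  shows "bimorphism A B C H \<longleftrightarrow> multimorphism A B C H"
proof -
  \<comment> \<open>Cellularity is asked for under the hypothesis \<open>bifunctor A B C H\<close>,
    since for a bimorphism it is proved inside that locale.\<close>
  have *: "bimorphism A B C H \<longleftrightarrow> multimorphism A B C H"
    if one: "\<And>a b. a \<in> Obj A \<Longrightarrow> b \<in> Obj B \<Longrightarrow> len A a = 0 \<or> len B b = 0 \<Longrightarrow> omap H (a, b) = one C"
      and cell: "bifunctor A B C H \<Longrightarrow> cellular C (tree A \<times> tree B) (prod_ord (tree_ord A) (tree_ord B))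
        (lex_lin (tree_ord A) (tree_ord B)) (tree_restrict A B H)"
  proof -
    have "bifunctor A B C H"
      using assms one by (simp add: bifunctor_def bifunctor_axioms_def)
    then have "cellular_bifunctor A B C H"
      using cell by (simp add: cellular_bifunctor_def cellular_bifunctor_axioms_def)
    then show ?thesis by (rule cellular_bifunctor.bimorphism_iff_multimorphism)
  qed
  show ?thesis
  proof
    assume bi: "bimorphism A B C H"
    then have "display_map1 C (bi_gap A B C H a b)" if "a \<in> tree A" "b \<in> tree B" for a b
      using that by (auto simp: bimorphism_def tree_def relative_display1_def bi_gap_def)
    moreover have "omap H (a, b) = one C" if "a \<in> Obj A" "b \<in> Obj B" "len A a = 0 \<or> len B b = 0" for a b
      using bi that unfolding bimorphism_def by blast
    ultimately show "multimorphism A B C H"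
      using bi * bifunctor.cellular_if_display_gap by blast
  next
    assume m: "multimorphism A B C H"
    then show "bimorphism A B C H"
      using * unfolding multimorphism_def by blast
  qed
qed

end
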